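(* Let $N\ge1$, let $E\subset\mathfrak{LC}(\mathbb R^{2N},\mathbb R^N)$, let $D'\subset\mathbb R^N$ and $D\subset\mathbb R^{2N}$ be countable dense subsets, and let $\mathcal C=C([-1,0],\mathbb R^N)$. (i) Suppose $E$ has $L^1_{loc}$-equicontinuous $m$-bounds and $L^1_{loc}$-bounded $l_2$-bounds, and let $\Theta=\{\theta^I_j\}$ be the suitable set of moduli of continuity given by the $m$-bounds of $E$, i.e. $\theta^I_j(s)=\sup_{t\in I,\,f\in E}\int_t^{t+s}m^j_f(u)\,du$. For any sequence $(f_n)_{n\in\mathbb N}$ in $E$ converging to $f$ in $(\mathfrak{LC}(\mathbb R^{2N},\mathbb R^N),\mathcal T_{\Theta D'})$ and any sequence $(\phi_n)_{n\in\mathbb N}$ in $\mathcal C$ converging uniformly to $\phi\in\mathcal C$, one has $$\|x(\cdot,f_n,\phi_n)-x(\cdot,f,\phi)\|_{\mathcal C^{1,1}([0,T])}\xrightarrow{n\to\infty}0\qquad( * )$$ for any $[0,T]\subset I_{f,\phi}$. (ii) If $E$ has $L^1_{loc}$-bounded $l$-bounds, then $( * )$ also holds when the convergence of the sequence $(f_n)_{n\in\mathbb N}$ to $f$ is with respect to $\mathcal T_D$.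
   Context: $B_j$ is the closed ball of radius $j$ centered at the origin; $C(I,W)$ is the space of continuous functions $I\to W$. $L^1_{loc}$ is the set of real functions on $\mathbb R$ belonging to $L^1(I)$ for every compact interval $I$. For a compact interval $I$, $\mathcal C^{1,1}(I)$ is the Sobolev space of (absolutely) continuous functions $x:I\to\mathbb R^N$ with $\dot x\in L^1(I)$, normed by $\|x\|_{\mathcal C^{1,1}(I)}=\|x\|_{L^\infty(I)}+\|\dot x\|_{L^1(I)}$. $\mathfrak{LC}(\mathbb R^{2N},\mathbb R^N)$ is the set of functions $f:\mathbb R\times\mathbb R^{2N}\to\mathbb R^N$ such that: $f$ is Borel measurable; for every compact $K\subset\mathbb R^{2N}$ there are $m^K,l^K\in L^1_{loc}$ such that for a.e. $t\in\mathbb R$, $|f(t,z)|\le m^K(t)$ and $|f(t,z_1)-f(t,z_2)|\le l^K(t)|z_1-z_2|$ for all $z,z_1,z_2\in K$. Functions differing only on a negligible set are identified. Points of $\mathbb R^{2N}$ are written $(x,u)$. Optimal bounds of $f$ on $B_j\subset\mathbb R^{2N}$: $m^j_f(t)=\sup_{z\in B_j}|f(t,z)|$, $l^j_f(t)=\sup_{z_1\neq z_2\in B_j}|f(t,z_1)-f(t,z_2)|/|z_1-z_2|$, $l^j_{2,f}(t)=\sup|f(t,x,u_1)-f(t,x,u_2)|/|u_1-u_2|$ over $(x,u_1),(x,u_2)\in B_j$, $u_1\ne u_2$. $E$ has $L^1_{loc}$-equicontinuous $m$-bounds if for every $j\in\mathbb N$, $r,\varepsilon>0$ there is $\delta>0$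 with $\sup_{f\in E}\int_s^t m^j_f(u)\,du<\varepsilon$ whenever $-r\le s\le t\le r$, $t-s<\delta$. $E$ has $L^1_{loc}$-bounded $l$-bounds (resp. $l_2$-bounds) if $\sup_{f\in E}\int_{-r}^r l^j_f(t)\,dt<\infty$ (resp. $\sup_{f\in E}\int_{-r}^r l^j_{2,f}(t)\,dt<\infty$) for every $j\in\mathbb N$, $r>0$. A suitable set of moduli of continuity is a countable set $\{\theta^I_j: j\in\mathbb N,\ I=[q_1,q_2],\ q_1,q_2\in\mathbb Q\}$ of non-decreasing continuous functions $[0,\infty)\to[0,\infty)$ with $\theta^I_j(0)=0$ and $\theta^{I_1}_{j_1}\le\theta^{I_2}_{j_2}$ whenever $I_1\subseteq I_2$, $j_1\le j_2$. $\mathcal K^I_j$ is the set of $x\in C(I,B_j)$, $B_j\subset\mathbb R^N$, with $|x(t)-x(s)|\le\theta^I_j(|t-s|)$ for all $t,s\in I$. Topologies, generated by the following seminorms over all $I=[q_1,q_2]$, $q_1,q_2\in\mathbb Q$, $j\in\mathbb N$: - $\mathcal T_{\Theta D'}$: $\sup_{x\in\mathcal K^I_j}\int_I|f(t,x(t),u)|\,dt$, $u\in D'$; - $\mathcal T_D$: $\int_I|f(t,z)|\,dt$, $z\in D$. For $f\in\mathfrak{LC}(\mathbb R^{2N},\mathbb R^N)$ and $\phi\in\mathcal C$, $x(\cdot,f,\phi)$ denotes the unique maximal continuous (Carathéodory) solution, with maximal interval of definition $I_{f,\phi}=[-1,b_{f,\phi})$, of $\dot x=f(t,x(t),x(t-1))$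 for $t>0$, $x(t)=\phi(t)$ for $t\in[-1,0]$; if $b_{f,\phi}<\infty$ then $|x(t,f,\phi)|\to\infty$ as $t\to b_{f,\phi}$. Convergence on $[0,T]$ is understood for $n$ large enough that $[0,T]\subset I_{f_n,\phi_n}$, this being part of the assertion. *)

theory Defs
  imports "HOL-Analysis.Analysis"
begin

section \<open>Caratheodory functions and their optimal bounds\<close>

definition L1_loc :: "(real \<Rightarrow> real) set" where
  "L1_loc = {m. \<forall>a b. set_integrable lebesgue {a..b} m}"

text \<open>
  We work with representatives: two members of \<open>LC\<close> that agree almost everywhere on the product
  agree, for almost every \<open>t\<close>, at all points \<open>z\<close> (both being continuous in \<open>z\<close>), and so have the same
  bounds up to null sets, the same integrals below, and the same solutions.
\<close>

definition LC :: "(real \<Rightarrow> 'a::euclidean_space \<Rightarrow> 'b::euclidean_space) set" where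
  "LC = {f. (\<lambda>(t, z). f t z) \<in> borel_measurable borel \<and>
            (\<forall>K. compact K \<longrightarrow>
               (\<exists>m\<in>L1_loc. \<exists>l\<in>L1_loc. AE t in lebesgue.
                  (\<forall>z\<in>K. norm (f t z) \<le> m t) \<and>
                  (\<forall>z1\<in>K. \<forall>z2\<in>K. norm (f t z1 - f t z2) \<le> l t * norm (z1 - z2))))}"

text \<open>
  The optimal bounds take values in \<open>ennreal\<close>, since they may be infinite on a null set of times.
\<close>

definition m_bound :: "nat \<Rightarrow> (real \<Rightarrow> 'a::real_normed_vector \<Rightarrow> 'b::real_normed_vector) \<Rightarrow> real \<Rightarrow> ennreal" where
  "m_bound j f t = (SUP z\<in>cball 0 (real j). ennreal (norm (f t z)))"

definition l_bound :: "nat \<Rightarrow> (real \<Rightarrow> 'a::real_normed_vector \<Rightarrow> 'b::real_normed_vector) \<Rightarrow> real \<Rightarrow> ennreal" where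
  "l_bound j f t =
     (SUP (z1, z2) \<in> {(z1, z2). z1 \<in> cball 0 (real j) \<and> z2 \<in> cball 0 (real j) \<and> z1 \<noteq> z2}.
        ennreal (norm (f t z1 - f t z2) / norm (z1 - z2)))"

definition l2_bound ::
  "nat \<Rightarrow> (real \<Rightarrow> 'a::real_normed_vector \<times> 'c::real_normed_vector \<Rightarrow> 'b::real_normed_vector) \<Rightarrow> real \<Rightarrow> ennreal" where
  "l2_bound j f t =
     (SUP (x, u1, u2) \<in> {(x, u1, u2). (x, u1) \<in> cball 0 (real j) \<and> (x, u2) \<in> cball 0 (real j) \<and> u1 \<noteq> u2}.
        ennreal (norm (f t (x, u1) - f t (x, u2)) / norm (u1 - u2)))"

definition equicontinuous_m_bounds ::
  "(real \<Rightarrow> 'a::real_normed_vector \<Rightarrow> 'b::real_normed_vector) set \<Rightarrow> bool" where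
  "equicontinuous_m_bounds E \<longleftrightarrow>
     (\<forall>j. \<forall>r>0. \<forall>\<epsilon>>0. \<exists>\<delta>>0. \<forall>s t. - r \<le> s \<longrightarrow> s \<le> t \<longrightarrow> t \<le> r \<longrightarrow> t - s < \<delta> \<longrightarrow>
        (SUP f\<in>E. \<integral>\<^sup>+u\<in>{s..t}. m_bound j f u \<partial>lebesgue) < ennreal \<epsilon>)"

definition bounded_l_bounds ::
  "(real \<Rightarrow> 'a::real_normed_vector \<Rightarrow> 'b::real_normed_vector) set \<Rightarrow> bool" where
  "bounded_l_bounds E \<longleftrightarrow>
     (\<forall>j. \<forall>r>0. (SUP f\<in>E. \<integral>\<^sup>+t\<in>{-r..r}. l_bound j f t \<partial>lebesgue) < \<infinity>)"

definition bounded_l2_bounds ::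
  "(real \<Rightarrow> 'a::real_normed_vector \<times> 'c::real_normed_vector \<Rightarrow> 'b::real_normed_vector) set \<Rightarrow> bool" where
  "bounded_l2_bounds E \<longleftrightarrow>
     (\<forall>j. \<forall>r>0. (SUP f\<in>E. \<integral>\<^sup>+t\<in>{-r..r}. l2_bound j f t \<partial>lebesgue) < \<infinity>)"


section \<open>Moduli of continuity\<close>

definition rat_intervals :: "real set set" where
  "rat_intervals = {{q1..q2} | q1 q2. q1 \<in> \<rat> \<and> q2 \<in> \<rat> \<and> q1 \<le> q2}"

text \<open>
  A family of moduli is indexed as \<open>\<theta> j I\<close>; only the values on \<open>{0..}\<close>, for \<open>I\<close> a compact interval
  with rational endpoints, matter.
\<close>

definition suitable_moduli :: "(nat \<Rightarrow> real set \<Rightarrow> real \<Rightarrow> real) \<Rightarrow> bool" where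
  "suitable_moduli \<theta> \<longleftrightarrow>
     (\<forall>j. \<forall>I\<in>rat_intervals. mono_on {0..} (\<theta> j I) \<and> continuous_on {0..} (\<theta> j I) \<and>
        \<theta> j I ` {0..} \<subseteq> {0..} \<and> \<theta> j I 0 = 0) \<and>
     (\<forall>j1 j2. \<forall>I1\<in>rat_intervals. \<forall>I2\<in>rat_intervals. j1 \<le> j2 \<longrightarrow> I1 \<subseteq> I2 \<longrightarrow>
        (\<forall>s\<ge>0. \<theta> j1 I1 s \<le> \<theta> j2 I2 s))"

text \<open>
  The supremum is finite when \<open>E\<close> has equicontinuous \<open>m\<close>-bounds, so that \<open>enn2real\<close> then loses
  nothing; see \<open>moduli_SUP_finite\<close> and \<open>suitable_moduli_of\<close> below.
\<close>

definition moduli_of ::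
  "(real \<Rightarrow> 'a::real_normed_vector \<Rightarrow> 'b::real_normed_vector) set \<Rightarrow> nat \<Rightarrow> real set \<Rightarrow> real \<Rightarrow> real" where
  "moduli_of E j I s = enn2real (SUP (t, f) \<in> I \<times> E. \<integral>\<^sup>+u\<in>{t..t + s}. m_bound j f u \<partial>lebesgue)"

definition modulus_class ::
  "(nat \<Rightarrow> real set \<Rightarrow> real \<Rightarrow> real) \<Rightarrow> nat \<Rightarrow> real set \<Rightarrow> (real \<Rightarrow> 'a::real_normed_vector) set" where
  "modulus_class \<theta> j I =
     {x. continuous_on I x \<and> x ` I \<subseteq> cball 0 (real j) \<and>
         (\<forall>t\<in>I. \<forall>s\<in>I. norm (x t - x s) \<le> \<theta> j I \<bar>t - s\<bar>)}"


section \<open>Topologies on the space of Caratheodory functions\<close>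

text \<open>
  The topology on \<open>LC\<close> with the translated seminorm balls as a subbasis. The seminorms have values in
  \<open>ennreal\<close>; the two families considered below are finite on \<open>LC\<close>.
\<close>

definition LC_topology ::
  "((real \<Rightarrow> 'a::euclidean_space \<Rightarrow> 'b::euclidean_space) \<Rightarrow> ennreal) set \<Rightarrow> (real \<Rightarrow> 'a \<Rightarrow> 'b) topology" where
  "LC_topology P =
     topology_generated_by
       {{g \<in> LC. p (\<lambda>t z. g t z - f t z) < ennreal \<epsilon>} | p f \<epsilon>. p \<in> P \<and> f \<in> LC \<and> 0 < \<epsilon>}"

definition T_Theta ::
  "(nat \<Rightarrow> real set \<Rightarrow> real \<Rightarrow> real) \<Rightarrow> 'c::euclidean_space set \<Rightarrow>
   (real \<Rightarrow> 'a::euclidean_space \<times> 'c \<Rightarrow> 'b::euclidean_space) topology" where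
  "T_Theta \<theta> D' =
     LC_topology {\<lambda>g. SUP x\<in>modulus_class \<theta> j I. \<integral>\<^sup>+t\<in>I. ennreal (norm (g t (x t, u))) \<partial>lebesgue
                  | j I u. I \<in> rat_intervals \<and> u \<in> D'}"

definition T_D :: "'a::euclidean_space set \<Rightarrow> (real \<Rightarrow> 'a \<Rightarrow> 'b::euclidean_space) topology" where
  "T_D D =
     LC_topology {\<lambda>g. \<integral>\<^sup>+t\<in>I. ennreal (norm (g t z)) \<partial>lebesgue | I z. I \<in> rat_intervals \<and> z \<in> D}"


section \<open>Solutions of the delay equation\<close>

text \<open>
  The usual definition through finite families of non-overlapping compact subintervals \<open>k\<close> of \<open>S\<close>,
  with endpoints \<open>Inf k\<close> and \<open>Sup k\<close>.
\<close>

definition absolutely_continuous_on :: "real set \<Rightarrow> (real \<Rightarrow> 'a::real_normed_vector) \<Rightarrow> bool" where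
  "absolutely_continuous_on S x \<longleftrightarrow>
     (\<forall>\<epsilon>>0. \<exists>\<delta>>0. \<forall>d T. d division_of T \<longrightarrow> T \<subseteq> S \<longrightarrow> (\<Sum>k\<in>d. Sup k - Inf k) < \<delta> \<longrightarrow>
        (\<Sum>k\<in>d. norm (x (Sup k) - x (Inf k))) < \<epsilon>)"

text \<open>
  Since \<open>x\<close> is continuous, its supremum is its essential supremum; an absolutely continuous \<open>x\<close> has a
  derivative almost everywhere on \<open>I\<close>, which is its weak derivative.
\<close>

definition C11_norm :: "real set \<Rightarrow> (real \<Rightarrow> 'a::real_normed_vector) \<Rightarrow> ennreal" where
  "C11_norm I x =
     (SUP t\<in>I. ennreal (norm (x t))) +
     (\<integral>\<^sup>+t\<in>I. ennreal (norm (vector_derivative x (at t within I))) \<partial>lebesgue)"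

text \<open>
  \<open>x\<close> solves \<open>x'(t) = f(t, x(t), x(t - 1))\<close> on \<open>[-1, b)\<close> with initial datum \<open>\<phi>\<close> on \<open>[-1, 0]\<close>;
  its values outside \<open>[-1, b)\<close> are irrelevant.
\<close>

definition dde_solution ::
  "(real \<Rightarrow> 'a::euclidean_space \<times> 'a \<Rightarrow> 'a) \<Rightarrow> (real \<Rightarrow> 'a) \<Rightarrow> ereal \<Rightarrow> (real \<Rightarrow> 'a) \<Rightarrow> bool" where
  "dde_solution f \<phi> b x \<longleftrightarrow>
     0 < b \<and>
     continuous_on {t. -1 \<le> t \<and> ereal t < b} x \<and>
     (\<forall>t\<in>{-1..0}. x t = \<phi> t) \<and>
     (\<forall>T\<ge>0. ereal T < b \<longrightarrow> absolutely_continuous_on {0..T} x) \<and>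
     (AE t in lebesgue. 0 < t \<and> ereal t < b \<longrightarrow>
        (x has_vector_derivative f t (x t, x (t - 1))) (at t))"

definition maximal_dde_solution ::
  "(real \<Rightarrow> 'a::euclidean_space \<times> 'a \<Rightarrow> 'a) \<Rightarrow> (real \<Rightarrow> 'a) \<Rightarrow> ereal \<Rightarrow> (real \<Rightarrow> 'a) \<Rightarrow> bool" where
  "maximal_dde_solution f \<phi> b x \<longleftrightarrow>
     dde_solution f \<phi> b x \<and>
     \<not> (\<exists>c y. b < c \<and> dde_solution f \<phi> c y \<and> (\<forall>t. -1 \<le> t \<longrightarrow> ereal t < b \<longrightarrow> y t = x t))"

definition solutions_converge ::
  "(nat \<Rightarrow> real \<Rightarrow> 'a::euclidean_space \<times> 'a \<Rightarrow> 'a) \<Rightarrow> (nat \<Rightarrow> real \<Rightarrow> 'a) \<Rightarrow>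
   (real \<Rightarrow> 'a \<times> 'a \<Rightarrow> 'a) \<Rightarrow> (real \<Rightarrow> 'a) \<Rightarrow> bool" where
  "solutions_converge fn \<phi>n f \<phi> \<longleftrightarrow>
     (\<forall>bn xn b x.
        (\<forall>n. maximal_dde_solution (fn n) (\<phi>n n) (bn n) (xn n)) \<longrightarrow>
        maximal_dde_solution f \<phi> b x \<longrightarrow>
        (\<forall>T\<ge>0. ereal T < b \<longrightarrow>
           (\<forall>\<^sub>F n in sequentially. ereal T < bn n) \<and>
           (\<lambda>n. C11_norm {0..T} (\<lambda>t. xn n t - x t)) \<longlonglongrightarrow> 0))"


section \<open>The moduli given by equicontinuous bounds are suitable\<close>

lemma m_bound_AE_measurable:
  fixes f :: "real \<Rightarrow> 'a::euclidean_space \<Rightarrow> 'b::euclidean_space"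
  assumes f: "f \<in> LC"
  obtains g where "g \<in> borel_measurable lebesgue" "AE t in lebesgue. m_bound j f t = g t"
proof -
  obtain Q :: "'a set" where Q: "countable Q" "Q \<subseteq> cball 0 (real j)" "cball 0 (real j) \<subseteq> closure Q"
    using separable by blast
  have fb: "(\<lambda>(t, z). f t z) \<in> borel_measurable borel" using f by (simp add: LC_def)
  define g where "g = (\<lambda>t. SUP z\<in>Q. ennreal (norm (f t z)))"
  have fz: "(\<lambda>t. f t z) \<in> borel_measurable borel" for z
  proof -
    have "(\<lambda>t. (t, z)) \<in> borel_measurable borel"
      by (intro borel_measurable_continuous_onI continuous_intros)
    from measurable_compose[OF this fb] show ?thesis by simp
  qed
  have "g \<in> borel_measurable borel"
    unfolding g_def using fz Q(1) by (intro borel_measurable_SUP) auto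
  then have g: "g \<in> borel_measurable lebesgue"
    by (simp add: measurable_completion)
  from f obtain m l where "AE t in lebesgue.
      (\<forall>z\<in>cball 0 (real j). norm (f t z) \<le> m t) \<and>
      (\<forall>z1\<in>cball 0 (real j). \<forall>z2\<in>cball 0 (real j). norm (f t z1 - f t z2) \<le> l t * norm (z1 - z2))"
    unfolding LC_def using compact_cball by blast
  then have "AE t in lebesgue. m_bound j f t = g t"
  proof eventually_elim
    case (elim t)
    have "(max 0 (l t))-lipschitz_on (cball 0 (real j)) (f t)"
    proof (rule lipschitz_onI)
      fix x y :: 'a assume "x \<in> cball 0 (real j)" "y \<in> cball 0 (real j)"
      then have "norm (f t x - f t y) \<le> l t * norm (x - y)" using elim by blast
      also have "\<dots> \<le> max 0 (l t) * norm (x - y)" by (intro mult_right_mono) auto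
      finally show "dist (f t x) (f t y) \<le> max 0 (l t) * dist x y" by (simp add: dist_norm)
    qed simp
    then have "continuous_on (cball 0 (real j)) (f t)" by (rule lipschitz_on_continuous_on)
    then have c: "continuous_on (cball 0 (real j)) (\<lambda>z. ennreal (norm (f t z)))"
      by (intro continuous_on_ennreal continuous_on_norm)
    show ?case
    proof (rule antisym)
      show "m_bound j f t \<le> g t" unfolding m_bound_def
      proof (rule SUP_least)
        fix z :: 'a assume z: "z \<in> cball 0 (real j)"
        then obtain q where q: "\<And>n. q n \<in> Q" "q \<longlonglongrightarrow> z"
          using Q(3) closure_sequential by (metis subsetD)
        have "(\<lambda>n. ennreal (norm (f t (q n)))) \<longlonglongrightarrow> ennreal (norm (f t z))"
          using c z q Q(2) unfolding continuous_on_sequentially comp_def by blast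
        then show "ennreal (norm (f t z)) \<le> g t"
          by (rule LIMSEQ_le_const2) (auto simp: g_def intro!: SUP_upper q)
      qed
      show "g t \<le> m_bound j f t" unfolding m_bound_def g_def
        using Q(2) by (intro SUP_subset_mono) auto
    qed
  qed
  with g show ?thesis by (rule that)
qed

lemma nn_integral_m_bound_add:
  fixes f :: "real \<Rightarrow> 'a::euclidean_space \<Rightarrow> 'b::euclidean_space"
  assumes f: "f \<in> LC" and "a \<le> b" "b \<le> c"
  shows "(\<integral>\<^sup>+u\<in>{a..c}. m_bound j f u \<partial>lebesgue) =
         (\<integral>\<^sup>+u\<in>{a..b}. m_bound j f u \<partial>lebesgue) + (\<integral>\<^sup>+u\<in>{b..c}. m_bound j f u \<partial>lebesgue)"
proof -
  obtain g where g: "g \<in> borel_measurable lebesgue"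
    and ae: "AE t in lebesgue. m_bound j f t = g t"
    using m_bound_AE_measurable[OF f] .
  have eq: "(\<integral>\<^sup>+u\<in>A. m_bound j f u \<partial>lebesgue) = (\<integral>\<^sup>+u\<in>A. g u \<partial>lebesgue)" for A
    by (rule nn_integral_cong_AE) (use ae in eventually_elim, simp)
  have "AE u in lebesgue. u \<noteq> b"
    by (simp add: AE_completion AE_lborel_singleton)
  then have "AE u in lebesgue. g u * indicator {a..c} u =
      g u * indicator {a..b} u + g u * indicator {b..c} u"
  proof eventually_elim
    case (elim u)
    then show ?case using assms(2,3) by (cases "u < b") (auto simp: indicator_def)
  qed
  then have "(\<integral>\<^sup>+u\<in>{a..c}. g u \<partial>lebesgue) =
      (\<integral>\<^sup>+u. g u * indicator {a..b} u + g u * indicator {b..c} u \<partial>lebesgue)"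
    by (rule nn_integral_cong_AE)
  also have "\<dots> = (\<integral>\<^sup>+u\<in>{a..b}. g u \<partial>lebesgue) + (\<integral>\<^sup>+u\<in>{b..c}. g u \<partial>lebesgue)"
    by (rule nn_integral_add; rule borel_measurable_times_ennreal[OF g borel_measurable_indicator]) auto
  finally show ?thesis by (simp add: eq)
qed

lemma moduli_SUP_step:
  fixes E :: "(real \<Rightarrow> 'a::euclidean_space \<Rightarrow> 'b::euclidean_space) set"
  assumes E: "E \<subseteq> LC" "equicontinuous_m_bounds E" and I: "I \<in> rat_intervals" and "0 < \<epsilon>"
  obtains \<delta> where "0 < \<delta>"
    "\<And>s s'. 0 \<le> s \<Longrightarrow> s \<le> s' \<Longrightarrow> s' \<le> S \<Longrightarrow> s' - s < \<delta> \<Longrightarrow>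
       (SUP (t, f) \<in> I \<times> E. \<integral>\<^sup>+u\<in>{t..t + s'}. m_bound j f u \<partial>lebesgue)
       \<le> (SUP (t, f) \<in> I \<times> E. \<integral>\<^sup>+u\<in>{t..t + s}. m_bound j f u \<partial>lebesgue) + ennreal \<epsilon>"
proof -
  from I obtain q1 q2 where q: "I = {q1..q2}" "q1 \<le> q2" by (auto simp: rat_intervals_def)
  define r where "r = \<bar>q1\<bar> + \<bar>q2\<bar> + \<bar>S\<bar> + 1"
  have "r > 0" by (simp add: r_def add_nonneg_pos)
  have "\<exists>\<delta>>0. \<forall>s t. - r \<le> s \<longrightarrow> s \<le> t \<longrightarrow> t \<le> r \<longrightarrow> t - s < \<delta> \<longrightarrow>
      (SUP f\<in>E. \<integral>\<^sup>+u\<in>{s..t}. m_bound j f u \<partial>lebesgue) < ennreal \<epsilon>"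
    by (rule E(2)[unfolded equicontinuous_m_bounds_def, rule_format, OF \<open>r > 0\<close> \<open>0 < \<epsilon>\<close>])
  then obtain \<delta> where \<delta>: "\<delta> > 0" "\<And>s t. - r \<le> s \<Longrightarrow> s \<le> t \<Longrightarrow> t \<le> r \<Longrightarrow> t - s < \<delta> \<Longrightarrow>
      (SUP f\<in>E. \<integral>\<^sup>+u\<in>{s..t}. m_bound j f u \<partial>lebesgue) < ennreal \<epsilon>"
    by blast
  show ?thesis
  proof (rule that[OF \<delta>(1)], rule SUP_least, clarify)
    fix s s' t :: real and f :: "real \<Rightarrow> 'a \<Rightarrow> 'b"
    assume s: "0 \<le> s" "s \<le> s'" "s' \<le> S" "s' - s < \<delta>" and t: "t \<in> I" and f: "f \<in> E"
    have "(\<integral>\<^sup>+u\<in>{t..t + s'}. m_bound j f u \<partial>lebesgue) =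
        (\<integral>\<^sup>+u\<in>{t..t + s}. m_bound j f u \<partial>lebesgue) + (\<integral>\<^sup>+u\<in>{t + s..t + s'}. m_bound j f u \<partial>lebesgue)"
      by (rule nn_integral_m_bound_add) (use f E s in auto)
    also have "\<dots> \<le> (SUP (t, f) \<in> I \<times> E. \<integral>\<^sup>+u\<in>{t..t + s}. m_bound j f u \<partial>lebesgue) + ennreal \<epsilon>"
    proof (rule add_mono)
      show "(\<integral>\<^sup>+u\<in>{t..t + s}. m_bound j f u \<partial>lebesgue)
          \<le> (SUP (t, f) \<in> I \<times> E. \<integral>\<^sup>+u\<in>{t..t + s}. m_bound j f u \<partial>lebesgue)"
        by (rule SUP_upper2[of "(t, f)"]) (use t f in auto)
      have "(\<integral>\<^sup>+u\<in>{t + s..t + s'}. m_bound j f u \<partial>lebesgue)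
          \<le> (SUP f\<in>E. \<integral>\<^sup>+u\<in>{t + s..t + s'}. m_bound j f u \<partial>lebesgue)"
        by (rule SUP_upper) (rule f)
      also have "\<dots> \<le> ennreal \<epsilon>"
        by (rule less_imp_le, rule \<delta>(2)) (use s t q in \<open>auto simp: r_def\<close>)
      finally show "(\<integral>\<^sup>+u\<in>{t + s..t + s'}. m_bound j f u \<partial>lebesgue) \<le> ennreal \<epsilon>" .
    qed
    finally show "(\<integral>\<^sup>+u\<in>{t..t + s'}. m_bound j f u \<partial>lebesgue)
        \<le> (SUP (t, f) \<in> I \<times> E. \<integral>\<^sup>+u\<in>{t..t + s}. m_bound j f u \<partial>lebesgue) + ennreal \<epsilon>" .
  qed
qed

lemma moduli_SUP_zero:
  "(SUP (t, f) \<in> I \<times> E. \<integral>\<^sup>+u\<in>{t..t + 0}. m_bound j f u \<partial>lebesgue) = 0"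
proof -
  have "(\<integral>\<^sup>+u\<in>{t..t + 0}. m_bound j f u \<partial>lebesgue) = 0" for t f
    using nn_integral_null_set[of "{t}" lebesgue "m_bound j f"] negligible_sing[of t]
    by (simp add: negligible_iff_null_sets)
  then show ?thesis by (intro antisym SUP_least) auto
qed

lemma moduli_SUP_finite:
  fixes E :: "(real \<Rightarrow> 'a::euclidean_space \<Rightarrow> 'b::euclidean_space) set"
  assumes E: "E \<subseteq> LC" "equicontinuous_m_bounds E" and I: "I \<in> rat_intervals" and "0 \<le> S"
  shows "(SUP (t, f) \<in> I \<times> E. \<integral>\<^sup>+u\<in>{t..t + S}. m_bound j f u \<partial>lebesgue) < \<infinity>"
proof -
  let ?G = "\<lambda>s. SUP (t, f) \<in> I \<times> E. \<integral>\<^sup>+u\<in>{t..t + s}. m_bound j f u \<partial>lebesgue"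
  obtain \<delta> where \<delta>: "0 < \<delta>" "\<And>s s'. 0 \<le> s \<Longrightarrow> s \<le> s' \<Longrightarrow> s' \<le> S \<Longrightarrow> s' - s < \<delta> \<Longrightarrow>
       ?G s' \<le> ?G s + ennreal 1"
    using moduli_SUP_step[OF E I, of 1 S j] by auto
  obtain n :: nat where n: "S < real n * \<delta>"
    using reals_Archimedean3[OF \<delta>(1)] by blast
  then have n0: "0 < n" using \<open>0 \<le> S\<close> by (cases n) auto
  define h where "h = S / real n"
  have h: "0 \<le> h" "h < \<delta>" "real n * h = S"
    using n n0 \<open>0 \<le> S\<close> by (auto simp: h_def field_simps)
  have "?G (real k * h) < \<infinity>" if "k \<le> n" for k
    using that
  proof (induction k)
    case 0 then show ?case using moduli_SUP_zero[of j I E] by simp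
  next
    case (Suc k)
    have "real (Suc k) * h \<le> S" using Suc.prems h by (metis mult_right_mono of_nat_mono)
    then have "?G (real (Suc k) * h) \<le> ?G (real k * h) + ennreal 1"
      by (intro \<delta>(2)) (use h in \<open>auto simp: algebra_simps\<close>)
    also have "\<dots> < \<infinity>" using Suc by simp
    finally show ?case .
  qed
  from this[of n] h show ?thesis by simp
qed

lemma moduli_SUP_mono:
  fixes E :: "(real \<Rightarrow> 'a::real_normed_vector \<Rightarrow> 'b::real_normed_vector) set"
  assumes "j1 \<le> j2" "I1 \<subseteq> I2" "s1 \<le> s2"
  shows "(SUP (t, f) \<in> I1 \<times> E. \<integral>\<^sup>+u\<in>{t..t + s1}. m_bound j1 f u \<partial>lebesgue)
       \<le> (SUP (t, f) \<in> I2 \<times> E. \<integral>\<^sup>+u\<in>{t..t + s2}. m_bound j2 f u \<partial>lebesgue)"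
proof (rule SUP_least, clarify)
  fix t :: real and f :: "real \<Rightarrow> 'a \<Rightarrow> 'b" assume tf: "t \<in> I1" "f \<in> E"
  have m: "m_bound j1 f u \<le> m_bound j2 f u" for u
    unfolding m_bound_def using assms(1) by (intro SUP_subset_mono subset_cball) auto
  have "(\<integral>\<^sup>+u\<in>{t..t + s1}. m_bound j1 f u \<partial>lebesgue) \<le> (\<integral>\<^sup>+u\<in>{t..t + s2}. m_bound j2 f u \<partial>lebesgue)"
    by (intro nn_integral_mono mult_mono m) (use assms(3) in \<open>auto split: split_indicator\<close>)
  also have "\<dots> \<le> (SUP (t, f) \<in> I2 \<times> E. \<integral>\<^sup>+u\<in>{t..t + s2}. m_bound j2 f u \<partial>lebesgue)"
    by (rule SUP_upper2[of "(t, f)"]) (use assms(2) tf in auto)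
  finally show "(\<integral>\<^sup>+u\<in>{t..t + s1}. m_bound j1 f u \<partial>lebesgue)
      \<le> (SUP (t, f) \<in> I2 \<times> E. \<integral>\<^sup>+u\<in>{t..t + s2}. m_bound j2 f u \<partial>lebesgue)" .
qed

lemma suitable_moduli_of:
  fixes E :: "(real \<Rightarrow> 'a::euclidean_space \<Rightarrow> 'b::euclidean_space) set"
  assumes E: "E \<subseteq> LC" "equicontinuous_m_bounds E"
  shows "suitable_moduli (moduli_of E)"
proof -
  let ?G = "\<lambda>j I s. SUP (t, f) \<in> I \<times> E. \<integral>\<^sup>+u\<in>{t..t + s}. m_bound j f u \<partial>lebesgue"
  have fin: "?G j I s < \<infinity>" if "I \<in> rat_intervals" "0 \<le> s" for j I s
    using moduli_SUP_finite[OF E that] .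
  have rmono: "moduli_of E j1 I1 s1 \<le> moduli_of E j2 I2 s2"
    if "j1 \<le> j2" "I1 \<subseteq> I2" "s1 \<le> s2" "0 \<le> s2" "I2 \<in> rat_intervals" for j1 j2 I1 I2 s1 s2
    unfolding moduli_of_def using moduli_SUP_mono[OF that(1-3)] fin[OF that(5,4)]
    by (intro enn2real_mono) auto
  have cont: "continuous_on {0..} (moduli_of E j I)" if I: "I \<in> rat_intervals" for j I
    unfolding continuous_on_iff
  proof (intro ballI allI impI)
    fix s \<epsilon> :: real assume s: "s \<in> {0..}" and \<epsilon>: "0 < \<epsilon>"
    obtain \<delta> where \<delta>: "0 < \<delta>" "\<And>a b. 0 \<le> a \<Longrightarrow> a \<le> b \<Longrightarrow> b \<le> s + 1 \<Longrightarrow> b - a < \<delta> \<Longrightarrow>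
       ?G j I b \<le> ?G j I a + ennreal (\<epsilon> / 2)"
      using moduli_SUP_step[OF E I, of "\<epsilon> / 2" "s + 1" j] \<epsilon> by auto
    have step: "moduli_of E j I b \<le> moduli_of E j I a + \<epsilon> / 2"
      if "0 \<le> a" "a \<le> b" "b \<le> s + 1" "b - a < \<delta>" for a b
    proof -
      have "enn2real (?G j I b) \<le> enn2real (?G j I a + ennreal (\<epsilon> / 2))"
        by (rule enn2real_mono[OF \<delta>(2)[OF that]])
           (use fin[OF I that(1), of j] in \<open>simp add: less_top[symmetric] ennreal_add_eq_top\<close>)
      also have "\<dots> = enn2real (?G j I a) + \<epsilon> / 2"
        using fin[OF I that(1), of j] \<epsilon> by (subst enn2real_plus) auto
      finally show ?thesis by (simp add: moduli_of_def)
    qed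
    show "\<exists>d>0. \<forall>s'\<in>{0..}. dist s' s < d \<longrightarrow> dist (moduli_of E j I s') (moduli_of E j I s) < \<epsilon>"
    proof (intro exI[of _ "min \<delta> 1"] conjI ballI impI)
      fix s' :: real assume s': "s' \<in> {0..}" "dist s' s < min \<delta> 1"
      show "dist (moduli_of E j I s') (moduli_of E j I s) < \<epsilon>"
      proof (cases "s \<le> s'")
        case True
        then show ?thesis
          using step[of s s'] rmono[OF order_refl order_refl True _ I] s s' \<epsilon>
          by (simp add: dist_real_def)
      next
        case False
        then show ?thesis
          using step[of s' s] rmono[OF order_refl order_refl _ _ I, of s' s j] s s' \<epsilon>
          by (simp add: dist_real_def)
      qed
    qed (use \<delta> in auto)
  qed
  have zero: "moduli_of E j I 0 = 0" for j I
    unfolding moduli_of_def moduli_SUP_zero by simp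
  show ?thesis
    unfolding suitable_moduli_def
  proof (intro conjI allI ballI impI)
    fix j I assume I: "I \<in> rat_intervals"
    show "mono_on {0..} (moduli_of E j I)"
      by (intro mono_onI rmono) (use I in auto)
    show "moduli_of E j I ` {0..} \<subseteq> {0..}"
      by (auto simp: moduli_of_def)
  qed (use cont zero in \<open>auto intro!: rmono\<close>)
qed

end

theory Submission
  imports Defs
begin

text \<open>
  Let \<open>x\<close> and \<open>x\<^sub>n\<close> be the solutions for \<open>f\<close> and \<open>f\<^sub>n\<close>. As long as \<open>x\<^sub>n\<close> stays within distance \<open>1\<close> of
  \<open>x\<close>, both curves live in a fixed ball. Under \<open>T_D\<close> one writes
  \<open>f\<^sub>n(x\<^sub>n) - f(x) = [f\<^sub>n(x\<^sub>n) - f\<^sub>n(x)] + [f\<^sub>n(x) - f(x)]\<close>, using the \<open>l\<close>-bounds for the first bracket and a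
  finite net of \<open>D\<close> for the second. Under \<open>T_Theta\<close> one first replaces the delayed argument of \<open>f\<^sub>n\<close> only
  (\<open>l\<^sub>2\<close>-bounds), then \<open>f\<^sub>n\<close> by \<open>f\<close> along the curve \<open>x\<^sub>n\<close>, which lies in the modulus class by the \<open>m\<close>-bounds
  (again with a finite net, now of \<open>D'\<close>), and finally \<open>x\<^sub>n\<close> by \<open>x\<close> in \<open>f\<close>, using the Lipschitz bound of
  \<open>f\<close> itself. A Gronwall argument makes \<open>x\<^sub>n - x\<close> uniformly small, so \<open>x\<^sub>n\<close> never leaves the tube around
  \<open>x\<close>, and a maximal solution cannot stop while it is bounded.
\<close>

section \<open>Absolutely continuous functions and indefinite integrals\<close>

text \<open>In case (i) there is no uniform Lipschitz control of the \<open>f\<^sub>n\<close> in the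
  current state, so \<open>x\<^sub>n\<close> cannot be replaced by \<open>x\<close> inside
  \<open>f\<^sub>n\<close>. Hence \<open>f\<^sub>n\<close> is compared with \<open>f\<close> along a
  curve that moves with \<open>n\<close>, which only a supremum over a fixed class of curves can
  control. The seminorms freeze the delayed argument at points of \<open>D'\<close>; it is therefore
  moved first to the fixed curve \<open>x (t - 1)\<close>, whose bounded range a finite net covers.
  The limit \<open>f\<close> is not assumed to lie in \<open>E\<close>, and its bounds come from
  \<open>LC\<close>. The bound \<open>C\<close> for the Gronwall kernels is chosen before the error
  \<open>e\<close>, independently of \<open>n\<close> and of the time up to which
  \<open>x\<^sub>n\<close> is known to stay near \<open>x\<close>. The growth factor depends on
  \<open>C\<close> alone, so a small \<open>e\<close> forces a deviation below the tube width.
  Solutions are defined by absolute continuity and an a.e. derivative, whereas all estimates are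
  integral ones. The passage is made in both directions: to the integral equation for the estimates,
  and back to recognise the continuation of a bounded solution as a solution.\<close>

lemma absolutely_continuous_on_subset:
  assumes "absolutely_continuous_on S x" "S' \<subseteq> S"
  shows "absolutely_continuous_on S' x"
  using assms unfolding absolutely_continuous_on_def by (meson subset_trans)

text \<open>
  The gauge keeps intervals tagged in the exceptional set \<open>N\<close> inside an open set of small measure, where
  absolute continuity controls the increments of \<open>x\<close>; all other tags use differentiability.
\<close>

lemma has_integral_derivative_absolutely_continuous:
  fixes x :: "real \<Rightarrow> 'a::real_normed_vector"
  assumes ac: "absolutely_continuous_on {a..b} x" and ab: "a \<le> b" and N: "negligible N"
    and d: "\<And>t. t \<in> {a..b} - N \<Longrightarrow> (x has_vector_derivative g t) (at t within {a..b})"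
  shows "(g has_integral (x b - x a)) {a..b}"
proof (rule has_integral_spike[OF N])
  \<comment> \<open>The value zero on \<open>N\<close> removes the Riemann terms tagged there, so
    that only the increments of \<open>x\<close> remain for those tags.\<close>
  define h where "h = (\<lambda>t. if t \<in> N then 0 else g t)"
  show "g t = h t" if "t \<in> {a..b} - N" for t using that by (simp add: h_def)
  show "(h has_integral (x b - x a)) {a..b}"
    unfolding box_real(2)[symmetric] has_integral
  proof (intro allI impI)
    fix e :: real assume e: "0 < e"
    \<comment> \<open>Tags outside \<open>N\<close> contribute at most
      \<open>\<eta> * (b - a)\<close>, less than half of \<open>e\<close>; the \<open>+ 1\<close>
      covers \<open>a = b\<close>.\<close>
    define \<eta> where "\<eta> = e / (2 * (b - a + 1))"
    have \<eta>: "0 < \<eta>" "\<eta> * (b - a) < e / 2" using e ab by (auto simp: \<eta>_def field_simps)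
    from ac e obtain \<delta> where \<delta>: "\<delta> > 0" "\<And>d T. d division_of T \<Longrightarrow> T \<subseteq> {a..b} \<Longrightarrow>
        (\<Sum>k\<in>d. Sup k - Inf k) < \<delta> \<Longrightarrow> (\<Sum>k\<in>d. norm (x (Sup k) - x (Inf k))) < e / 2"
      unfolding absolutely_continuous_on_def by (meson half_gt_zero)
    obtain U where U: "open U" "N \<subseteq> U" "U - N \<in> lmeasurable" "emeasure lebesgue (U - N) < ennreal \<delta>"
      using sets_lebesgue_outer_open[of N \<delta>] N \<delta>(1) negligible_imp_sets by metis
    have Um: "U \<in> lmeasurable"
      using fmeasurable.Un[OF U(3) negligible_imp_measurable[OF N]] U(2)
      by (simp add: Un_absorb2)
    have mU: "measure lebesgue U < \<delta>"
    proof -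
      have "measure lebesgue U \<le> measure lebesgue ((U - N) \<union> N)"
        using U(2) by (simp add: Un_absorb2)
      also have "\<dots> \<le> measure lebesgue (U - N) + measure lebesgue N"
        by (rule measure_Un_le) (use U N negligible_imp_sets in auto)
      also have "\<dots> < \<delta>"
        using U(4) N \<delta>(1) U(3) by (simp add: negligible_imp_measure0 emeasure_eq_measure2 ennreal_less_iff)
      finally show ?thesis .
    qed
    have "\<exists>\<rho>>0. (t \<in> N \<longrightarrow> ball t \<rho> \<subseteq> U) \<and> (t \<in> {a..b} - N \<longrightarrow>
       (\<forall>y\<in>{a..b}. \<bar>y - t\<bar> < \<rho> \<longrightarrow> norm (x y - x t - (y - t) *\<^sub>R g t) \<le> \<eta> * \<bar>y - t\<bar>))" for t
    proof (cases "t \<in> N")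
      case True
      then show ?thesis using U openE by (metis DiffD2 subsetD)
    next
      case False
      show ?thesis
      proof (cases "t \<in> {a..b}")
        case True
        with False d[of t] \<eta>(1) show ?thesis
          unfolding has_vector_derivative_def has_derivative_within_alt by auto
      qed (use False in \<open>auto intro: exI[of _ 1]\<close>)
    qed
    then obtain \<rho> where \<rho>: "\<And>t. \<rho> t > 0" "\<And>t. t \<in> N \<Longrightarrow> ball t (\<rho> t) \<subseteq> U"
      "\<And>t y. t \<in> {a..b} - N \<Longrightarrow> y \<in> {a..b} \<Longrightarrow> \<bar>y - t\<bar> < \<rho> t \<Longrightarrow>
         norm (x y - x t - (y - t) *\<^sub>R g t) \<le> \<eta> * \<bar>y - t\<bar>"
      by metis
    show "\<exists>\<gamma>. gauge \<gamma> \<and> (\<forall>\<D>. \<D> tagged_division_of cbox a b \<and> \<gamma> fine \<D> \<longrightarrow>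
        norm ((\<Sum>(t, k)\<in>\<D>. measure lborel k *\<^sub>R h t) - (x b - x a)) < e)"
    proof (intro exI[of _ "\<lambda>t. ball t (\<rho> t)"] conjI allI impI; (elim conjE)?)
      show "gauge (\<lambda>t. ball t (\<rho> t))" using \<rho>(1) by (simp add: gauge_def)
      fix p assume p: "p tagged_division_of cbox a b" and fine: "(\<lambda>t. ball t (\<rho> t)) fine p"
      have fin: "finite p" using p by auto
      define q where "q = {z \<in> p. fst z \<in> N}"
      have qp: "q \<subseteq> p" by (auto simp: q_def)
      let ?D = "\<lambda>k. x (Sup k) - x (Inf k)"
      have elt: "\<exists>u v. k = {u..v} \<and> a \<le> u \<and> u \<le> t \<and> t \<le> v \<and> v \<le> b" if "(t, k) \<in> p" for t k
        using tagged_division_ofD(2-4)[OF p that] by (fastforce simp: subset_eq)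
      have "(\<Sum>(t, k)\<in>p. ?D k) = x b - x a"
        using additive_tagged_division_1[OF ab] p by (simp add: box_real)
      then have "norm ((\<Sum>(t, k)\<in>p. measure lborel k *\<^sub>R h t) - (x b - x a)) =
          norm (\<Sum>(t, k)\<in>p. measure lborel k *\<^sub>R h t - ?D k)"
        by (simp add: sum_subtractf case_prod_unfold)
      also have "\<dots> \<le> (\<Sum>(t, k)\<in>p. norm (measure lborel k *\<^sub>R h t - ?D k))"
        unfolding case_prod_unfold by (rule norm_sum)
      also have "\<dots> = (\<Sum>(t, k)\<in>p - q. norm (measure lborel k *\<^sub>R h t - ?D k)) +
          (\<Sum>(t, k)\<in>q. norm (measure lborel k *\<^sub>R h t - ?D k))"
        by (rule sum.subset_diff[OF qp fin])
      also have "\<dots> < e / 2 + e / 2"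
      proof (rule add_strict_mono)
        have "(\<Sum>(t, k)\<in>p - q. norm (measure lborel k *\<^sub>R h t - ?D k)) \<le> (\<Sum>(t, k)\<in>p - q. \<eta> * measure lborel k)"
        proof (rule sum_mono, clarify)
          fix t k assume tk: "(t, k) \<in> p" "(t, k) \<notin> q"
          then have t: "t \<notin> N" by (auto simp: q_def)
          from elt[OF tk(1)] obtain u v where k: "k = {u..v}" "a \<le> u" "u \<le> t" "t \<le> v" "v \<le> b" by blast
          have "k \<subseteq> ball t (\<rho> t)" using fine tk(1) by (auto simp: fine_def)
          moreover have "u \<in> k" "v \<in> k" using k by auto
          ultimately have "u \<in> ball t (\<rho> t)" "v \<in> ball t (\<rho> t)" by blast+
          then have uv: "\<bar>u - t\<bar> < \<rho> t" "\<bar>v - t\<bar> < \<rho> t"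
            by (simp_all add: dist_real_def abs_minus_commute)
          \<comment> \<open>The tag lies between the endpoints, so the increment over
            \<open>k\<close> is split at \<open>t\<close> and the differentiability estimate is
            applied to both pieces, whose lengths add up to that of \<open>k\<close>.\<close>
          have "measure lborel k *\<^sub>R h t - ?D k =
              (x u - x t - (u - t) *\<^sub>R g t) - (x v - x t - (v - t) *\<^sub>R g t)"
            using k t by (simp add: h_def algebra_simps)
          also have "norm \<dots> \<le> norm (x u - x t - (u - t) *\<^sub>R g t) + norm (x v - x t - (v - t) *\<^sub>R g t)"
            by (rule norm_triangle_ineq4)
          also have "\<dots> \<le> \<eta> * \<bar>u - t\<bar> + \<eta> * \<bar>v - t\<bar>"
            by (intro add_mono \<rho>(3)) (use k t uv in auto)
          also have "\<dots> = \<eta> * measure lborel k" using k by (simp add: algebra_simps)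
          finally show "norm (measure lborel k *\<^sub>R h t - ?D k) \<le> \<eta> * measure lborel k" .
        qed
        also have "\<dots> \<le> (\<Sum>(t, k)\<in>p. \<eta> * measure lborel k)"
          by (rule sum_mono2[OF fin]) (use \<eta> in auto)
        also have "\<dots> = \<eta> * (b - a)"
          using additive_content_tagged_division[OF p] ab
          by (simp add: case_prod_unfold sum_distrib_left[symmetric])
        finally show "(\<Sum>(t, k)\<in>p - q. norm (measure lborel k *\<^sub>R h t - ?D k)) < e / 2" using \<eta>(2) by simp
      next
        have qt: "q tagged_partial_division_of cbox a b"
          using tagged_partial_division_subset[OF _ qp] p by (simp add: tagged_division_of_def)
        note qd = tagged_partial_division_of_Union_self[OF qt]
        note dd = division_of_tagged_division[OF qd]
        \<comment> \<open>Passing from tagged pairs to a sum over intervals needs a summand that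
          vanishes on every interval with empty interior. One-point intervals satisfy this; for the
          empty interval, where \<open>Sup\<close> and \<open>Inf\<close> say nothing, the value 0
          is imposed.\<close>
        have "(\<Sum>(t, k)\<in>q. norm (measure lborel k *\<^sub>R h t - ?D k)) = (\<Sum>(t, k)\<in>q. if k = {} then 0 else norm (?D k))"
          by (rule sum.cong) (use elt in \<open>fastforce simp: q_def h_def norm_minus_commute\<close>)+
        also have "\<dots> = (\<Sum>k\<in>snd ` q. if k = {} then 0 else norm (?D k))"
          by (rule sum.over_tagged_division_lemma[OF qd]) auto
        also have "\<dots> = (\<Sum>k\<in>snd ` q. norm (?D k))"
          by (rule sum.cong) (use elt qp in fastforce)+
        also have "\<dots> < e / 2"
        proof (rule \<delta>(2)[OF dd])
          show "\<Union> (snd ` q) \<subseteq> {a..b}" using elt qp by fastforce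
          have "(\<Sum>k\<in>snd ` q. Sup k - Inf k) = (\<Sum>k\<in>snd ` q. measure lebesgue k)"
            by (rule sum.cong[OF refl]) (use elt qp in fastforce)
          also have "\<dots> = measure lebesgue (\<Union> (snd ` q))"
            using content_division[OF dd] by simp
          also have "\<dots> \<le> measure lebesgue U"
          proof (rule measure_mono_fmeasurable)
            show "\<Union> (snd ` q) \<subseteq> U"
              using fine qp \<rho>(2) by (fastforce simp: fine_def q_def)
            show "\<Union> (snd ` q) \<in> sets lebesgue"
              using lmeasurable_division[OF dd] by auto
          qed (use Um in auto)
          finally show "(\<Sum>k\<in>snd ` q. Sup k - Inf k) < \<delta>" using mU by simp
        qed
        finally show "(\<Sum>(t, k)\<in>q. norm (measure lborel k *\<^sub>R h t - ?D k)) < e / 2" .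
      qed
      finally show "norm ((\<Sum>(t, k)\<in>p. measure lborel k *\<^sub>R h t) - (x b - x a)) < e" by simp
    qed
  qed
qed

text \<open>
  Around a point of non-differentiability there are arbitrarily short intervals whose contribution to the
  Riemann sum is off by a fixed fraction of their length. A disjoint Vitali subfamily of them is a partial
  tagged division, so the Henstock lemma makes its total length arbitrarily small.
\<close>

lemma indefinite_integral_has_vector_derivative_AE:
  fixes g :: "real \<Rightarrow> 'a::euclidean_space"
  assumes g: "g integrable_on {a..b}"
  shows "AE t in lebesgue. a < t \<and> t < b \<longrightarrow>
    ((\<lambda>u. integral {a..u} g) has_vector_derivative g t) (at t)"
proof -
  \<comment> \<open>Since \<open>t\<close> may be an endpoint of the interval, a point outside every
    \<open>B k\<close> has good difference quotients from the left and from the right.\<close>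
  define P where "P k t u v \<longleftrightarrow> u \<le> t \<and> t \<le> v \<and> u < v \<and> a \<le> u \<and> v \<le> b \<and>
      norm ((v - u) *\<^sub>R g t - integral {u..v} g) > (v - u) / real (Suc k)" for k t u v
  define B where "B k = {t. \<forall>d>0. \<exists>u v. P k t u v \<and> v - u < d}" for k
  have neg: "negligible (B k)" for k
    unfolding negligible_outer_le
  proof (intro allI impI)
    fix e :: real assume e: "e > 0"
    \<comment> \<open>The tolerance \<open>e / real (Suc k)\<close> cancels against the relative
      error built into \<open>P k\<close>, which leaves total length below \<open>e\<close>.\<close>
    obtain \<gamma> where \<gamma>: "gauge \<gamma>" "\<And>p. p tagged_partial_division_of (cbox a b) \<Longrightarrow> \<gamma> fine p \<Longrightarrow>
        (\<Sum>(x, k)\<in>p. norm (measure lborel k *\<^sub>R g x - integral k g)) < e / real (Suc k)"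
      using Henstock_lemma[of g a b "e / real (Suc k)"] g e by (auto simp: box_real)
    define K where "K = {(t, u, v). P k t u v \<and> {u..v} \<subseteq> \<gamma> t}"
    define ctr where "ctr = (\<lambda>(t::real, u, v). (u + v) / 2 :: real)"
    define rad where "rad = (\<lambda>(t::real, u, v). (v - u) / 2 :: real)"
    have cb: "cball (ctr (t, u, v)) (rad (t, u, v)) = {u..v}" for t u v
      by (simp add: ctr_def rad_def cball_eq_atLeastAtMost field_simps)
    have r0: "0 < rad i" if "i \<in> K" for i using that by (auto simp: K_def rad_def P_def)
    obtain C where C: "countable C" "C \<subseteq> K"
      "pairwise (\<lambda>i j. disjnt (cball (ctr i) (rad i)) (cball (ctr j) (rad j))) C"
      "negligible (B k - (\<Union>i\<in>C. cball (ctr i) (rad i)))"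
    proof (rule Vitali_covering_theorem_cballs[of K rad "B k" ctr, OF r0])
      fix t d :: real assume t: "t \<in> B k" and d: "0 < d"
      have "open (\<gamma> t)" "t \<in> \<gamma> t" using \<gamma>(1) by (auto simp: gauge_def)
      then obtain \<rho> where \<rho>: "\<rho> > 0" "ball t \<rho> \<subseteq> \<gamma> t" by (auto elim: openE)
      from t \<rho>(1) d obtain u v where uv: "P k t u v" "v - u < min \<rho> d"
        unfolding B_def mem_Collect_eq by (meson min_less_iff_conj)
      then have "{u..v} \<subseteq> ball t \<rho>" by (auto simp: P_def dist_real_def)
      then have "(t, u, v) \<in> K" using uv \<rho> by (auto simp: K_def)
      moreover have "t \<in> cball (ctr (t, u, v)) (rad (t, u, v))" unfolding cb using uv by (simp add: P_def)
      moreover have "rad (t, u, v) < d" using uv r0[OF calculation(1)] by (auto simp: rad_def)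
      ultimately show "\<exists>i. i \<in> K \<and> t \<in> cball (ctr i) (rad i) \<and> rad i < d" by blast
    qed
    \<comment> \<open>Partial divisions are finite, so the Henstock bound is proved for finite
      subfamilies; being uniform, it passes to the countable Vitali family.\<close>
    have fin: "measure lebesgue (\<Union>i\<in>F. cball (ctr i) (rad i)) \<le> e" if F: "F \<subseteq> C" "finite F" for F
    proof -
      define q where "q = (\<lambda>(t::real, u::real, v). (t, {u..v}))"
      have FK: "P k t u v \<and> {u..v} \<subseteq> \<gamma> t" if "(t, u, v) \<in> F" for t u v
        using that F C(2) by (auto simp: K_def)
      have dis: "{u..v} \<inter> {u'..v'} = {}" if "(t, u, v) \<in> F" "(t', u', v') \<in> F" "(t, u, v) \<noteq> (t', u', v')"
        for t u v t' u' v'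
        using pairwiseD[OF C(3), of "(t, u, v)" "(t', u', v')"] that F(1) unfolding cb disjnt_def by blast
      have inj: "inj_on q F"
      proof (rule inj_onI, rule ccontr)
        fix i j assume ij: "i \<in> F" "j \<in> F" "q i = q j" "i \<noteq> j"
        obtain t u v t' u' v' where e: "i = (t, u, v)" "j = (t', u', v')" by (metis prod_cases3)
        have "{u..v} = {u'..v'}" using ij(3) by (simp add: e q_def)
        moreover have "u \<le> v" using FK[of t u v] ij(1) by (simp add: e P_def)
        ultimately show False using dis[of t u v t' u' v'] ij by (auto simp: e)
      qed
      have part: "q ` F tagged_partial_division_of cbox a b"
        unfolding tagged_partial_division_of_def
      proof (intro conjI allI impI)
        show "finite (q ` F)" using F by simp
      next
        fix x k' assume "(x, k') \<in> q ` F"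
        then obtain u v where uv: "(x, u, v) \<in> F" "k' = {u..v}" by (auto simp: q_def)
        have "P k x u v" using FK[OF uv(1)] by simp
        then show "x \<in> k'" "k' \<subseteq> cbox a b" "\<exists>a b. k' = cbox a b"
          using uv by (auto simp: P_def)
      next
        fix x1 k1 x2 k2 assume *: "(x1, k1) \<in> q ` F \<and> (x2, k2) \<in> q ` F \<and> (x1, k1) \<noteq> (x2, k2)"
        then obtain u v u' v' where "(x1, u, v) \<in> F" "k1 = {u..v}" "(x2, u', v') \<in> F" "k2 = {u'..v'}"
          by (auto simp: q_def)
        with * have "k1 \<inter> k2 = {}" using dis by blast
        then show "interior k1 \<inter> interior k2 = {}" using interior_subset by blast
      qed
      have fine: "\<gamma> fine q ` F" using FK by (auto simp: fine_def q_def)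
      have "(\<Sum>(t, u, v)\<in>F. (v - u) / real (Suc k)) \<le>
          (\<Sum>(t, u, v)\<in>F. norm ((v - u) *\<^sub>R g t - integral {u..v} g))"
      proof (rule sum_mono, clarify)
        fix t u v assume "(t, u, v) \<in> F"
        from FK[OF this] show "(v - u) / real (Suc k) \<le> norm ((v - u) *\<^sub>R g t - integral {u..v} g)"
          unfolding P_def by linarith
      qed
      also have "\<dots> = (\<Sum>(x, k)\<in>q ` F. norm (measure lborel k *\<^sub>R g x - integral k g))"
        unfolding sum.reindex[OF inj]
      proof (rule sum.cong[OF refl], clarify)
        fix t u v assume "(t, u, v) \<in> F"
        from FK[OF this] have "u < v" by (simp add: P_def)
        then show "norm ((v - u) *\<^sub>R g t - integral {u..v} g) =
            ((\<lambda>(x, k). norm (measure lborel k *\<^sub>R g x - integral k g)) \<circ> q) (t, u, v)"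
          by (simp add: q_def)
      qed
      also have "\<dots> < e / real (Suc k)" by (rule \<gamma>(2)[OF part fine])
      finally have "(\<Sum>(t, u, v)\<in>F. (v - u)) / real (Suc k) < e / real (Suc k)"
        by (simp add: sum_divide_distrib case_prod_unfold)
      then have *: "(\<Sum>(t, u, v)\<in>F. (v - u)) < e"
        by (simp add: divide_less_cancel)
      have "measure lebesgue (\<Union>i\<in>F. cball (ctr i) (rad i)) \<le> (\<Sum>i\<in>F. measure lebesgue (cball (ctr i) (rad i)))"
        by (rule measure_UNION_le) (use F in auto)
      also have "\<dots> = (\<Sum>(t, u, v)\<in>F. (v - u))"
      proof (rule sum.cong[OF refl], clarify)
        fix t u v assume "(t, u, v) \<in> F"
        from FK[OF this] have "u < v" by (simp add: P_def)
        then show "measure lebesgue (cball (ctr (t, u, v)) (rad (t, u, v))) = v - u" by (simp add: cb)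
      qed
      finally show ?thesis using * by simp
    qed
    have lm: "(\<Union>i\<in>C. cball (ctr i) (rad i)) \<in> lmeasurable"
      and le: "measure lebesgue (\<Union>i\<in>C. cball (ctr i) (rad i)) \<le> e"
      by (rule fmeasurable_UN_bound[OF C(1) _ fin] measure_UN_bound[OF C(1) _ fin]; simp)+
    define V where "V = (\<Union>i\<in>C. cball (ctr i) (rad i))"
    have V: "V \<in> lmeasurable" "measure lebesgue V \<le> e" "negligible (B k - V)"
      using lm le C(4) by (simp_all add: V_def)
    show "\<exists>T. B k \<subseteq> T \<and> T \<in> lmeasurable \<and> measure lebesgue T \<le> e"
    proof (intro exI conjI)
      show "B k \<subseteq> V \<union> (B k - V)" by blast
      show "V \<union> (B k - V) \<in> lmeasurable"
        by (rule fmeasurable.Un[OF V(1) negligible_imp_measurable[OF V(3)]])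
      have "measure lebesgue (V \<union> (B k - V)) \<le> measure lebesgue V + measure lebesgue (B k - V)"
        by (rule measure_Un_le[OF fmeasurableD[OF V(1)] negligible_imp_sets[OF V(3)]])
      then show "measure lebesgue (V \<union> (B k - V)) \<le> e"
        unfolding negligible_imp_measure0[OF V(3)] using V(2) by simp
    qed
  qed
  have "negligible (\<Union>k. B k)" using neg by (intro negligible_countable_Union) auto
  then have "AE t in lebesgue. t \<notin> (\<Union>k. B k)"
    by (intro AE_not_in) (simp add: negligible_iff_null_sets)
  then show ?thesis
  proof eventually_elim
    case (elim t)
    show ?case
      unfolding has_vector_derivative_def has_derivative_within_alt
    proof (intro impI conjI allI bounded_linear_scaleR_left)
      assume t: "a < t \<and> t < b"
      fix e :: real assume "e > 0"
      then obtain k where k: "1 / real (Suc k) < e" by (rule nat_approx_posE)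
      have "t \<notin> B k" using elim by blast
      then obtain d where d: "d > 0" "\<And>u v. P k t u v \<Longrightarrow> \<not> v - u < d"
        unfolding B_def mem_Collect_eq by meson
      show "\<exists>d>0. \<forall>y\<in>UNIV. norm (y - t) < d \<longrightarrow>
          norm (integral {a..y} g - integral {a..t} g - (y - t) *\<^sub>R g t) \<le> e * norm (y - t)"
      proof (intro exI[of _ "min d (min (t - a) (b - t))"] conjI ballI impI)
        show "0 < min d (min (t - a) (b - t))" using d t by simp
        fix y assume y: "norm (y - t) < min d (min (t - a) (b - t))"
        have main: "norm ((v - u) *\<^sub>R g t - integral {u..v} g) \<le> e * (v - u)"
          if "u \<le> t" "t \<le> v" "u < v" "a \<le> u" "v \<le> b" "v - u < d" for u v
        proof -
          have "\<not> P k t u v" using d(2) that(6) by blast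
          then have "norm ((v - u) *\<^sub>R g t - integral {u..v} g) \<le> (v - u) / real (Suc k)"
            using that unfolding P_def by linarith
          also have "\<dots> = 1 / real (Suc k) * (v - u)" by simp
          also have "\<dots> \<le> e * (v - u)" using k that by (intro mult_right_mono) auto
          finally show ?thesis .
        qed
        have split: "integral {a..v} g = integral {a..u} g + integral {u..v} g"
          if "a \<le> u" "u \<le> v" "v \<le> b" for u v
          using Henstock_Kurzweil_Integration.integral_combine[of a u v g] integrable_on_subinterval[OF g, of a v] that by auto
        consider "y = t" | "y < t" | "y > t" by linarith
        then show "norm (integral {a..y} g - integral {a..t} g - (y - t) *\<^sub>R g t) \<le> e * norm (y - t)"
        proof cases
          case 2
          have "norm (integral {a..y} g - integral {a..t} g - (y - t) *\<^sub>R g t) =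
              norm ((t - y) *\<^sub>R g t - integral {y..t} g)"
            using split[of y t] 2 y t by (simp add: algebra_simps)
          also have "\<dots> \<le> e * (t - y)" by (rule main) (use 2 y t in auto)
          finally show ?thesis using 2 by simp
        next
          case 3
          have "norm (integral {a..y} g - integral {a..t} g - (y - t) *\<^sub>R g t) =
              norm ((y - t) *\<^sub>R g t - integral {t..y} g)"
            using split[of t y] 3 y t by (simp add: norm_minus_commute)
          also have "\<dots> \<le> e * (y - t)" by (rule main) (use 3 y t in auto)
          finally show ?thesis using 3 by simp
        qed simp
      qed
    qed
  qed
qed

text \<open>
  Truncating \<open>norm (g t)\<close> at height \<open>n\<close> leaves a remainder of small integral, and the truncated part
  is Lipschitz after integration.
\<close>

lemma absolutely_continuous_on_indefinite_integral:
  fixes g :: "real \<Rightarrow> 'a::euclidean_space"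
  assumes g: "g absolutely_integrable_on {a..b}"
    and x: "\<And>u v. a \<le> u \<Longrightarrow> u \<le> v \<Longrightarrow> v \<le> b \<Longrightarrow> x v - x u = integral {u..v} g"
  shows "absolutely_continuous_on {a..b} x"
  unfolding absolutely_continuous_on_def
proof (intro allI impI)
  fix e :: real assume e: "e > 0"
  have ng: "(\<lambda>t. norm (g t)) absolutely_integrable_on {a..b}"
    using g by (rule absolutely_integrable_norm[unfolded o_def])
  define h where "h n t = norm (g t) - min (norm (g t)) (real n)" for n t
  have h: "h n absolutely_integrable_on {a..b}" for n
    unfolding h_def
    by (intro set_integral_diff ng absolutely_integrable_min_1) (auto simp: absolutely_integrable_on_const)
  have "(\<lambda>n. integral {a..b} (h n)) \<longlonglongrightarrow> integral {a..b} (\<lambda>t. 0)"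
  proof (rule dominated_convergence)
    show "h n integrable_on {a..b}" for n using h by (rule set_lebesgue_integral_eq_integral)
    show "(\<lambda>t. norm (g t)) integrable_on {a..b}" using ng by (rule set_lebesgue_integral_eq_integral)
    show "norm (h n t) \<le> norm (g t)" for n t by (auto simp: h_def min_def)
    show "(\<lambda>n. h n t) \<longlonglongrightarrow> 0" for t
    proof (rule tendsto_eventually)
      obtain n0 where "norm (g t) \<le> real n0" using real_arch_simple by blast
      then have "\<forall>n\<ge>n0. h n t = 0" by (auto simp: h_def min_def)
      then show "\<forall>\<^sub>F n in sequentially. h n t = 0" by (auto simp: eventually_sequentially)
    qed
  qed
  then have "\<forall>\<^sub>F n in sequentially. integral {a..b} (h n) < e / 2"
    using e by (intro order_tendstoD(2)) auto
  then obtain n where n: "integral {a..b} (h n) < e / 2" by (auto simp: eventually_sequentially)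
  define \<delta> where "\<delta> = e / (2 * (real n + 1))"
  have \<delta>: "\<delta> > 0" "real n * \<delta> < e / 2" using e by (auto simp: \<delta>_def field_simps)
  show "\<exists>\<delta>>0. \<forall>d T. d division_of T \<longrightarrow> T \<subseteq> {a..b} \<longrightarrow> (\<Sum>k\<in>d. Sup k - Inf k) < \<delta> \<longrightarrow>
      (\<Sum>k\<in>d. norm (x (Sup k) - x (Inf k))) < e"
  proof (intro exI[of _ \<delta>] conjI allI impI \<delta>(1))
    fix d T assume d: "d division_of T" and T: "T \<subseteq> {a..b}" and len: "(\<Sum>k\<in>d. Sup k - Inf k) < \<delta>"
    have hT: "h n integrable_on T"
      by (rule set_lebesgue_integral_eq_integral, rule set_integrable_subset[OF h _ T])
         (use lmeasurable_division[OF d] in auto)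
    have "norm (x (Sup k) - x (Inf k)) \<le> integral k (h n) + real n * (Sup k - Inf k)" if k: "k \<in> d" for k
    proof -
      from division_ofD(2-4)[OF d k] obtain u v where uv: "k = {u..v}" "u \<le> v" "a \<le> u" "v \<le> b"
        using T by fastforce
      have sub: "{u..v} \<subseteq> {a..b}" using uv by auto
      have hk: "h n integrable_on {u..v}" and gk: "g integrable_on {u..v}"
        using set_integrable_subset[OF h _ sub] set_integrable_subset[OF g _ sub]
        by (auto intro: set_lebesgue_integral_eq_integral)
      have "norm (integral {u..v} g) \<le> integral {u..v} (\<lambda>t. h n t + real n)"
      proof (rule integral_norm_bound_integral[OF gk])
        show "(\<lambda>t. h n t + real n) integrable_on {u..v}" by (intro integrable_add hk) auto
        show "norm (g t) \<le> h n t + real n" for t by (auto simp: h_def min_def)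
      qed
      also have "\<dots> = integral {u..v} (h n) + real n * (v - u)"
        using uv by (subst integral_add[OF hk]) auto
      finally show ?thesis using x[of u v] uv by simp
    qed
    then have "(\<Sum>k\<in>d. norm (x (Sup k) - x (Inf k))) \<le> (\<Sum>k\<in>d. integral k (h n) + real n * (Sup k - Inf k))"
      by (rule sum_mono)
    also have "\<dots> = integral T (h n) + real n * (\<Sum>k\<in>d. Sup k - Inf k)"
      by (simp add: sum.distrib sum_distrib_left integral_combine_division_topdown[OF hT d])
    also have "\<dots> \<le> integral {a..b} (h n) + real n * \<delta>"
      by (intro add_mono integral_subset_le T hT mult_left_mono)
         (use len set_lebesgue_integral_eq_integral(1)[OF h] in \<open>auto simp: h_def\<close>)
    also have "\<dots> < e" using n \<delta> by simp
    finally show "(\<Sum>k\<in>d. norm (x (Sup k) - x (Inf k))) < e" .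
  qed
qed

section \<open>Caratheodory functions along curves and the integral equation\<close>

text \<open>Setting both functions to zero on the exceptional null set changes no integral and makes
  the comparison pointwise. The \<open>LC\<close> bounds hold only almost everywhere, so every
  integral estimate below goes through this form.\<close>

lemma integral_norm_bound_AE:
  fixes f :: "real \<Rightarrow> 'a::euclidean_space"
  assumes f: "f integrable_on {a..b}" and g: "g integrable_on {a..b}"
    and ae: "AE t in lebesgue. t \<in> {a..b} \<longrightarrow> norm (f t) \<le> g t"
  shows "norm (integral {a..b} f) \<le> integral {a..b} g"
proof -
  from ae obtain N where "N \<in> null_sets lebesgue" and sub: "{t \<in> space lebesgue. \<not> (t \<in> {a..b} \<longrightarrow> norm (f t) \<le> g t)} \<subseteq> N"
    unfolding eventually_ae_filter by blast
  then have N: "negligible N" by (simp add: negligible_iff_null_sets)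
  define f' where "f' t = (if t \<in> N then 0 else f t)" for t
  define g' where "g' t = (if t \<in> N then 0 else g t)" for t
  have "f' integrable_on {a..b}" "g' integrable_on {a..b}"
    by (rule integrable_spike[OF f N] integrable_spike[OF g N]; simp add: f'_def g'_def)+
  then have "norm (integral {a..b} f') \<le> integral {a..b} g'"
    by (rule integral_norm_bound_integral) (use sub in \<open>auto simp: f'_def g'_def\<close>)
  moreover have "integral {a..b} f' = integral {a..b} f" "integral {a..b} g' = integral {a..b} g"
    by (rule integral_spike[OF N]; simp add: f'_def g'_def)+
  ultimately show ?thesis by simp
qed

lemma borel_measurable_LC_comp:
  assumes f: "f \<in> LC" and z: "z \<in> borel_measurable borel"
  shows "(\<lambda>t. f t (z t)) \<in> borel_measurable borel"
proof -
  have fb: "(\<lambda>(t, z). f t z) \<in> borel_measurable borel" using f by (simp add: LC_def)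
  have "(\<lambda>t. (t, z t)) \<in> borel_measurable borel"
    using z by (intro borel_measurable_Pair) auto
  from measurable_compose[OF this fb] show ?thesis by simp
qed

text \<open>Taking absolute values makes the bounds nonnegative at every time, so that they can
  serve as factors in monotonicity arguments.\<close>

lemma LC_boundsE:
  assumes f: "f \<in> LC" and K: "compact K"
  obtains m l where "\<forall>t. 0 \<le> m t" "\<forall>t. 0 \<le> l t"
    "\<forall>a b. m absolutely_integrable_on {a..b}" "\<forall>a b. l absolutely_integrable_on {a..b}"
    "AE t in lebesgue. (\<forall>z\<in>K. norm (f t z) \<le> m t) \<and>
       (\<forall>z1\<in>K. \<forall>z2\<in>K. norm (f t z1 - f t z2) \<le> l t * norm (z1 - z2))"
proof -
  from f K obtain m l where ml: "m \<in> L1_loc" "l \<in> L1_loc" and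
    ae: "AE t in lebesgue. (\<forall>z\<in>K. norm (f t z) \<le> m t) \<and>
       (\<forall>z1\<in>K. \<forall>z2\<in>K. norm (f t z1 - f t z2) \<le> l t * norm (z1 - z2))"
    unfolding LC_def by blast
  show ?thesis
  proof (rule that[of "\<lambda>t. \<bar>m t\<bar>" "\<lambda>t. \<bar>l t\<bar>"])
    show "\<forall>a b. (\<lambda>t. \<bar>m t\<bar>) absolutely_integrable_on {a..b}" "\<forall>a b. (\<lambda>t. \<bar>l t\<bar>) absolutely_integrable_on {a..b}"
      using ml by (auto simp: L1_loc_def intro: set_integrable_abs)
    show "AE t in lebesgue. (\<forall>z\<in>K. norm (f t z) \<le> \<bar>m t\<bar>) \<and>
       (\<forall>z1\<in>K. \<forall>z2\<in>K. norm (f t z1 - f t z2) \<le> \<bar>l t\<bar> * norm (z1 - z2))"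
      using ae by eventually_elim (meson abs_ge_self mult_right_mono norm_ge_zero order_trans)
  qed auto
qed

text \<open>Freezing a curve at its endpoints extends it to the whole line without enlarging its
  range. This makes it Borel there, as the composition with a jointly Borel \<open>f\<close>
  requires, and is used again for the Picard operator and for membership in a modulus class.\<close>

lemma continuous_on_clamp_ext:
  fixes z :: "real \<Rightarrow> 'a::topological_space"
  assumes "a \<le> b" "continuous_on {a..b} z"
  shows "continuous_on UNIV (\<lambda>t. z (max a (min t b)))"
  by (rule continuous_on_compose2[OF assms(2)])
     (use assms(1) in \<open>auto intro!: continuous_intros\<close>)

lemma borel_measurable_clamp_ext:
  fixes z :: "real \<Rightarrow> 'a::topological_space"
  assumes "a \<le> b" "continuous_on {a..b} z"
  shows "(\<lambda>t. z (max a (min t b))) \<in> borel_measurable borel"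
  by (rule borel_measurable_continuous_onI[OF continuous_on_clamp_ext[OF assms]])

lemma LC_absolutely_integrable:
  fixes f :: "real \<Rightarrow> 'a::euclidean_space \<Rightarrow> 'b::euclidean_space"
  assumes f: "f \<in> LC" and z: "continuous_on {a..b} z"
  shows "(\<lambda>t. f t (z t)) absolutely_integrable_on {a..b}"
proof (cases "a \<le> b")
  case True
  have "compact (z ` {a..b})" by (intro compact_continuous_image z compact_Icc)
  from LC_boundsE[OF f this] obtain m :: "real \<Rightarrow> real" where
    m: "m absolutely_integrable_on {a..b}" "AE t in lebesgue. (\<forall>w\<in>z ` {a..b}. norm (f t w) \<le> m t)"
    by (smt (verit, best) eventually_mono)
  have "(\<lambda>t. f t (z (max a (min t b)))) \<in> borel_measurable borel"
    by (rule borel_measurable_LC_comp[OF f borel_measurable_clamp_ext[OF True z]])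
  then have "(\<lambda>t. f t (z (max a (min t b)))) \<in> borel_measurable lebesgue"
    by (simp add: measurable_completion)
  then have "set_borel_measurable lebesgue {a..b} (\<lambda>t. f t (z (max a (min t b))))"
    unfolding set_borel_measurable_def
    by (intro borel_measurable_scaleR borel_measurable_indicator) auto
  then have "(\<lambda>t. f t (z (max a (min t b)))) absolutely_integrable_on {a..b}"
  proof (rule set_integrable_bound[OF m(1)])
    show "AE t in lebesgue. t \<in> {a..b} \<longrightarrow> norm (f t (z (max a (min t b)))) \<le> norm (m t)"
      using m(2) by eventually_elim (force intro: order_trans[OF _ abs_ge_self])
  qed
  then show ?thesis
    by (rule set_integrable_cong[THEN iffD1, rotated -1]) auto
qed (simp add: set_integrable_def)

lemma dde_solution_continuous_on:
  assumes "dde_solution f \<phi> b x" "ereal t < b"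
  shows "continuous_on {-1..t} x"
  using assms(1) unfolding dde_solution_def
  by (elim conjE continuous_on_subset) (use assms(2) in \<open>auto intro: le_less_trans[of "ereal _" "ereal t"]\<close>)

lemma continuous_on_delay_pair:
  fixes x :: "real \<Rightarrow> 'a::topological_space"
  assumes "continuous_on {-1..t} x" "0 \<le> s"
  shows "continuous_on {s..t} (\<lambda>r. (x r, x (r - 1)))"
  by (intro continuous_on_Pair continuous_on_compose2[OF assms(1)] continuous_intros) (use assms(2) in auto)

lemma dde_solution_has_integral:
  assumes sol: "dde_solution f \<phi> b x" and st: "0 \<le> s" "s \<le> t" and t: "ereal t < b"
  shows "((\<lambda>r. f r (x r, x (r - 1))) has_integral (x t - x s)) {s..t}"
proof -
  have "absolutely_continuous_on {0..t} x" using sol st t by (auto simp: dde_solution_def)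
  then have ac: "absolutely_continuous_on {s..t} x"
    by (rule absolutely_continuous_on_subset) (use st in auto)
  have "AE r in lebesgue. 0 < r \<and> ereal r < b \<longrightarrow>
        (x has_vector_derivative f r (x r, x (r - 1))) (at r)"
    using sol by (simp add: dde_solution_def)
  then obtain N where "N \<in> null_sets lebesgue" and sub: "{r \<in> space lebesgue. \<not> (0 < r \<and> ereal r < b \<longrightarrow>
        (x has_vector_derivative f r (x r, x (r - 1))) (at r))} \<subseteq> N"
    unfolding eventually_ae_filter by blast
  \<comment> \<open>The differential equation is demanded only for positive times, hence 0 joins the
    exceptional set.\<close>
  then have N: "negligible (insert 0 N)" by (simp add: negligible_iff_null_sets[symmetric])
  show ?thesis
  proof (rule has_integral_derivative_absolutely_continuous[OF ac st(2) N])
    fix r assume r: "r \<in> {s..t} - insert 0 N"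
    then have "0 < r" "ereal r < b" using st t by (auto intro: le_less_trans[of "ereal r" "ereal t"])
    with r sub show "(x has_vector_derivative f r (x r, x (r - 1))) (at r within {s..t})"
      by (auto intro: has_vector_derivative_at_within)
  qed
qed

text \<open>Converse of \<open>dde_solution_has_integral\<close>. It rests on the a.e.
  differentiability and the absolute continuity of indefinite integrals, and serves to verify
  continuations.\<close>

lemma dde_solutionI:
  fixes f :: "real \<Rightarrow> 'a::euclidean_space \<times> 'a \<Rightarrow> 'a"
  assumes f: "f \<in> LC" and b: "0 < b" and cont: "continuous_on {t. -1 \<le> t \<and> ereal t < b} y"
    and ini: "\<And>t. t \<in> {-1..0} \<Longrightarrow> y t = \<phi> t"
    and int: "\<And>t. 0 \<le> t \<Longrightarrow> ereal t < b \<Longrightarrow> y t = y 0 + integral {0..t} (\<lambda>r. f r (y r, y (r - 1)))"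
  shows "dde_solution f \<phi> b y"
proof -
  let ?g = "\<lambda>r. f r (y r, y (r - 1))"
  have g: "?g absolutely_integrable_on {0..T}" if "ereal T < b" for T
  proof -
    have "continuous_on {-1..T} y"
      by (rule continuous_on_subset[OF cont]) (use that in \<open>auto intro: le_less_trans[of "ereal _" "ereal T"]\<close>)
    then show ?thesis
      by (intro LC_absolutely_integrable[OF f] continuous_on_delay_pair) auto
  qed
  have ac: "absolutely_continuous_on {0..T} y" if T: "0 \<le> T" "ereal T < b" for T
  proof (rule absolutely_continuous_on_indefinite_integral[OF g[OF T(2)]])
    fix u v assume uv: "0 \<le> u" "u \<le> v" "v \<le> T"
    have lt: "ereal u < b" "ereal v < b"
      using uv T(2) by (auto intro: le_less_trans[of "ereal _" "ereal T"])
    have "integral {0..u} ?g + integral {u..v} ?g = integral {0..v} ?g"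
      by (rule Henstock_Kurzweil_Integration.integral_combine)
         (use uv set_lebesgue_integral_eq_integral(1)[OF g[OF lt(2)]] in auto)
    then show "y v - y u = integral {u..v} ?g"
      using int[of u] int[of v] uv lt by (simp add: algebra_simps)
  qed
  \<comment> \<open>Differentiability of the primitive is available on compact intervals, while
    \<open>b\<close> may be infinite or not attained. Rational endpoints exhaust the interval at the
    cost of countably many null sets.\<close>
  have "AE t in lebesgue. \<forall>T\<in>{T \<in> \<rat>. ereal T < b}. 0 < t \<and> t < T \<longrightarrow>
      ((\<lambda>u. integral {0..u} ?g) has_vector_derivative ?g t) (at t)"
    by (intro AE_ball_countable' indefinite_integral_has_vector_derivative_AE)
       (auto intro: set_lebesgue_integral_eq_integral g countable_subset[OF _ countable_rat])
  then have ae: "AE t in lebesgue. 0 < t \<and> ereal t < b \<longrightarrow> (y has_vector_derivative ?g t) (at t)"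
  proof eventually_elim
    case (elim t)
    show ?case
    proof (intro impI, elim conjE)
      assume t: "0 < t" "ereal t < b"
      then obtain s where s: "ereal t < ereal s" "ereal s < b"
        by (metis ereal_dense2 less_ereal.simps(1))
      then obtain T where T: "T \<in> \<rat>" "t < T" "T < s" using Rats_dense_in_real[of t s] by auto
      then have Tb: "ereal T < b" using s by (meson less_ereal.simps(1) less_trans)
      with elim t T have "((\<lambda>u. integral {0..u} ?g) has_vector_derivative ?g t) (at t)" by blast
      then have "((\<lambda>u. y 0 + integral {0..u} ?g) has_vector_derivative ?g t) (at t)"
        using has_vector_derivative_add[OF has_vector_derivative_const] by fastforce
      then show "(y has_vector_derivative ?g t) (at t)"
      proof (rule has_vector_derivative_transform_within_open[of _ _ _ "{0<..<T}"])
        fix r assume "r \<in> {0<..<T}"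
        moreover from this have "ereal r < b" using Tb by (auto intro: less_trans[of "ereal r" "ereal T"])
        ultimately show "y 0 + integral {0..r} ?g = y r" using int[of r] by simp
      qed (use t T in auto)
    qed
  qed
  show ?thesis
    unfolding dde_solution_def using b cont ini ac ae by blast
qed

section \<open>Continuation of bounded solutions\<close>

lemma integral_short_interval_less:
  fixes k :: "real \<Rightarrow> real"
  assumes k: "\<And>c. k integrable_on {a..c}" and e: "0 < e"
  obtains \<eta> where "0 < \<eta>" "\<eta> \<le> 1" "\<And>t. a \<le> t \<Longrightarrow> t \<le> a + \<eta> \<Longrightarrow> integral {a..t} k < e"
proof -
  have "continuous_on {a..a + 1} (\<lambda>t. integral {a..t} k)"
    by (rule indefinite_integral_continuous_1[OF k])
  from this[unfolded continuous_on_iff, rule_format, of a, OF _ e]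
  obtain d where d: "d > 0" "\<And>t. t \<in> {a..a + 1} \<Longrightarrow> dist t a < d \<Longrightarrow>
      dist (integral {a..t} k) (integral {a..a} k) < e"
    by auto
  show ?thesis
  proof (rule that[of "min 1 (d / 2)"])
    fix t assume t: "a \<le> t" "t \<le> a + min 1 (d / 2)"
    then have "t \<le> a + 1" "t \<le> a + d / 2" by linarith+
    then show "integral {a..t} k < e" using d(2)[of t] d(1) t by (auto simp: dist_real_def)
  qed (use d in auto)
qed

text \<open>Method of steps: over a time span of at most 1 the delayed argument is a known curve
  \<open>u\<close>, so the delay equation becomes an ordinary one. The Picard operator is a
  contraction on a short interval because \<open>m\<close> and \<open>l\<close> have small integrals
  there.\<close>

lemma caratheodory_local_existence:
  fixes f :: "real \<Rightarrow> 'a::euclidean_space \<times> 'c::euclidean_space \<Rightarrow> 'a" and u :: "real \<Rightarrow> 'c"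
  assumes f: "f \<in> LC" and u: "continuous_on {a..a + 1} u"
  obtains \<eta> y where "0 < \<eta>" "\<eta> \<le> 1" "continuous_on {a..a + \<eta>} y"
    "\<And>t. t \<in> {a..a + \<eta>} \<Longrightarrow> y t = y0 + integral {a..t} (\<lambda>r. f r (y r, u r))"
proof -
  have a1: "a \<le> a + 1" by simp
  \<comment> \<open>Freezing keeps all values of \<open>u\<close> in its compact range, so the
    single compact set \<open>?K\<close> contains every argument that the Picard operator
    meets.\<close>
  define U where "U t = u (max a (min t (a + 1)))" for t
  have Uc: "continuous_on UNIV U" unfolding U_def by (rule continuous_on_clamp_ext[OF a1 u])
  have Uin: "U t \<in> u ` {a..a + 1}" for t unfolding U_def by (intro imageI) auto
  let ?K = "cball y0 1 \<times> u ` {a..a + 1}"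
  have "compact ?K" by (intro compact_Times compact_cball compact_continuous_image u compact_Icc)
  from LC_boundsE[OF f this] obtain m l where ml0: "\<forall>t. 0 \<le> m t" "\<forall>t. 0 \<le> l t"
    "\<forall>a b. m absolutely_integrable_on {a..b}" "\<forall>a b. l absolutely_integrable_on {a..b}"
    and ae: "AE t in lebesgue. (\<forall>z\<in>?K. norm (f t z) \<le> m t) \<and>
       (\<forall>z1\<in>?K. \<forall>z2\<in>?K. norm (f t z1 - f t z2) \<le> l t * norm (z1 - z2))"
    .
  note ml = ml0[rule_format]
  have mi: "m integrable_on {a..b}" and li: "l integrable_on {a..b}" for a b
    using ml set_lebesgue_integral_eq_integral(1) by blast+
  obtain \<eta>1 where \<eta>1: "0 < \<eta>1" "\<eta>1 \<le> 1" "\<And>t. a \<le> t \<Longrightarrow> t \<le> a + \<eta>1 \<Longrightarrow> integral {a..t} m < 1"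
    using integral_short_interval_less[OF mi, where e = 1 and a = a] by auto
  obtain \<eta>2 where \<eta>2: "0 < \<eta>2" "\<eta>2 \<le> 1" "\<And>t. a \<le> t \<Longrightarrow> t \<le> a + \<eta>2 \<Longrightarrow> integral {a..t} l < 1/2"
    using integral_short_interval_less[OF li, where e = "1/2" and a = a] by auto
  \<comment> \<open>The integral of \<open>m\<close> below 1 keeps the Picard operator inside the
    unit ball around \<open>y0\<close>; the integral of \<open>l\<close> below 1/2 gives the
    contraction factor.\<close>
  define \<eta> where "\<eta> = min \<eta>1 \<eta>2"
  have \<eta>: "0 < \<eta>" "\<eta> \<le> 1" using \<eta>1 \<eta>2 by (auto simp: \<eta>_def)
  \<comment> \<open>The fixed point is sought among bounded continuous functions on the whole line,
    a complete space; \<open>cl\<close> makes the Picard images constant outside the short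
    interval.\<close>
  define cl where "cl t = max a (min t (a + \<eta>))" for t
  have cl: "a \<le> cl t" "cl t \<le> a + \<eta>" "t \<in> {a..a + \<eta>} \<Longrightarrow> cl t = t" for t
    using \<eta> by (auto simp: cl_def)
  have clm: "integral {a..cl t} m \<le> 1" "integral {a..cl t} l \<le> 1/2" for t
  proof -
    have "cl t \<le> a + \<eta>1" "cl t \<le> a + \<eta>2" using cl(2)[of t] unfolding \<eta>_def by linarith+
    then show "integral {a..cl t} m \<le> 1" "integral {a..cl t} l \<le> 1/2"
      using \<eta>1(3)[OF cl(1)] \<eta>2(3)[OF cl(1)] by fastforce+
  qed
  define S where "S = cball (const_bcontfun y0 :: real \<Rightarrow>\<^sub>C 'a) 1"
  have Sy: "apply_bcontfun y r \<in> cball y0 1" if "y \<in> S" for y r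
    using dist_bounded[of "const_bcontfun y0" r y] that by (auto simp: S_def)
  have ycont: "continuous_on A (apply_bcontfun y)" for y :: "real \<Rightarrow>\<^sub>C 'a" and A
    using apply_bcontfun[of y] continuous_on_subset by (auto simp: bcontfun_def)
  define G where "G y r = f r (apply_bcontfun y r, U r)" for y r
  have Gi: "G y integrable_on {b..c}" for y b c
    unfolding G_def
    by (intro set_lebesgue_integral_eq_integral(1) LC_absolutely_integrable[OF f] continuous_on_Pair ycont
        continuous_on_subset[OF Uc] subset_UNIV)
  define P where "P y t = y0 + integral {a..cl t} (G y)" for y t
  have Pc: "continuous_on UNIV (P y)" for y
  proof -
    have "continuous_on {a..a + \<eta>} (\<lambda>t. y0 + integral {a..t} (G y))"
      by (intro continuous_intros indefinite_integral_continuous_1 Gi)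
    then show ?thesis
      unfolding P_def cl_def by (intro continuous_on_clamp_ext[of a "a + \<eta>"]) (use \<eta> in auto)
  qed
  have Pd: "dist y0 (P y t) \<le> 1" if "y \<in> S" for y t
  proof -
    have "norm (integral {a..cl t} (G y)) \<le> integral {a..cl t} m"
    proof (rule integral_norm_bound_AE[OF Gi mi])
      show "AE r in lebesgue. r \<in> {a..cl t} \<longrightarrow> norm (G y r) \<le> m r"
        using ae
      proof eventually_elim
        case (elim r)
        have "(apply_bcontfun y r, U r) \<in> ?K" using Sy[OF that, of r] Uin[of r] by blast
        then show ?case unfolding G_def using elim by blast
      qed
    qed
    then show ?thesis using clm(1)[of t] by (simp add: P_def dist_norm)
  qed
  have Pb: "P y \<in> bcontfun" if "y \<in> S" for y
  proof -
    have "range (P y) \<subseteq> cball y0 1" using Pd[OF that] by auto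
    then show ?thesis
      using Pc[of y] bounded_subset[OF bounded_cball] by (auto simp: bcontfun_def)
  qed
  have appP: "apply_bcontfun (Bcontfun (P y)) = P y" if "y \<in> S" for y
    using Pb[OF that] by (rule Bcontfun_inverse)
  have "\<exists>!y\<in>S. Bcontfun (P y) = y"
  proof (rule Banach_fix)
    show "complete S" unfolding S_def by (simp add: complete_eq_closed)
    show "S \<noteq> {}" by (simp add: S_def)
    show "(0::real) \<le> 1/2" "1/2 < (1::real)" by auto
    show "(\<lambda>y. Bcontfun (P y)) ` S \<subseteq> S"
    proof clarify
      fix y assume y: "y \<in> S"
      have "dist (const_bcontfun y0) (Bcontfun (P y)) \<le> 1"
        by (rule dist_bound) (use Pd[OF y] appP[OF y] in auto)
      then show "Bcontfun (P y) \<in> S" by (simp add: S_def)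
    qed
    fix y w assume yw: "y \<in> S" "w \<in> S"
    show "dist (Bcontfun (P y)) (Bcontfun (P w)) \<le> 1/2 * dist y w"
    proof (rule dist_bound)
      fix t
      have "dist (P y t) (P w t) = norm (integral {a..cl t} (\<lambda>r. G y r - G w r))"
        by (simp add: P_def dist_norm integral_diff[OF Gi Gi])
      also have "\<dots> \<le> integral {a..cl t} (\<lambda>r. l r * dist y w)"
      proof (rule integral_norm_bound_AE)
        show "(\<lambda>r. G y r - G w r) integrable_on {a..cl t}" by (intro integrable_diff Gi)
        show "(\<lambda>r. l r * dist y w) integrable_on {a..cl t}" by (intro integrable_on_mult_left li)
        show "AE r in lebesgue. r \<in> {a..cl t} \<longrightarrow> norm (G y r - G w r) \<le> l r * dist y w"
          using ae
        proof eventually_elim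
          case (elim r)
          have "norm (G y r - G w r) \<le> l r * norm ((apply_bcontfun y r, U r) - (apply_bcontfun w r, U r))"
          proof -
            have "(apply_bcontfun y r, U r) \<in> ?K" "(apply_bcontfun w r, U r) \<in> ?K"
              using Sy[OF yw(1), of r] Sy[OF yw(2), of r] Uin[of r] by blast+
            then show ?thesis unfolding G_def using elim by blast
          qed
          also have "\<dots> = l r * dist (apply_bcontfun y r) (apply_bcontfun w r)"
            by (simp add: norm_Pair dist_norm)
          also have "\<dots> \<le> l r * dist y w" by (intro mult_left_mono dist_bounded ml)
          finally show ?case by simp
        qed
      qed
      also have "\<dots> = integral {a..cl t} l * dist y w" by simp
      also have "\<dots> \<le> 1/2 * dist y w" by (intro mult_right_mono clm) auto
      finally show "dist (apply_bcontfun (Bcontfun (P y)) t) (apply_bcontfun (Bcontfun (P w)) t) \<le> 1/2 * dist y w"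
        by (simp add: appP yw)
    qed
  qed
  then obtain y where y: "y \<in> S" "Bcontfun (P y) = y" by blast
  show ?thesis
  proof (rule that[OF \<eta> ycont[of _ y]])
    fix t assume t: "t \<in> {a..a + \<eta>}"
    have "apply_bcontfun y t = P y t" using appP[OF y(1)] y(2) by simp
    also have "\<dots> = y0 + integral {a..t} (G y)" using cl(3)[OF t] by (simp add: P_def)
    also have "integral {a..t} (G y) = integral {a..t} (\<lambda>r. f r (apply_bcontfun y r, u r))"
      by (rule integral_cong) (use t \<eta> in \<open>auto simp: G_def U_def\<close>)
    finally show "apply_bcontfun y t = y0 + integral {a..t} (\<lambda>r. f r (apply_bcontfun y r, u r))" .
  qed
qed

text \<open>On a bounded range the increments of \<open>x\<close> are at most those of a primitive
  of an \<open>m\<close>-bound. That primitive is uniformly continuous on the closed interval, so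
  \<open>x\<close> is uniformly continuous up to \<open>B\<close> and has a limit there.\<close>

lemma bounded_dde_solution_extends_continuously:
  fixes f :: "real \<Rightarrow> 'a::euclidean_space \<times> 'a \<Rightarrow> 'a"
  assumes f: "f \<in> LC" and sol: "dde_solution f \<phi> (ereal B) x" and bd: "bounded (x ` {-1..<B})"
  obtains X where "continuous_on {-1..B} X" "\<And>t. t \<in> {-1..<B} \<Longrightarrow> X t = x t"
proof -
  have B: "0 < B" using sol by (simp add: dde_solution_def)
  have xc: "continuous_on {-1..t} x" if "t < B" for t
    by (rule dde_solution_continuous_on[OF sol]) (use that in simp)
  from bd obtain R where "\<forall>y\<in>x ` {-1..<B}. norm y \<le> R"
    unfolding bounded_iff by blast
  then have R: "x t \<in> cball 0 R" if "t \<in> {-1..<B}" for t using that by simp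
  have "compact (cball (0::'a) R \<times> cball (0::'a) R)" by (intro compact_Times compact_cball)
  from LC_boundsE[OF f this] obtain m l where m0: "\<forall>t. 0 \<le> m t" "\<forall>t. 0 \<le> l t" "\<forall>a b. m absolutely_integrable_on {a..b}"
    "\<forall>a b. l absolutely_integrable_on {a..b}"
    and ae: "AE t in lebesgue. (\<forall>z\<in>cball 0 R \<times> cball 0 R. norm (f t z) \<le> m t) \<and>
       (\<forall>z1\<in>cball 0 R \<times> cball 0 R. \<forall>z2\<in>cball 0 R \<times> cball 0 R.
          norm (f t z1 - f t z2) \<le> l t * norm (z1 - z2))"
    .
  note m = m0[rule_format]
  have mi: "m integrable_on {a..b}" for a b
    using m(3) by (rule set_lebesgue_integral_eq_integral)
  have le: "dist (x t) (x s) \<le> integral {s..t} m" if "0 \<le> s" "s \<le> t" "t < B" for s t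
  proof -
    have I: "((\<lambda>r. f r (x r, x (r - 1))) has_integral (x t - x s)) {s..t}"
      by (rule dde_solution_has_integral[OF sol]) (use that in auto)
    have "norm (integral {s..t} (\<lambda>r. f r (x r, x (r - 1)))) \<le> integral {s..t} m"
    proof (rule integral_norm_bound_AE[OF has_integral_integrable[OF I] mi])
      show "AE r in lebesgue. r \<in> {s..t} \<longrightarrow> norm (f r (x r, x (r - 1))) \<le> m r"
        using ae
      proof eventually_elim
        case (elim r)
        show ?case
        proof
          assume "r \<in> {s..t}"
          then have "x r \<in> cball 0 R" "x (r - 1) \<in> cball 0 R" using that R[of r] R[of "r - 1"] by auto
          then show "norm (f r (x r, x (r - 1))) \<le> m r" using elim by blast
        qed
      qed
    qed
    then show ?thesis using integral_unique[OF I] by (simp add: dist_norm)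
  qed
  have "uniformly_continuous_on {0..B} (\<lambda>t. integral {0..t} m)"
    by (intro compact_uniformly_continuous indefinite_integral_continuous_1 mi compact_Icc)
  then have "uniformly_continuous_on {0..<B} x"
    unfolding uniformly_continuous_on_def
  proof (intro allI impI)
    fix e :: real assume *: "\<forall>e>0. \<exists>d>0. \<forall>x\<in>{0..B}. \<forall>x'\<in>{0..B}. dist x' x < d \<longrightarrow>
        dist (integral {0..x'} m) (integral {0..x} m) < e" and e: "e > 0"
    from *[rule_format, OF e]
    obtain d where d: "d > 0" "\<And>t s. t \<in> {0..B} \<Longrightarrow> s \<in> {0..B} \<Longrightarrow> dist s t < d \<Longrightarrow>
        dist (integral {0..s} m) (integral {0..t} m) < e" by blast
    have main: "dist (x t) (x s) < e" if "0 \<le> s" "s \<le> t" "t < B" "dist s t < d" for s t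
    proof -
      have "integral {0..s} m + integral {s..t} m = integral {0..t} m"
        by (rule Henstock_Kurzweil_Integration.integral_combine) (use that mi in auto)
      then have "integral {s..t} m < e" using d(2)[of t s] that by (auto simp: dist_real_def)
      with le[OF that(1-3)] show ?thesis by simp
    qed
    show "\<exists>d>0. \<forall>s\<in>{0..<B}. \<forall>t\<in>{0..<B}. dist t s < d \<longrightarrow> dist (x t) (x s) < e"
    proof (intro exI[of _ d] conjI d(1) ballI impI)
      fix s t assume "s \<in> {0..<B}" "t \<in> {0..<B}" "dist t s < d"
      then show "dist (x t) (x s) < e"
        using main[of s t] main[of t s] by (cases "s \<le> t") (auto simp: dist_commute)
    qed
  qed
  then obtain g where g: "uniformly_continuous_on (closure {0..<B}) g" "\<And>t. t \<in> {0..<B} \<Longrightarrow> x t = g t"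
    using uniformly_continuous_on_extension_on_closure by metis
  then have gc: "continuous_on {0..B} g" using B by (auto dest: uniformly_continuous_imp_continuous)
  show ?thesis
  proof (rule that[of "\<lambda>t. if t \<le> 0 then x t else g t"])
    have "continuous_on {t \<in> {-1..B}. t \<le> 0} x"
      by (rule continuous_on_subset[OF xc[OF B]]) auto
    moreover have "continuous_on {t \<in> {-1..B}. 0 \<le> t} g"
      by (rule continuous_on_subset[OF gc]) auto
    ultimately show "continuous_on {-1..B} (\<lambda>t. if t \<le> 0 then x t else g t)"
      by (rule continuous_on_cases_le) (use g(2)[of 0] B in auto)
  qed (use g in auto)
qed

text \<open>The limit at \<open>B\<close> of a bounded solution can be taken as a new initial value,
  and its past supplies the delayed argument on the next unit interval. Local existence then gives a
  proper extension, against maximality.\<close>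

lemma maximal_dde_solution_unbounded:
  fixes f :: "real \<Rightarrow> 'a::euclidean_space \<times> 'a \<Rightarrow> 'a"
  assumes f: "f \<in> LC" and max: "maximal_dde_solution f \<phi> (ereal B) x"
  shows "\<not> bounded (x ` {-1..<B})"
proof
  assume bd: "bounded (x ` {-1..<B})"
  have sol: "dde_solution f \<phi> (ereal B) x" using max by (simp add: maximal_dde_solution_def)
  have B: "0 < B" using sol by (simp add: dde_solution_def)
  obtain X where X: "continuous_on {-1..B} X" "\<And>t. t \<in> {-1..<B} \<Longrightarrow> X t = x t"
    using bounded_dde_solution_extends_continuously[OF f sol bd] by blast
  let ?g = "\<lambda>r. f r (X r, X (r - 1))"
  have gi: "?g integrable_on {0..B}"
    by (intro set_lebesgue_integral_eq_integral(1) LC_absolutely_integrable[OF f]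
        continuous_on_delay_pair X) auto
  have Xlt: "X t - integral {0..t} ?g = X 0" if "t \<in> {0..<B}" for t
  proof -
    have "((\<lambda>r. f r (x r, x (r - 1))) has_integral (x t - x 0)) {0..t}"
      by (rule dde_solution_has_integral[OF sol]) (use that in auto)
    then have "(?g has_integral (x t - x 0)) {0..t}"
      by (rule has_integral_eq[rotated]) (use that X(2) in auto)
    from integral_unique[OF this] show ?thesis using X(2)[of t] X(2)[of 0] that by simp
  qed
  \<comment> \<open>The difference of both sides is constant on the half-open interval, and
    continuity carries the identity to \<open>B\<close> itself.\<close>
  have XB: "X t = X 0 + integral {0..t} ?g" if "t \<in> {0..B}" for t
  proof -
    have "continuous_on (closure {0..<B}) (\<lambda>t. X t - integral {0..t} ?g)"
      using B by (auto intro!: continuous_intros indefinite_integral_continuous_1 gi continuous_on_subset[OF X(1)])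
    from continuous_constant_on_closure[OF this Xlt] have "X t - integral {0..t} ?g = X 0"
      using that B by simp
    then show ?thesis by (simp add: algebra_simps)
  qed
  define u where "u r = X (r - 1)" for r
  have "continuous_on {B..B + 1} u"
    unfolding u_def by (intro continuous_on_compose2[OF X(1)] continuous_intros) (use B in auto)
  from caratheodory_local_existence[OF f this, of "X B"] obtain \<eta> y where \<eta>: "0 < \<eta>" "\<eta> \<le> 1"
    and y: "continuous_on {B..B + \<eta>} y"
      "\<And>t. t \<in> {B..B + \<eta>} \<Longrightarrow> y t = X B + integral {B..t} (\<lambda>r. f r (y r, u r))"
    by blast
  have yB: "y B = X B" using y(2)[of B] \<eta> by simp
  define Y where "Y t = (if t \<le> B then X t else y t)" for t
  let ?h = "\<lambda>r. f r (Y r, Y (r - 1))"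
  have Yc: "continuous_on {-1..B + \<eta>} Y"
    unfolding Y_def
    by (rule continuous_on_cases_le)
       (use yB in \<open>auto intro: continuous_on_subset[OF X(1)] continuous_on_subset[OF y(1)]\<close>)
  have hi: "?h integrable_on {0..t}" if "t \<le> B + \<eta>" for t
    by (intro set_lebesgue_integral_eq_integral(1) LC_absolutely_integrable[OF f]
        continuous_on_delay_pair continuous_on_subset[OF Yc]) (use that in auto)
  have "dde_solution f \<phi> (ereal (B + \<eta>)) Y"
  proof (rule dde_solutionI[OF f])
    show "0 < ereal (B + \<eta>)" using B \<eta> by simp
    show "continuous_on {t. -1 \<le> t \<and> ereal t < ereal (B + \<eta>)} Y"
      by (rule continuous_on_subset[OF Yc]) auto
    show "Y t = \<phi> t" if "t \<in> {-1..0}" for t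
      using that B X(2)[of t] sol by (auto simp: Y_def dde_solution_def)
    fix t assume t: "0 \<le> t" "ereal t < ereal (B + \<eta>)"
    have eq: "integral {0..s} ?h = integral {0..s} ?g" if "s \<le> B" for s
      by (rule integral_cong) (use that in \<open>auto simp: Y_def\<close>)
    show "Y t = Y 0 + integral {0..t} ?h"
    proof (cases "t \<le> B")
      case True
      then show ?thesis using XB[of t] eq[OF True] t B by (simp add: Y_def)
    next
      case False
      have "integral {0..B} ?h + integral {B..t} ?h = integral {0..t} ?h"
        by (rule Henstock_Kurzweil_Integration.integral_combine) (use False B t hi in auto)
      moreover have "integral {B..t} ?h = integral {B..t} (\<lambda>r. f r (y r, u r))"
        by (rule integral_cong) (use t \<eta> yB in \<open>auto simp: Y_def u_def\<close>)
      ultimately show ?thesis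
        using y(2)[of t] XB[of B] eq[of B] False t B by (simp add: Y_def)
    qed
  qed
  moreover have "Y t = x t" if "-1 \<le> t" "ereal t < ereal B" for t
    using that X(2)[of t] by (simp add: Y_def)
  moreover have "ereal B < ereal (B + \<eta>)" using \<eta> by simp
  ultimately show False using max unfolding maximal_dde_solution_def by blast
qed

section \<open>Integrable bounds and a Gronwall inequality\<close>

text \<open>For continuous \<open>F t\<close> the supremum over \<open>S\<close> equals that over a
  countable dense subset, which is measurable in \<open>t\<close>. This handles the uncountable
  suprema in the optimal bounds.\<close>

lemma SUP_ennreal_AE_measurable:
  fixes F :: "'m::euclidean_space \<Rightarrow> 'a::euclidean_space \<Rightarrow> real"
  assumes meas: "\<And>p. p \<in> S \<Longrightarrow> (\<lambda>t. F t p) \<in> borel_measurable lebesgue"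
    and cont: "AE t in lebesgue. continuous_on S (F t)"
  shows "\<exists>g\<in>borel_measurable lebesgue. AE t in lebesgue. (SUP p\<in>S. ennreal (F t p)) = g t"
proof -
  obtain Q where Q: "countable Q" "Q \<subseteq> S" "S \<subseteq> closure Q" using separable by blast
  define g where "g t = (SUP p\<in>Q. ennreal (F t p))" for t
  have "g \<in> borel_measurable lebesgue"
    unfolding g_def by (rule borel_measurable_SUP[OF Q(1)]) (use meas Q(2) in auto)
  moreover have "AE t in lebesgue. (SUP p\<in>S. ennreal (F t p)) = g t"
    using cont
  proof eventually_elim
    case (elim t)
    then have c: "continuous_on S (\<lambda>p. ennreal (F t p))" by (rule continuous_on_ennreal)
    show ?case
    proof (rule antisym)
      show "(SUP p\<in>S. ennreal (F t p)) \<le> g t"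
      proof (rule SUP_least)
        fix p assume p: "p \<in> S"
        then obtain q where q: "\<And>n. q n \<in> Q" "q \<longlonglongrightarrow> p"
          using Q(3) closure_sequential by (metis subsetD)
        have "(\<lambda>n. ennreal (F t (q n))) \<longlonglongrightarrow> ennreal (F t p)"
          using c p q Q(2) unfolding continuous_on_sequentially comp_def by blast
        then show "ennreal (F t p) \<le> g t"
          by (rule LIMSEQ_le_const2) (auto simp: g_def intro!: SUP_upper q)
      qed
      show "g t \<le> (SUP p\<in>S. ennreal (F t p))"
        unfolding g_def using Q(2) by (intro SUP_subset_mono) auto
    qed
  qed
  ultimately show ?thesis by blast
qed

text \<open>A finite integral makes the extended-real bound finite almost everywhere, so the
  conversion to a real function loses nothing outside a null set. Cutting off outside
  \<open>{a..b}\<close> makes the result integrable on the whole line.\<close>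

lemma integrable_real_majorant:
  fixes L :: "real \<Rightarrow> ennreal"
  assumes g: "g \<in> borel_measurable lebesgue" "AE t in lebesgue. L t = g t"
    and C: "(\<integral>\<^sup>+t\<in>{a..b}. L t \<partial>lebesgue) \<le> ennreal C" "0 \<le> C"
  shows "\<exists>k. (\<forall>t. 0 \<le> k t) \<and> k absolutely_integrable_on {a..b} \<and> integral {a..b} k \<le> C \<and>
    (AE t in lebesgue. t \<in> {a..b} \<longrightarrow> L t \<le> ennreal (k t))"
proof -
  define G where "G t = g t * indicator {a..b} t" for t
  define k where "k t = enn2real (G t)" for t
  have Gm: "G \<in> borel_measurable lebesgue"
    unfolding G_def by (intro borel_measurable_times_ennreal g borel_measurable_indicator) auto
  then have km: "k \<in> borel_measurable lebesgue" unfolding k_def by measurable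
  have "(\<integral>\<^sup>+t. G t \<partial>lebesgue) = (\<integral>\<^sup>+t\<in>{a..b}. L t \<partial>lebesgue)"
    by (rule nn_integral_cong_AE) (use g(2) in \<open>eventually_elim, simp add: G_def\<close>)
  with C have GC: "(\<integral>\<^sup>+t. G t \<partial>lebesgue) \<le> ennreal C" by simp
  then have "AE t in lebesgue. G t \<noteq> \<infinity>"
    by (intro nn_integral_PInf_AE Gm) (auto simp: top_unique)
  then have kG: "AE t in lebesgue. ennreal (k t) = G t"
    by eventually_elim (simp add: k_def less_top)
  have kC: "(\<integral>\<^sup>+t. ennreal (k t) \<partial>lebesgue) \<le> ennreal C"
    using GC nn_integral_cong_AE[OF kG] by simp
  then have ki: "integrable lebesgue k"
    by (intro integrableI_nonneg km) (auto simp: k_def intro: le_less_trans)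
  have ind: "(\<lambda>t. indicator {a..b} t *\<^sub>R k t) = k"
    by (auto simp: k_def G_def indicator_def)
  have ka: "k absolutely_integrable_on {a..b}"
    unfolding set_integrable_def ind by (rule ki)
  have "(\<integral>\<^sup>+t. ennreal (k t) \<partial>lebesgue) = ennreal (LINT t|lebesgue. k t)"
    by (rule nn_integral_eq_integral[OF ki]) (simp add: k_def)
  with kC have "ennreal (LINT t|lebesgue. k t) \<le> ennreal C" by simp
  then have "(LINT t|lebesgue. k t) \<le> C" using C(2) by simp
  then have "integral {a..b} k \<le> C"
    using set_lebesgue_integral_eq_integral(2)[OF ka] unfolding set_lebesgue_integral_def ind by simp
  moreover have "AE t in lebesgue. t \<in> {a..b} \<longrightarrow> L t \<le> ennreal (k t)"
    using kG g(2) by eventually_elim (simp add: G_def)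
  moreover have "\<forall>t. 0 \<le> k t" by (simp add: k_def)
  ultimately show ?thesis using ka by blast
qed

lemma LC_AE_continuous_on:
  assumes f: "f \<in> LC" and K: "compact K"
  shows "AE t in lebesgue. continuous_on K (f t)"
proof -
  from LC_boundsE[OF assms] obtain m l where "\<forall>t. 0 \<le> m t" and l: "\<forall>t. 0 \<le> l t"
    and "\<forall>a b. m absolutely_integrable_on {a..b}" "\<forall>a b. l absolutely_integrable_on {a..b}"
    and ae: "AE t in lebesgue. (\<forall>z\<in>K. norm (f t z) \<le> m t) \<and>
       (\<forall>z1\<in>K. \<forall>z2\<in>K. norm (f t z1 - f t z2) \<le> l t * norm (z1 - z2))"
    .
  from ae show ?thesis
  proof eventually_elim
    case (elim t)
    have "(l t)-lipschitz_on K (f t)"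
      by (rule lipschitz_onI) (use elim l in \<open>auto simp: dist_norm\<close>)
    then show ?case by (rule lipschitz_on_continuous_on)
  qed
qed

lemma borel_measurable_LC_point:
  assumes f: "f \<in> LC"
  shows "(\<lambda>t. f t z) \<in> borel_measurable lebesgue"
  using borel_measurable_LC_comp[OF f, of "\<lambda>_. z"] by (simp add: measurable_completion)

text \<open>Together with its two analogues for \<open>l_bound\<close> and \<open>l2_bound\<close>,
  this turns optimal bounds into real integrable functions whose integrals respect a prescribed
  \<open>C\<close>, so uniformity over \<open>E\<close> survives the passage to
  representatives.\<close>

lemma LC_m_bound_integrable:
  fixes f :: "real \<Rightarrow> 'a::euclidean_space \<Rightarrow> 'b::euclidean_space"
  assumes f: "f \<in> LC" and C: "(\<integral>\<^sup>+t\<in>{a..b}. m_bound j f t \<partial>lebesgue) \<le> ennreal C" "0 \<le> C"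
  shows "\<exists>k. (\<forall>t. 0 \<le> k t) \<and> k absolutely_integrable_on {a..b} \<and> integral {a..b} k \<le> C \<and>
    (AE t in lebesgue. t \<in> {a..b} \<longrightarrow> (\<forall>z\<in>cball 0 (real j). norm (f t z) \<le> k t))"
proof -
  obtain g where g: "g \<in> borel_measurable lebesgue" "AE t in lebesgue. m_bound j f t = g t"
    using m_bound_AE_measurable[OF f] .
  from integrable_real_majorant[OF g C] obtain k where k: "\<forall>t. 0 \<le> k t" "k absolutely_integrable_on {a..b}"
    "integral {a..b} k \<le> C" "AE t in lebesgue. t \<in> {a..b} \<longrightarrow> m_bound j f t \<le> ennreal (k t)"
    by blast
  have "AE t in lebesgue. t \<in> {a..b} \<longrightarrow> (\<forall>z\<in>cball 0 (real j). norm (f t z) \<le> k t)"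
    using k(4)
  proof eventually_elim
    case (elim t)
    then show ?case
      using k(1) by (auto simp: m_bound_def SUP_le_iff)
  qed
  with k show ?thesis by blast
qed

text \<open>Difference quotients are continuous on pairs of distinct points, which is what makes
  their supremum measurable; on the diagonal the Lipschitz inequality is trivial.\<close>

lemma LC_l_bound_integrable:
  fixes f :: "real \<Rightarrow> 'a::euclidean_space \<Rightarrow> 'b::euclidean_space"
  assumes f: "f \<in> LC" and C: "(\<integral>\<^sup>+t\<in>{a..b}. l_bound j f t \<partial>lebesgue) \<le> ennreal C" "0 \<le> C"
  shows "\<exists>k. (\<forall>t. 0 \<le> k t) \<and> k absolutely_integrable_on {a..b} \<and> integral {a..b} k \<le> C \<and>
    (AE t in lebesgue. t \<in> {a..b} \<longrightarrow> (\<forall>z1\<in>cball 0 (real j). \<forall>z2\<in>cball 0 (real j).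
       norm (f t z1 - f t z2) \<le> k t * norm (z1 - z2)))"
proof -
  let ?B = "cball (0::'a) (real j)"
  let ?S = "{(z1, z2). z1 \<in> ?B \<and> z2 \<in> ?B \<and> z1 \<noteq> z2}"
  define F where "F t p = norm (f t (fst p) - f t (snd p)) / norm (fst p - snd p)" for t and p :: "'a \<times> 'a"
  have "\<exists>g\<in>borel_measurable lebesgue. AE t in lebesgue. (SUP p\<in>?S. ennreal (F t p)) = g t"
  proof (rule SUP_ennreal_AE_measurable)
    note [measurable] = borel_measurable_LC_point[OF f]
    show "(\<lambda>t. F t p) \<in> borel_measurable lebesgue" for p
      unfolding F_def by measurable
    show "AE t in lebesgue. continuous_on ?S (F t)"
      using LC_AE_continuous_on[OF f compact_cball, of 0 "real j"]
    proof eventually_elim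
      case (elim t)
      show ?case unfolding F_def
        by (intro continuous_intros continuous_on_compose2[OF elim]) auto
    qed
  qed
  moreover have "(SUP p\<in>?S. ennreal (F t p)) = l_bound j f t" for t
    unfolding l_bound_def F_def by (simp add: case_prod_unfold)
  ultimately obtain g where g: "g \<in> borel_measurable lebesgue" "AE t in lebesgue. l_bound j f t = g t"
    by auto
  from integrable_real_majorant[OF g C] obtain k where k: "\<forall>t. 0 \<le> k t" "k absolutely_integrable_on {a..b}"
    "integral {a..b} k \<le> C" "AE t in lebesgue. t \<in> {a..b} \<longrightarrow> l_bound j f t \<le> ennreal (k t)"
    by blast
  have "AE t in lebesgue. t \<in> {a..b} \<longrightarrow> (\<forall>z1\<in>?B. \<forall>z2\<in>?B. norm (f t z1 - f t z2) \<le> k t * norm (z1 - z2))"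
    using k(4)
  proof eventually_elim
    case (elim t)
    show ?case
    proof (intro impI ballI)
      fix z1 z2 assume t: "t \<in> {a..b}" and z: "z1 \<in> ?B" "z2 \<in> ?B"
      show "norm (f t z1 - f t z2) \<le> k t * norm (z1 - z2)"
      proof (cases "z1 = z2")
        case False
        have "ennreal (norm (f t z1 - f t z2) / norm (z1 - z2)) \<le> l_bound j f t"
          unfolding l_bound_def by (rule SUP_upper2[of "(z1, z2)"]) (use z False in auto)
        also have "\<dots> \<le> ennreal (k t)" using elim t by blast
        finally have "norm (f t z1 - f t z2) / norm (z1 - z2) \<le> k t" using k(1) by simp
        then show ?thesis using False by (simp add: field_simps)
      qed simp
    qed
  qed
  with k show ?thesis by blast
qed

lemma LC_l2_bound_integrable:
  fixes f :: "real \<Rightarrow> 'a::euclidean_space \<times> 'c::euclidean_space \<Rightarrow> 'b::euclidean_space"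
  assumes f: "f \<in> LC" and C: "(\<integral>\<^sup>+t\<in>{a..b}. l2_bound j f t \<partial>lebesgue) \<le> ennreal C" "0 \<le> C"
  shows "\<exists>k. (\<forall>t. 0 \<le> k t) \<and> k absolutely_integrable_on {a..b} \<and> integral {a..b} k \<le> C \<and>
    (AE t in lebesgue. t \<in> {a..b} \<longrightarrow> (\<forall>x u1 u2. (x, u1) \<in> cball 0 (real j) \<longrightarrow> (x, u2) \<in> cball 0 (real j) \<longrightarrow>
       norm (f t (x, u1) - f t (x, u2)) \<le> k t * norm (u1 - u2)))"
proof -
  let ?B = "cball (0::'a \<times> 'c) (real j)"
  let ?S = "{(x, u1, u2). (x, u1) \<in> ?B \<and> (x, u2) \<in> ?B \<and> u1 \<noteq> u2}"
  define F where "F t p = norm (f t (fst p, fst (snd p)) - f t (fst p, snd (snd p))) / norm (fst (snd p) - snd (snd p))"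
    for t and p :: "'a \<times> 'c \<times> 'c"
  have "\<exists>g\<in>borel_measurable lebesgue. AE t in lebesgue. (SUP p\<in>?S. ennreal (F t p)) = g t"
  proof (rule SUP_ennreal_AE_measurable)
    note [measurable] = borel_measurable_LC_point[OF f]
    show "(\<lambda>t. F t p) \<in> borel_measurable lebesgue" for p
      unfolding F_def by measurable
    show "AE t in lebesgue. continuous_on ?S (F t)"
      using LC_AE_continuous_on[OF f compact_cball, of 0 "real j"]
    proof eventually_elim
      case (elim t)
      show ?case unfolding F_def
        by (intro continuous_intros continuous_on_compose2[OF elim]) auto
    qed
  qed
  moreover have "(SUP p\<in>?S. ennreal (F t p)) = l2_bound j f t" for t
    unfolding l2_bound_def F_def by (simp add: case_prod_unfold)
  ultimately obtain g where g: "g \<in> borel_measurable lebesgue" "AE t in lebesgue. l2_bound j f t = g t"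
    by auto
  from integrable_real_majorant[OF g C] obtain k where k: "\<forall>t. 0 \<le> k t" "k absolutely_integrable_on {a..b}"
    "integral {a..b} k \<le> C" "AE t in lebesgue. t \<in> {a..b} \<longrightarrow> l2_bound j f t \<le> ennreal (k t)"
    by blast
  have "AE t in lebesgue. t \<in> {a..b} \<longrightarrow> (\<forall>x u1 u2. (x, u1) \<in> ?B \<longrightarrow> (x, u2) \<in> ?B \<longrightarrow>
       norm (f t (x, u1) - f t (x, u2)) \<le> k t * norm (u1 - u2))"
    using k(4)
  proof eventually_elim
    case (elim t)
    show ?case
    proof (intro impI allI)
      fix x u1 u2 assume t: "t \<in> {a..b}" and z: "(x, u1) \<in> ?B" "(x, u2) \<in> ?B"
      show "norm (f t (x, u1) - f t (x, u2)) \<le> k t * norm (u1 - u2)"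
      proof (cases "u1 = u2")
        case False
        have "ennreal (norm (f t (x, u1) - f t (x, u2)) / norm (u1 - u2)) \<le> l2_bound j f t"
          unfolding l2_bound_def by (rule SUP_upper2[of "(x, u1, u2)"]) (use z False in auto)
        also have "\<dots> \<le> ennreal (k t)" using elim t by blast
        finally have "norm (f t (x, u1) - f t (x, u2)) / norm (u1 - u2) \<le> k t" using k(1) by simp
        then show ?thesis using False by (simp add: field_simps)
      qed simp
    qed
  qed
  with k show ?thesis by blast
qed

text \<open>
  Whenever \<open>K\<close> grows by at most \<open>1/2\<close>, the maximum of \<open>v\<close> can be absorbed into the left-hand side of
  \<open>step\<close> and the bound at most doubles, up to \<open>e\<close>. This avoids differentiating an exponential of the
  absolutely continuous \<open>K\<close>.
\<close>

lemma gronwall_delay: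
  fixes v K :: "real \<Rightarrow> real"
  assumes v: "continuous_on {-1..\<tau>} v" and K: "continuous_on {0..\<tau>} K" "K 0 = 0"
    and e: "0 \<le> e" and \<delta>: "0 \<le> \<delta>" "\<And>t. t \<in> {-1..0} \<Longrightarrow> v t \<le> \<delta>"
    and step: "\<And>s t M. 0 \<le> s \<Longrightarrow> s \<le> t \<Longrightarrow> t \<le> \<tau> \<Longrightarrow> 0 \<le> M \<Longrightarrow> (\<And>r. r \<in> {-1..t} \<Longrightarrow> v r \<le> M) \<Longrightarrow>
        v t \<le> v s + M * (K t - K s) + e"
    and mono: "\<And>s t. 0 \<le> s \<Longrightarrow> s \<le> t \<Longrightarrow> t \<le> \<tau> \<Longrightarrow> K s \<le> K t"
    and pos: "\<And>t. t \<in> {-1..\<tau>} \<Longrightarrow> 0 \<le> v t"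
    and \<tau>: "0 \<le> \<tau>" "K \<tau> \<le> real m / 2" and r: "r \<in> {-1..\<tau>}"
  shows "v r \<le> 2 ^ Suc m * (\<delta> + 2 * e)"
proof -
  have double: "v r \<le> 2 * A + 2 * e"
    if "0 \<le> s" "s \<le> t" "t \<le> \<tau>" "K t - K s \<le> 1 / 2" "0 \<le> A" and A: "\<And>r. r \<in> {-1..s} \<Longrightarrow> v r \<le> A"
      and r: "r \<in> {-1..t}" for s t A r
  proof -
    have "continuous_on {-1..t} v" by (rule continuous_on_subset[OF v]) (use that in auto)
    moreover have "{-1..t} \<noteq> {}" using that(1,2) by simp
    ultimately obtain p where p: "p \<in> {-1..t}" "\<And>r. r \<in> {-1..t} \<Longrightarrow> v r \<le> v p"
      using continuous_attains_sup[OF compact_Icc] by blast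
    have vp: "0 \<le> v p" using p that by (intro pos) auto
    have "v p \<le> 2 * A + 2 * e"
    proof (cases "p \<le> s")
      case True
      then show ?thesis using A[of p] p \<open>0 \<le> A\<close> e by simp
    next
      case False
      have "v p \<le> v s + v p * (K p - K s) + e"
        by (rule step) (use False p that vp in auto)
      moreover have "v p * (K p - K s) \<le> v p * (1 / 2)"
        by (rule mult_left_mono) (use mono[of p t] that p False vp in auto)
      moreover have "v s \<le> A" using that by auto
      ultimately show ?thesis by simp
    qed
    with p(2)[OF r] show ?thesis by simp
  qed
  \<comment> \<open>This solves the recursion \<open>B (Suc n) = 2 * B n + 2 * e\<close> produced by
    \<open>double\<close>, starting from \<open>B 0 = \<delta>\<close>.\<close>
  define B where "B n = 2 ^ n * (\<delta> + 2 * e) - 2 * e" for n :: nat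
  have BSuc: "B (Suc n) = 2 * B n + 2 * e" for n by (simp add: B_def algebra_simps)
  have B0: "\<delta> \<le> B n" for n
    by (induction n) (use e \<delta>(1) in \<open>auto simp: BSuc B_def[of 0]\<close>)
  have Bpos: "0 \<le> B n" for n using B0[of n] \<delta>(1) by simp
  \<comment> \<open>The index is \<open>Suc n\<close> because even where \<open>K t \<le> 0\<close>
    the additive error \<open>e\<close> can raise \<open>v\<close> above \<open>\<delta>\<close>;
    the base case already spends one doubling.\<close>
  have main: "v r \<le> B (Suc n)"
    if "0 \<le> t" "t \<le> \<tau>" "K t \<le> real n / 2" "r \<in> {-1..t}" for n t r
    using that
  proof (induction n arbitrary: t r)
    case (0 t r)
    have "v r \<le> 2 * B 0 + 2 * e"
      by (rule double[of 0 t]) (use 0 K(2) \<delta>(2) B0[of 0] Bpos in \<open>auto intro: order_trans\<close>)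
    then show ?case by (simp add: BSuc)
  next
    case (Suc n t r)
    show ?case
    proof (cases "K t \<le> real n / 2")
      case True
      have "v r \<le> B (Suc n)" by (rule Suc.IH[OF Suc.prems(1,2) True Suc.prems(4)])
      then show ?thesis using Bpos[of "Suc n"] e by (simp add: BSuc[of "Suc n"])
    next
      case False
      \<comment> \<open>Restarting where \<open>K\<close> equals \<open>n / 2\<close> leaves a
        growth of at most 1/2 up to \<open>t\<close>, just what \<open>double\<close>
        tolerates.\<close>
      have "\<exists>s\<ge>0. s \<le> t \<and> K s = real n / 2"
        by (rule IVT') (use False K Suc.prems in \<open>auto intro: continuous_on_subset\<close>)
      then obtain s where s: "0 \<le> s" "s \<le> t" "K s = real n / 2" by blast
      have "v r \<le> 2 * B (Suc n) + 2 * e"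
        by (rule double[of s t]) (use s Suc Bpos in \<open>auto simp: field_simps\<close>)
      then show ?thesis by (simp add: BSuc[of "Suc n"])
    qed
  qed
  have "v r \<le> B (Suc m)" using main[OF \<tau>(1) _ \<tau>(2) r] by simp
  then show ?thesis using e by (simp add: B_def)
qed

section \<open>Stability under perturbations of the right-hand side\<close>

text \<open>
  The common form of the estimates under \<open>T_Theta\<close> and \<open>T_D\<close>: a Gronwall kernel \<open>k\<close> with integral bounded
  by a fixed \<open>C\<close>, and an error \<open>h\<close> with integral at most \<open>e\<close>.
\<close>

definition rhs_close_upto ::
  "real \<Rightarrow> real \<Rightarrow> real \<Rightarrow> (real \<Rightarrow> 'a::euclidean_space \<times> 'a \<Rightarrow> 'a) \<Rightarrow> (real \<Rightarrow> 'a) \<Rightarrow>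
   (real \<Rightarrow> 'a \<times> 'a \<Rightarrow> 'a) \<Rightarrow> (real \<Rightarrow> 'a) \<Rightarrow> bool" where
  "rhs_close_upto \<tau> C e g y f x \<longleftrightarrow> (\<exists>k h. (\<forall>t. 0 \<le> k t) \<and> (\<forall>t. 0 \<le> h t) \<and>
     k absolutely_integrable_on {0..\<tau>} \<and> h absolutely_integrable_on {0..\<tau>} \<and>
     integral {0..\<tau>} k \<le> C \<and> integral {0..\<tau>} h \<le> e \<and>
     (AE t in lebesgue. t \<in> {0..\<tau>} \<longrightarrow> norm (g t (y t, y (t - 1)) - f t (x t, x (t - 1)))
        \<le> k t * (norm (y t - x t) + norm (y (t - 1) - x (t - 1))) + h t))"

text \<open>The crossing time is the minimum of the compact level set; a larger value before it
  would produce an earlier point of that set by the intermediate value theorem.\<close>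

lemma first_crossing:
  fixes v :: "real \<Rightarrow> real"
  assumes v: "continuous_on {a..b} v" and "a \<le> b" "v a < c" "c \<le> v b"
  obtains s where "a \<le> s" "s \<le> b" "v s = c" "\<And>r. a \<le> r \<Longrightarrow> r \<le> s \<Longrightarrow> v r \<le> c"
proof -
  let ?S = "{s \<in> {a..b}. v s = c}"
  have "closed ?S" by (rule continuous_closed_preimage_constant[OF v closed_atLeastAtMost])
  moreover have "bounded ?S" by (rule bounded_subset[OF bounded_closed_interval[of a b]]) auto
  ultimately have "compact ?S" by (simp add: compact_eq_bounded_closed)
  have ivt: "\<exists>s. a \<le> s \<and> s \<le> r \<and> v s = c" if "a \<le> r" "r \<le> b" "c \<le> v r" for r
    by (rule IVT') (use assms that in \<open>auto intro: continuous_on_subset[OF v]\<close>)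
  have "?S \<noteq> {}" using ivt[of b] assms by auto
  from compact_attains_inf[OF \<open>compact ?S\<close> this]
  obtain s where s: "s \<in> ?S" "\<And>r. r \<in> ?S \<Longrightarrow> s \<le> r" by blast
  show ?thesis
  proof (rule that[of s])
    fix r assume r: "a \<le> r" "r \<le> s"
    show "v r \<le> c"
    proof (rule ccontr)
      assume "\<not> v r \<le> c"
      then obtain q where "a \<le> q" "q \<le> r" "v q = c" using ivt[of r] r s by auto
      then have "s \<le> q" using s r by auto
      with \<open>q \<le> r\<close> r have "r = s" by simp
      with \<open>\<not> v r \<le> c\<close> s show False by simp
    qed
  qed (use s in auto)
qed

lemma dde_solutions_difference_bound:
  fixes f g :: "real \<Rightarrow> 'a::euclidean_space \<times> 'a \<Rightarrow> 'a"
  assumes x: "dde_solution f \<phi> b x" and y: "dde_solution g \<psi> c y"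
    and \<tau>: "0 \<le> \<tau>" "ereal \<tau> < b" "ereal \<tau> < c"
    and \<delta>: "0 \<le> \<delta>" "\<And>t. t \<in> {-1..0} \<Longrightarrow> norm (\<psi> t - \<phi> t) \<le> \<delta>" and e: "0 \<le> e"
    and close: "rhs_close_upto \<tau> C e g y f x" and m: "4 * C \<le> real m"
    and r: "r \<in> {-1..\<tau>}"
  shows "norm (y r - x r) \<le> 2 ^ Suc m * (\<delta> + 2 * e)"
proof -
  from close obtain k h where k0: "\<And>t. 0 \<le> k t" and h0: "\<And>t. 0 \<le> h t"
    and ka: "k absolutely_integrable_on {0..\<tau>}" and ha: "h absolutely_integrable_on {0..\<tau>}"
    and kC: "integral {0..\<tau>} k \<le> C" and he: "integral {0..\<tau>} h \<le> e"
    and ae: "AE t in lebesgue. t \<in> {0..\<tau>} \<longrightarrow> norm (g t (y t, y (t - 1)) - f t (x t, x (t - 1)))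
        \<le> k t * (norm (y t - x t) + norm (y (t - 1) - x (t - 1))) + h t"
    unfolding rhs_close_upto_def by blast
  have ki: "k integrable_on {s..t}" and hi: "h integrable_on {s..t}" if "0 \<le> s" "t \<le> \<tau>" for s t
    using that by (auto intro!: integrable_on_subinterval[OF set_lebesgue_integral_eq_integral(1)] ka ha)
  have xc: "continuous_on {-1..\<tau>} x" by (rule dde_solution_continuous_on[OF x \<tau>(2)])
  have yc: "continuous_on {-1..\<tau>} y" by (rule dde_solution_continuous_on[OF y \<tau>(3)])
  \<comment> \<open>The factor 2 accounts for the current and the delayed deviation, each bounded by
    the same \<open>M\<close>. Hence \<open>K \<tau> \<le> 2 * C \<le> m / 2\<close>, the origin of
    the condition \<open>4 * C \<le> real m\<close>.\<close>
  define K where "K t = 2 * integral {0..t} k" for t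
  have Kdiff: "K t - K s = 2 * integral {s..t} k" if "0 \<le> s" "s \<le> t" "t \<le> \<tau>" for s t
    using Henstock_Kurzweil_Integration.integral_combine[of 0 s t k] that ki[of 0 t] by (simp add: K_def)
  show ?thesis
  proof (rule gronwall_delay[where v = "\<lambda>t. norm (y t - x t)" and K = K and \<tau> = \<tau>])
    show "continuous_on {-1..\<tau>} (\<lambda>t. norm (y t - x t))"
      by (intro continuous_intros xc yc)
    show "continuous_on {0..\<tau>} K"
      unfolding K_def by (intro continuous_intros indefinite_integral_continuous_1 ki) auto
    show "K 0 = 0" by (simp add: K_def)
    show "norm (y t - x t) \<le> \<delta>" if "t \<in> {-1..0}" for t
      using \<delta>(2)[OF that] x y that by (simp add: dde_solution_def)
    show "K s \<le> K t" if "0 \<le> s" "s \<le> t" "t \<le> \<tau>" for s t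
    proof -
      have "0 \<le> integral {s..t} k" by (rule Henstock_Kurzweil_Integration.integral_nonneg) (use ki that k0 in auto)
      then show ?thesis using Kdiff[OF that] by simp
    qed
    show "K \<tau> \<le> real m / 2" using kC m by (simp add: K_def)
    fix s t M assume st: "0 \<le> s" "s \<le> t" "t \<le> \<tau>" and "(0::real) \<le> M"
      and M: "\<And>r. r \<in> {-1..t} \<Longrightarrow> norm (y r - x r) \<le> M"
    have tb: "ereal t < b" "ereal t < c" using st \<tau> by (auto intro: le_less_trans[of "ereal t" "ereal \<tau>"])
    have I: "((\<lambda>r. g r (y r, y (r - 1)) - f r (x r, x (r - 1))) has_integral ((y t - y s) - (x t - x s))) {s..t}"
      by (intro has_integral_diff dde_solution_has_integral[OF x st(1,2) tb(1)]
          dde_solution_has_integral[OF y st(1,2) tb(2)])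
    have "norm ((y t - y s) - (x t - x s)) \<le> integral {s..t} (\<lambda>r. k r * (2 * M) + h r)"
      unfolding integral_unique[OF I, symmetric]
    proof (rule integral_norm_bound_AE[OF has_integral_integrable[OF I]])
      show "(\<lambda>r. k r * (2 * M) + h r) integrable_on {s..t}"
        by (intro integrable_add integrable_on_mult_left ki hi st)
      show "AE r in lebesgue. r \<in> {s..t} \<longrightarrow>
          norm (g r (y r, y (r - 1)) - f r (x r, x (r - 1))) \<le> k r * (2 * M) + h r"
        using ae
      proof eventually_elim
        case (elim r)
        show ?case
        proof
          assume r: "r \<in> {s..t}"
          have "norm (y r - x r) + norm (y (r - 1) - x (r - 1)) \<le> 2 * M"
            using M[of r] M[of "r - 1"] r st by auto
          then have "k r * (norm (y r - x r) + norm (y (r - 1) - x (r - 1))) \<le> k r * (2 * M)"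
            using k0 by (rule mult_left_mono)
          then show "norm (g r (y r, y (r - 1)) - f r (x r, x (r - 1))) \<le> k r * (2 * M) + h r"
            using elim r st by auto
        qed
      qed
    qed
    also have "\<dots> = M * (K t - K s) + integral {s..t} h"
      using Kdiff[OF st] st by (subst integral_add) (auto intro!: ki hi integrable_on_mult_left)
    also have "integral {s..t} h \<le> integral {0..\<tau>} h"
      by (rule integral_subset_le) (use st hi h0 in auto)
    finally have "norm ((y t - x t) - (y s - x s)) \<le> M * (K t - K s) + e"
      using he by (simp add: algebra_simps)
    then show "norm (y t - x t) \<le> norm (y s - x s) + M * (K t - K s) + e"
      using norm_triangle_ineq2[of "y t - x t" "y s - x s"] by linarith
  qed (use \<delta> e \<tau> r in auto)
qed

text \<open>The derivative of the difference is almost everywhere the difference of the right-hand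
  sides. With both deviations at most \<open>\<eta>\<close> its norm is at most
  \<open>2 * \<eta> * k + h\<close>, so the derivative part of the norm needs only the uniform bound
  already obtained.\<close>

lemma C11_norm_le:
  fixes f g :: "real \<Rightarrow> 'a::euclidean_space \<times> 'a \<Rightarrow> 'a"
  assumes x: "dde_solution f \<phi> b x" and y: "dde_solution g \<psi> c y"
    and T: "0 \<le> T" "ereal T < b" "ereal T < c"
    and close: "rhs_close_upto T C e g y f x" and C: "0 \<le> C" and e: "0 \<le> e"
    and \<eta>: "\<And>r. r \<in> {-1..T} \<Longrightarrow> norm (y r - x r) \<le> \<eta>"
  shows "C11_norm {0..T} (\<lambda>t. y t - x t) \<le> ennreal (\<eta> + 2 * C * \<eta> + e)"
proof -
  have \<eta>0: "0 \<le> \<eta>" using order_trans[OF norm_ge_zero \<eta>[of 0]] T by simp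
  from close obtain k h where k0: "\<And>t. 0 \<le> k t" and h0: "\<And>t. 0 \<le> h t"
    and ka: "k absolutely_integrable_on {0..T}" and ha: "h absolutely_integrable_on {0..T}"
    and kC: "integral {0..T} k \<le> C" and he: "integral {0..T} h \<le> e"
    and ae: "AE t in lebesgue. t \<in> {0..T} \<longrightarrow> norm (g t (y t, y (t - 1)) - f t (x t, x (t - 1)))
        \<le> k t * (norm (y t - x t) + norm (y (t - 1) - x (t - 1))) + h t"
    unfolding rhs_close_upto_def by blast
  define q where "q t = k t * (2 * \<eta>) + h t" for t
  have q0: "0 \<le> q t" for t using k0 h0 \<eta>0 by (simp add: q_def)
  have qa: "q absolutely_integrable_on {0..T}"
    unfolding q_def by (intro set_integral_add ha set_integrable_mult_left ka)
  have "integral {0..T} q = integral {0..T} k * (2 * \<eta>) + integral {0..T} h"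
    unfolding q_def using ka ha
    by (subst integral_add) (auto intro!: integrable_on_mult_left set_lebesgue_integral_eq_integral(1))
  also have "\<dots> \<le> C * (2 * \<eta>) + e" by (intro add_mono mult_right_mono kC he) (use \<eta>0 in auto)
  finally have qi: "integral {0..T} q \<le> 2 * C * \<eta> + e" by simp
  have aex: "AE t in lebesgue. 0 < t \<and> ereal t < b \<longrightarrow> (x has_vector_derivative f t (x t, x (t - 1))) (at t)"
    using x by (simp add: dde_solution_def)
  have aey: "AE t in lebesgue. 0 < t \<and> ereal t < c \<longrightarrow> (y has_vector_derivative g t (y t, y (t - 1))) (at t)"
    using y by (simp add: dde_solution_def)
  \<comment> \<open>Discarding the endpoints makes the derivative within the interval the two-sided
    one, and leaves only positive times, where the equation is available.\<close>
  have ae0: "AE t in lebesgue. t \<noteq> 0 \<and> t \<noteq> T"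
    by (simp add: AE_completion AE_lborel_singleton)
  have "(\<integral>\<^sup>+t\<in>{0..T}. ennreal (norm (vector_derivative (\<lambda>t. y t - x t) (at t within {0..T}))) \<partial>lebesgue)
      \<le> (\<integral>\<^sup>+t. ennreal (indicator {0..T} t *\<^sub>R q t) \<partial>lebesgue)"
  proof (rule nn_integral_mono_AE)
    show "AE t in lebesgue. ennreal (norm (vector_derivative (\<lambda>t. y t - x t) (at t within {0..T}))) * indicator {0..T} t
        \<le> ennreal (indicator {0..T} t *\<^sub>R q t)"
      using ae aex aey ae0
    proof eventually_elim
      case (elim t)
      show ?case
      proof (cases "t \<in> {0..T}")
        case True
        then have t: "0 < t" "t < T" using elim(4) by auto
        then have tb: "ereal t < b" "ereal t < c" using T by (auto intro: less_trans[of "ereal t" "ereal T"])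
        have "((\<lambda>t. y t - x t) has_vector_derivative (g t (y t, y (t - 1)) - f t (x t, x (t - 1)))) (at t)"
          by (intro has_vector_derivative_diff) (use elim t tb in auto)
        then have "vector_derivative (\<lambda>t. y t - x t) (at t within {0..T}) = g t (y t, y (t - 1)) - f t (x t, x (t - 1))"
          using t by (simp add: at_within_Icc_at vector_derivative_at)
        moreover have "norm (g t (y t, y (t - 1)) - f t (x t, x (t - 1))) \<le> q t"
        proof -
          have "norm (y t - x t) + norm (y (t - 1) - x (t - 1)) \<le> 2 * \<eta>"
            using \<eta>[of t] \<eta>[of "t - 1"] t by auto
          then have "k t * (norm (y t - x t) + norm (y (t - 1) - x (t - 1))) \<le> k t * (2 * \<eta>)"
            using k0 by (rule mult_left_mono)
          then show ?thesis using elim(1) True by (auto simp: q_def)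
        qed
        ultimately show ?thesis using True by (simp add: ennreal_leI)
      qed simp
    qed
  qed
  also have "\<dots> = ennreal (LINT t|lebesgue. indicator {0..T} t *\<^sub>R q t)"
    by (rule nn_integral_eq_integral) (use qa q0 in \<open>auto simp: set_integrable_def\<close>)
  also have "\<dots> = ennreal (integral {0..T} q)"
    using set_lebesgue_integral_eq_integral(2)[OF qa] by (simp add: set_lebesgue_integral_def)
  also have "\<dots> \<le> ennreal (2 * C * \<eta> + e)" using qi by (rule ennreal_leI)
  finally have d: "(\<integral>\<^sup>+t\<in>{0..T}. ennreal (norm (vector_derivative (\<lambda>t. y t - x t) (at t within {0..T}))) \<partial>lebesgue)
      \<le> ennreal (2 * C * \<eta> + e)" .
  have "(SUP t\<in>{0..T}. ennreal (norm (y t - x t))) \<le> ennreal \<eta>"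
    by (rule SUP_least) (use \<eta> in \<open>auto intro: ennreal_leI\<close>)
  then have "C11_norm {0..T} (\<lambda>t. y t - x t) \<le> ennreal \<eta> + ennreal (2 * C * \<eta> + e)"
    unfolding C11_norm_def using d by (rule add_mono)
  also have "\<dots> = ennreal (\<eta> + 2 * C * \<eta> + e)"
    using \<eta>0 C e by (subst ennreal_plus[symmetric]) (auto simp: algebra_simps)
  finally show ?thesis .
qed

text \<open>A bootstrap: closeness of the right-hand sides is known only while \<open>y\<close>
  stays in the tube of width 1, but the resulting bound \<open>\<eta>\<close> is below 1, so the
  tube cannot be left. Boundedness of \<open>y\<close> then excludes \<open>c \<le> T\<close> by
  maximality.\<close>

lemma dde_stability:
  fixes f g :: "real \<Rightarrow> 'a::euclidean_space \<times> 'a \<Rightarrow> 'a"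
  assumes g: "g \<in> LC" and x: "dde_solution f \<phi> b x" and y: "maximal_dde_solution g \<psi> c y"
    and T: "0 \<le> T" "ereal T < b"
    and \<delta>: "0 \<le> \<delta>" "\<And>t. t \<in> {-1..0} \<Longrightarrow> norm (\<psi> t - \<phi> t) \<le> \<delta>" and e: "0 \<le> e"
    and close: "\<And>\<tau>. 0 \<le> \<tau> \<Longrightarrow> \<tau> \<le> T \<Longrightarrow> ereal \<tau> < c \<Longrightarrow> (\<forall>t\<in>{-1..\<tau>}. norm (y t - x t) \<le> 1) \<Longrightarrow>
        rhs_close_upto \<tau> C e g y f x"
    and C: "0 \<le> C" "4 * C \<le> real m"
    and \<eta>: "\<eta> = 2 ^ Suc m * (\<delta> + 2 * e)" "\<eta> < 1"
  shows "ereal T < c \<and> C11_norm {0..T} (\<lambda>t. y t - x t) \<le> ennreal (\<eta> + 2 * C * \<eta> + e)"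
proof -
  have ysol: "dde_solution g \<psi> c y" using y by (simp add: maximal_dde_solution_def)
  have \<tau>b: "ereal \<tau> < b" if "\<tau> \<le> T" for \<tau> using that T(2) by (auto intro: le_less_trans[of "ereal \<tau>" "ereal T"])
  have est: "norm (y r - x r) \<le> \<eta>"
    if "0 \<le> \<tau>" "\<tau> \<le> T" "ereal \<tau> < c" "\<forall>t\<in>{-1..\<tau>}. norm (y t - x t) \<le> 1" "r \<in> {-1..\<tau>}" for \<tau> r
    unfolding \<eta>(1)
    by (rule dde_solutions_difference_bound[OF x ysol that(1) \<tau>b[OF that(2)] that(3) \<delta> e close[OF that(1-4)] C(2) that(5)])
  have \<delta>\<eta>: "\<delta> \<le> \<eta>"
  proof -
    have "1 * \<delta> \<le> 2 ^ Suc m * (\<delta> + 2 * e)" by (intro mult_mono one_le_power) (use \<delta> e in auto)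
    then show ?thesis by (simp add: \<eta>(1))
  qed
  have ini: "norm (y t - x t) \<le> \<eta>" if "t \<in> {-1..0}" for t
    using \<delta>(2)[OF that] \<delta>\<eta> x ysol that by (simp add: dde_solution_def)
  have bound: "norm (y r - x r) \<le> \<eta>" if r: "-1 \<le> r" "r \<le> T" "ereal r < c" for r
  proof (rule ccontr)
    assume *: "\<not> norm (y r - x r) \<le> \<eta>"
    have r0: "0 \<le> r" using * ini[of r] r by (cases "0 \<le> r") auto
    \<comment> \<open>A level above \<open>\<eta>\<close> but at most 1: up to the first time it is
      reached the tube condition holds, so the estimate gives a deviation of at most
      \<open>\<eta> < a\<close> there, a contradiction.\<close>
    define a where "a = min (norm (y r - x r)) 1"
    have a: "\<eta> < a" "a \<le> norm (y r - x r)" "a \<le> 1" using * \<eta>(2) by (auto simp: a_def)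
    have "continuous_on {0..r} (\<lambda>t. norm (y t - x t))"
      by (intro continuous_intros continuous_on_subset[OF dde_solution_continuous_on[OF ysol r(3)]]
          continuous_on_subset[OF dde_solution_continuous_on[OF x \<tau>b[OF r(2)]]]) auto
    then obtain s where s: "0 \<le> s" "s \<le> r" "norm (y s - x s) = a"
      "\<And>t. 0 \<le> t \<Longrightarrow> t \<le> s \<Longrightarrow> norm (y t - x t) \<le> a"
      using first_crossing[of 0 r "\<lambda>t. norm (y t - x t)" a] r0 a ini[of 0] by auto
    have "\<forall>t\<in>{-1..s}. norm (y t - x t) \<le> 1"
    proof
      fix t assume "t \<in> {-1..s}"
      then show "norm (y t - x t) \<le> 1"
        using s(4)[of t] ini[of t] a(3) \<eta>(2) by (cases "0 \<le> t") auto
    qed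
    then have "norm (y s - x s) \<le> \<eta>"
      by (intro est[of s s]) (use s r in \<open>auto intro: le_less_trans[of "ereal s" "ereal r"]\<close>)
    with s(3) a(1) show False by simp
  qed
  have Tc: "ereal T < c"
  proof (rule ccontr)
    assume "\<not> ereal T < c"
    then have cT: "c \<le> ereal T" by simp
    moreover have "0 < c" using ysol by (simp add: dde_solution_def)
    ultimately obtain B where B: "c = ereal B" "0 < B" "B \<le> T" by (cases c) auto
    have "bounded (x ` {-1..T})"
      by (intro compact_imp_bounded compact_continuous_image dde_solution_continuous_on[OF x T(2)] compact_Icc)
    then obtain R where R: "\<And>t. t \<in> {-1..T} \<Longrightarrow> norm (x t) \<le> R" unfolding bounded_iff by blast
    have "norm (y t) \<le> R + \<eta>" if "t \<in> {-1..<B}" for t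
      using bound[of t] R[of t] norm_triangle_sub[of "y t" "x t"] that B by auto
    then have "bounded (y ` {-1..<B})" unfolding bounded_iff by blast
    with maximal_dde_solution_unbounded[OF g] y B(1) show False by blast
  qed
  have bT: "norm (y r - x r) \<le> \<eta>" if "r \<in> {-1..T}" for r
  proof -
    have "ereal r < c" using that Tc by (auto intro: le_less_trans[of "ereal r" "ereal T"])
    then show ?thesis using bound that by simp
  qed
  have "rhs_close_upto T C e g y f x"
    by (rule close) (use T Tc bT \<eta>(2) in force)+
  from C11_norm_le[OF x ysol T Tc this C(1) e bT] Tc show ?thesis by blast
qed

text \<open>The order of quantifiers in \<open>close\<close> matters: \<open>C\<close> fixes
  \<open>m\<close> and thus the Gronwall factor before \<open>e\<close> is chosen, and the eventual
  index is chosen before \<open>\<tau>\<close>, which depends on how long \<open>xn n\<close> is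
  known to stay near \<open>x\<close>.\<close>

lemma solutions_convergeI:
  fixes fn :: "nat \<Rightarrow> real \<Rightarrow> 'a::euclidean_space \<times> 'a \<Rightarrow> 'a"
  assumes fn: "\<And>n. fn n \<in> LC" and \<phi>: "uniform_limit {-1..0} \<phi>n \<phi> sequentially"
    and close: "\<And>bn xn b x T. (\<And>n. dde_solution (fn n) (\<phi>n n) (bn n) (xn n)) \<Longrightarrow> dde_solution f \<phi> b x \<Longrightarrow>
      0 \<le> T \<Longrightarrow> ereal T < b \<Longrightarrow> \<exists>C\<ge>0. \<forall>e>0. \<forall>\<^sub>F n in sequentially. \<forall>\<tau>. 0 \<le> \<tau> \<longrightarrow> \<tau> \<le> T \<longrightarrow>
        ereal \<tau> < bn n \<longrightarrow> (\<forall>t\<in>{-1..\<tau>}. norm (xn n t - x t) \<le> 1) \<longrightarrow> rhs_close_upto \<tau> C e (fn n) (xn n) f x"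
  shows "solutions_converge fn \<phi>n f \<phi>"
  unfolding solutions_converge_def
proof (intro allI impI)
  fix bn xn b x T
  assume mn: "\<forall>n. maximal_dde_solution (fn n) (\<phi>n n) (bn n) (xn n)" and mx: "maximal_dde_solution f \<phi> b x"
    and T: "0 \<le> (T::real)" "ereal T < b"
  have x: "dde_solution f \<phi> b x" and xn: "dde_solution (fn n) (\<phi>n n) (bn n) (xn n)" for n
    using mn mx by (auto simp: maximal_dde_solution_def)
  from close[OF xn x T] obtain C where C: "0 \<le> C" "\<And>e. 0 < e \<Longrightarrow> \<forall>\<^sub>F n in sequentially. \<forall>\<tau>. 0 \<le> \<tau> \<longrightarrow> \<tau> \<le> T \<longrightarrow>
        ereal \<tau> < bn n \<longrightarrow> (\<forall>t\<in>{-1..\<tau>}. norm (xn n t - x t) \<le> 1) \<longrightarrow> rhs_close_upto \<tau> C e (fn n) (xn n) f x"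
    by blast
  obtain m :: nat where m: "4 * C \<le> real m" using real_arch_simple by blast
  have main: "\<forall>\<^sub>F n in sequentially. ereal T < bn n \<and> C11_norm {0..T} (\<lambda>t. xn n t - x t) \<le> ennreal \<epsilon>"
    if "0 < \<epsilon>" for \<epsilon>
  proof -
    \<comment> \<open>One \<open>e\<close> bounds both the initial deviation and the error integral,
      so \<open>\<eta>\<close> is \<open>3 * e\<close> times the Gronwall factor and the final bound
      is exactly \<open>e * A\<close>. Taking the minimum with 1/2 in \<open>e\<close> ensures
      \<open>\<eta> < 1\<close>.\<close>
    define A where "A = 2 ^ Suc m * 3 * (1 + 2 * C) + 1"
    define e where "e = min \<epsilon> (1 / 2) / A"
    define \<eta> where "\<eta> = 2 ^ Suc m * (e + 2 * e)"
    have A: "0 < A" using C(1) by (simp add: A_def add_nonneg_pos)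
    then have e: "0 < e" using that by (simp add: e_def)
    have eA: "\<eta> + 2 * C * \<eta> + e = e * A" by (simp add: \<eta>_def A_def algebra_simps)
    have "e * A = min \<epsilon> (1 / 2)" using A by (simp add: e_def)
    with eA have le: "\<eta> + 2 * C * \<eta> + e \<le> \<epsilon>" "\<eta> + 2 * C * \<eta> + e \<le> 1 / 2" by auto
    have "0 \<le> \<eta>" using e by (simp add: \<eta>_def)
    then have "0 \<le> 2 * C * \<eta>" using C(1) by simp
    then have \<eta>1: "\<eta> < 1" using le(2) e by linarith
    have "\<forall>\<^sub>F n in sequentially. \<forall>t\<in>{-1..0}. dist (\<phi>n n t) (\<phi> t) < e"
      using uniform_limitD[OF \<phi> e] .
    with C(2)[OF e] show ?thesis
    proof eventually_elim
      case (elim n)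
      have "ereal T < bn n \<and> C11_norm {0..T} (\<lambda>t. xn n t - x t) \<le> ennreal (\<eta> + 2 * C * \<eta> + e)"
        by (rule dde_stability[OF fn x _ T, where \<delta> = e and C = C and m = m and \<psi> = "\<phi>n n"])
           (use mn elim e C(1) m \<eta>1 in \<open>auto simp: \<eta>_def dist_norm less_imp_le\<close>)
      then show ?case using le(1) by (auto intro: order_trans ennreal_leI)
    qed
  qed
  show "(\<forall>\<^sub>F n in sequentially. ereal T < bn n) \<and> (\<lambda>n. C11_norm {0..T} (\<lambda>t. xn n t - x t)) \<longlonglongrightarrow> 0"
  proof
    show "\<forall>\<^sub>F n in sequentially. ereal T < bn n" using main[of 1] by (auto elim: eventually_mono)
    show "(\<lambda>n. C11_norm {0..T} (\<lambda>t. xn n t - x t)) \<longlonglongrightarrow> 0"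
    proof (rule order_tendstoI)
      fix a :: ennreal assume "0 < a"
      then obtain d where d: "0 < d" "d < a" using dense by blast
      then obtain \<epsilon> where \<epsilon>: "d = ennreal \<epsilon>" "0 < \<epsilon>"
        by (cases d) auto
      from main[OF \<epsilon>(2)] show "\<forall>\<^sub>F n in sequentially. C11_norm {0..T} (\<lambda>t. xn n t - x t) < a"
        by eventually_elim (use d \<epsilon> in auto)
    qed simp
  qed
qed

section \<open>Convergence in the two topologies\<close>

lemma limitin_LC_topology_seminorm:
  assumes lim: "limitin (LC_topology P) fn f sequentially" and f: "f \<in> LC"
    and p: "p \<in> P" "p (\<lambda>t z. 0) = 0" and \<epsilon>: "0 < \<epsilon>"
  shows "\<forall>\<^sub>F n in sequentially. p (\<lambda>t z. fn n t z - f t z) < ennreal \<epsilon>"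
proof -
  let ?U = "{g \<in> LC. p (\<lambda>t z. g t z - f t z) < ennreal \<epsilon>}"
  have "openin (LC_topology P) ?U"
    unfolding LC_topology_def by (rule topology_generated_by_Basis) (use p f \<epsilon> in blast)
  moreover have "f \<in> ?U" using f p \<epsilon> by simp
  ultimately have "\<forall>\<^sub>F n in sequentially. fn n \<in> ?U" using lim unfolding limitin_def by blast
  then show ?thesis by eventually_elim simp
qed

text \<open>Compactness of the ball gives finiteness. Points of \<open>D\<close> close to the
  boundary may lie outside the ball, hence the radius \<open>r + 1\<close>, which suffices because
  \<open>\<epsilon> \<le> 1\<close>.\<close>

lemma dense_finite_net:
  fixes D :: "'a::euclidean_space set"
  assumes D: "closure D = UNIV" and \<epsilon>: "0 < \<epsilon>" "\<epsilon> \<le> 1"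
  obtains F where "finite F" "F \<subseteq> D" "F \<subseteq> cball 0 (r + 1)" "\<And>p. p \<in> cball 0 r \<Longrightarrow> \<exists>d\<in>F. norm (p - d) < \<epsilon>"
proof -
  have cover: "cball 0 r \<subseteq> (\<Union>d\<in>D \<inter> cball 0 (r + 1). ball d \<epsilon>)"
  proof
    fix p :: 'a assume p: "p \<in> cball 0 r"
    have "p \<in> closure D" using D by simp
    then obtain d where d: "d \<in> D" "dist d p < \<epsilon>" using \<epsilon>(1) closure_approachable by blast
    have "norm d \<le> norm p + dist d p" by (metis dist_norm norm_triangle_sub)
    then have "d \<in> cball 0 (r + 1)" using p d \<epsilon> by simp
    with d show "p \<in> (\<Union>d\<in>D \<inter> cball 0 (r + 1). ball d \<epsilon>)" by auto
  qed
  from compactE_image[OF compact_cball _ cover]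
  obtain F where F: "F \<subseteq> D \<inter> cball 0 (r + 1)" "finite F" "cball 0 r \<subseteq> (\<Union>d\<in>F. ball d \<epsilon>)"
    by auto
  show ?thesis
  proof (rule that[OF F(2)])
    fix p :: 'a assume "p \<in> cball 0 r"
    then obtain d where "d \<in> F" "p \<in> ball d \<epsilon>" using F(3) by blast
    then show "\<exists>d\<in>F. norm (p - d) < \<epsilon>"
      by (intro bexI[of _ d]) (auto simp: dist_norm norm_minus_commute)
  qed (use F in auto)
qed

text \<open>The seminorms live on intervals with rational endpoints, whereas the estimates run up to
  an arbitrary real time inside such an interval.\<close>

lemma integral_le_of_nn_integral_superset:
  fixes w :: "real \<Rightarrow> real"
  assumes w: "w absolutely_integrable_on {a..b}" "\<And>t. 0 \<le> w t" and I: "{a..b} \<subseteq> I"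
    and le: "(\<integral>\<^sup>+t\<in>I. ennreal (w t) \<partial>lebesgue) \<le> ennreal \<epsilon>" "0 \<le> \<epsilon>"
  shows "integral {a..b} w \<le> \<epsilon>"
proof -
  have "ennreal (integral {a..b} w) = ennreal (LINT t|lebesgue. indicator {a..b} t *\<^sub>R w t)"
    using set_lebesgue_integral_eq_integral(2)[OF w(1)] by (simp add: set_lebesgue_integral_def)
  also have "\<dots> = (\<integral>\<^sup>+t. ennreal (indicator {a..b} t *\<^sub>R w t) \<partial>lebesgue)"
    by (rule nn_integral_eq_integral[symmetric]) (use w in \<open>auto simp: set_integrable_def\<close>)
  also have "\<dots> \<le> (\<integral>\<^sup>+t\<in>I. ennreal (w t) \<partial>lebesgue)"
    by (rule nn_integral_mono) (use I in \<open>auto simp: indicator_def\<close>)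
  finally show ?thesis using le by (meson ennreal_le_iff order_trans)
qed

text \<open>The term \<open>\<epsilon> * (k t + l t)\<close> pays for moving a point to a nearby net
  point, once in \<open>f\<^sub>n\<close> and once in \<open>f\<close>. The nearby point varies with
  \<open>t\<close>; summing over the whole net dominates it without a measurable selection. Each
  part receives at most \<open>e / 2\<close>.\<close>

lemma net_error_integral:
  fixes k l :: "real \<Rightarrow> real" and w :: "'d \<Rightarrow> real \<Rightarrow> real"
  assumes k: "k absolutely_integrable_on {0..\<tau>}" "integral {0..\<tau>} k \<le> C1"
    and l: "l absolutely_integrable_on {0..\<tau>}" "integral {0..\<tau>} l \<le> C2"
    and F: "finite F" and w: "\<And>d. d \<in> F \<Longrightarrow> w d absolutely_integrable_on {0..\<tau>}"
      "\<And>d. d \<in> F \<Longrightarrow> integral {0..\<tau>} (w d) \<le> e / (2 * (real (card F) + 1))"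
    and \<epsilon>: "0 \<le> \<epsilon>" "\<epsilon> * (C1 + C2) \<le> e / 2" and e: "0 \<le> e"
  shows "(\<lambda>t. \<epsilon> * (k t + l t) + (\<Sum>d\<in>F. w d t)) absolutely_integrable_on {0..\<tau>}"
    and "integral {0..\<tau>} (\<lambda>t. \<epsilon> * (k t + l t) + (\<Sum>d\<in>F. w d t)) \<le> e"
proof -
  note ii = set_lebesgue_integral_eq_integral(1)
  have a: "(\<lambda>t. \<epsilon> * (k t + l t)) absolutely_integrable_on {0..\<tau>}"
    by (intro set_integrable_mult_right set_integral_add k l)
  have s: "(\<lambda>t. \<Sum>d\<in>F. w d t) absolutely_integrable_on {0..\<tau>}"
    by (rule absolutely_integrable_sum[OF F w(1)])
  show "(\<lambda>t. \<epsilon> * (k t + l t) + (\<Sum>d\<in>F. w d t)) absolutely_integrable_on {0..\<tau>}"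
    by (rule set_integral_add[OF a s])
  have "integral {0..\<tau>} (\<lambda>t. \<epsilon> * (k t + l t) + (\<Sum>d\<in>F. w d t)) =
      \<epsilon> * (integral {0..\<tau>} k + integral {0..\<tau>} l) + (\<Sum>d\<in>F. integral {0..\<tau>} (w d))"
    by (simp add: integral_add[OF ii[OF a] ii[OF s]] integral_add[OF ii[OF k(1)] ii[OF l(1)]]
        integral_sum[OF F ii[OF w(1)]])
  also have "\<dots> \<le> \<epsilon> * (C1 + C2) + (\<Sum>d\<in>F. e / (2 * (real (card F) + 1)))"
    by (intro add_mono mult_left_mono sum_mono w k l \<epsilon>)
  also have "(\<Sum>d\<in>F. e / (2 * (real (card F) + 1))) \<le> e / 2"
    using e by (simp add: field_simps)
  finally show "integral {0..\<tau>} (\<lambda>t. \<epsilon> * (k t + l t) + (\<Sum>d\<in>F. w d t)) \<le> e" using \<epsilon>(2) by simp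
qed

lemma uniform_integral_bound:
  fixes L :: "(real \<Rightarrow> 'a \<Rightarrow> 'b) \<Rightarrow> real \<Rightarrow> ennreal"
  assumes "\<forall>r>0. (SUP f\<in>E. \<integral>\<^sup>+t\<in>{-r..r}. L f t \<partial>lebesgue) < \<infinity>"
  shows "\<exists>C\<ge>0. \<forall>g\<in>E. \<forall>\<tau>\<le>T. (\<integral>\<^sup>+t\<in>{0..\<tau>}. L g t \<partial>lebesgue) \<le> ennreal C"
proof -
  define r where "r = \<bar>T\<bar> + 1"
  let ?S = "SUP f\<in>E. \<integral>\<^sup>+t\<in>{-r..r}. L f t \<partial>lebesgue"
  have "0 < r" by (simp add: r_def add_nonneg_pos)
  then have fin: "?S < \<infinity>" by (rule assms[rule_format])
  show ?thesis
  proof (intro exI[of _ "enn2real ?S"] conjI ballI allI impI)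
    fix g \<tau> assume g: "g \<in> E" and \<tau>: "\<tau> \<le> T"
    have "(\<integral>\<^sup>+t\<in>{0..\<tau>}. L g t \<partial>lebesgue) \<le> (\<integral>\<^sup>+t\<in>{-r..r}. L g t \<partial>lebesgue)"
      by (rule nn_integral_mono) (use \<tau> in \<open>auto simp: indicator_def r_def\<close>)
    also have "\<dots> \<le> ?S" by (rule SUP_upper[OF g])
    also have "\<dots> = ennreal (enn2real ?S)" using fin by simp
    finally show "(\<integral>\<^sup>+t\<in>{0..\<tau>}. L g t \<partial>lebesgue) \<le> ennreal (enn2real ?S)" .
  qed simp
qed

lemma rat_intervals_0: "q \<in> \<rat> \<Longrightarrow> 0 \<le> q \<Longrightarrow> {0..q} \<in> rat_intervals"
  unfolding rat_intervals_def by (intro CollectI exI[of _ 0] exI[of _ q]) auto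

text \<open>
  The solution is only controlled up to \<open>\<tau>\<close>; freezing it there gives a member of the modulus class on an
  interval with rational endpoints that does not depend on \<open>\<tau>\<close>.
\<close>

lemma clamped_solution_in_modulus_class:
  fixes E :: "(real \<Rightarrow> 'a::euclidean_space \<times> 'a \<Rightarrow> 'a) set"
  assumes E: "E \<subseteq> LC" "equicontinuous_m_bounds E" and g: "g \<in> E" and y: "dde_solution g \<psi> c y"
    and \<tau>: "0 \<le> \<tau>" "ereal \<tau> < c" "\<tau> \<le> q" "q \<in> \<rat>"
    and R: "\<And>t. t \<in> {-1..\<tau>} \<Longrightarrow> norm (y t) \<le> R" "2 * R \<le> real j"
  shows "(\<lambda>t. y (max 0 (min t \<tau>))) \<in> modulus_class (moduli_of E) j {0..q}"
proof -
  let ?I = "{0..q}"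
  have q: "0 \<le> q" using \<tau> by simp
  have I: "?I \<in> rat_intervals" by (rule rat_intervals_0[OF \<tau>(4) q])
  have R0: "0 \<le> R" using order_trans[OF norm_ge_zero R(1)[of 0]] \<tau> by simp
  have yc: "continuous_on {0..\<tau>} y"
    by (rule continuous_on_subset[OF dde_solution_continuous_on[OF y \<tau>(2)]]) auto
  have main: "norm (y (max 0 (min t \<tau>)) - y (max 0 (min s \<tau>))) \<le> moduli_of E j ?I \<bar>t - s\<bar>"
    if st: "s \<in> ?I" "s \<le> t" for s t
  proof -
    define s' where "s' = max 0 (min s \<tau>)"
    define t' where "t' = max 0 (min t \<tau>)"
    \<comment> \<open>Freezing does not increase distances and keeps \<open>s'\<close> in the index
      interval, so the window of length \<open>t - s\<close> starting at \<open>s'\<close> takes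
      part in the supremum that defines the modulus.\<close>
    have st': "0 \<le> s'" "s' \<le> t'" "t' \<le> \<tau>" "s' \<in> ?I" "t' \<le> s' + (t - s)"
      using st \<tau> by (auto simp: s'_def t'_def)
    let ?S = "SUP (u, f) \<in> ?I \<times> E. \<integral>\<^sup>+r\<in>{u..u + (t - s)}. m_bound j f r \<partial>lebesgue"
    have fin: "?S < \<infinity>" by (rule moduli_SUP_finite[OF E I]) (use st in simp)
    have V: "ennreal (moduli_of E j ?I (t - s)) = ?S" "0 \<le> moduli_of E j ?I (t - s)"
      unfolding moduli_of_def using fin by simp_all
    have "(\<integral>\<^sup>+r\<in>{s'..t'}. m_bound j g r \<partial>lebesgue) \<le> (\<integral>\<^sup>+r\<in>{s'..s' + (t - s)}. m_bound j g r \<partial>lebesgue)"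
      by (rule nn_integral_mono) (use st' in \<open>auto simp: indicator_def\<close>)
    also have "\<dots> \<le> ?S" by (rule SUP_upper2[of "(s', g)"]) (use st' g in auto)
    finally have "(\<integral>\<^sup>+r\<in>{s'..t'}. m_bound j g r \<partial>lebesgue) \<le> ennreal (moduli_of E j ?I (t - s))"
      using V(1) by simp
    from LC_m_bound_integrable[OF subsetD[OF E(1) g] this V(2)]
    obtain k where k: "k absolutely_integrable_on {s'..t'}" "integral {s'..t'} k \<le> moduli_of E j ?I (t - s)"
      and ae: "AE r in lebesgue. r \<in> {s'..t'} \<longrightarrow> (\<forall>z\<in>cball 0 (real j). norm (g r z) \<le> k r)"
      by blast
    have I: "((\<lambda>r. g r (y r, y (r - 1))) has_integral (y t' - y s')) {s'..t'}"
      by (rule dde_solution_has_integral[OF y]) (use st' \<tau> in \<open>auto intro: le_less_trans[of "ereal t'" "ereal \<tau>"]\<close>)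
    have "norm (integral {s'..t'} (\<lambda>r. g r (y r, y (r - 1)))) \<le> integral {s'..t'} k"
    proof (rule integral_norm_bound_AE[OF has_integral_integrable[OF I] set_lebesgue_integral_eq_integral(1)[OF k(1)]])
      show "AE r in lebesgue. r \<in> {s'..t'} \<longrightarrow> norm (g r (y r, y (r - 1))) \<le> k r"
        using ae
      proof eventually_elim
        case (elim r)
        show ?case
        proof
          assume r: "r \<in> {s'..t'}"
          \<comment> \<open>The \<open>m\<close>-bound concerns the pair of current and delayed
            state, whose norm can exceed \<open>R\<close> but not \<open>2 * R\<close>; this is why
            \<open>j\<close> dominates \<open>2 * R\<close>.\<close>
          have "norm (y r, y (r - 1)) \<le> norm (y r) + norm (y (r - 1))" by (rule norm_Pair_le)
          also have "\<dots> \<le> R + R" by (intro add_mono R(1)) (use r st' in auto)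
          finally have "(y r, y (r - 1)) \<in> cball 0 (real j)" using R(2) by simp
          then show "norm (g r (y r, y (r - 1))) \<le> k r" using elim r by blast
        qed
      qed
    qed
    then show ?thesis using k(2) st(2) integral_unique[OF I] by (simp add: s'_def t'_def)
  qed
  show ?thesis
    unfolding modulus_class_def
  proof (intro CollectI conjI ballI)
    show "continuous_on ?I (\<lambda>t. y (max 0 (min t \<tau>)))"
      by (rule continuous_on_subset[OF continuous_on_clamp_ext[OF \<tau>(1) yc] subset_UNIV])
    show "(\<lambda>t. y (max 0 (min t \<tau>))) ` ?I \<subseteq> cball 0 (real j)"
    proof clarify
      fix t
      have "norm (y (max 0 (min t \<tau>))) \<le> R" by (rule R(1)) (use \<tau> in auto)
      then show "y (max 0 (min t \<tau>)) \<in> cball 0 (real j)" using R(2) R0 by simp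
    qed
    fix t s assume "t \<in> ?I" "s \<in> ?I"
    then show "norm (y (max 0 (min t \<tau>)) - y (max 0 (min s \<tau>))) \<le> moduli_of E j ?I \<bar>t - s\<bar>"
      using main[of s t] main[of t s] by (cases "s \<le> t") (auto simp: norm_minus_commute abs_minus_commute)
  qed
qed

lemma dde_solution_radius:
  fixes x :: "real \<Rightarrow> 'a::euclidean_space"
  assumes "dde_solution f \<phi> b x" "0 \<le> T" "ereal T < b"
  obtains R where "1 \<le> R" "\<And>t. t \<in> {-1..T} \<Longrightarrow> norm (x t) \<le> R"
    "\<And>y \<tau> t. \<tau> \<le> T \<Longrightarrow> \<forall>t\<in>{-1..\<tau>}. norm (y t - x t) \<le> 1 \<Longrightarrow> t \<in> {-1..\<tau>} \<Longrightarrow> norm (y t) \<le> R"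
proof -
  have "bounded (x ` {-1..T})"
    by (intro compact_imp_bounded compact_continuous_image dde_solution_continuous_on[OF assms(1,3)] compact_Icc)
  then obtain R where R: "\<And>t. t \<in> {-1..T} \<Longrightarrow> norm (x t) \<le> R" unfolding bounded_iff by blast
  have R0: "0 \<le> R" using order_trans[OF norm_ge_zero R[of 0]] assms(2) by simp
  show ?thesis
  \<comment> \<open>Adding the tube width gives one radius for \<open>x\<close> and for every curve
    near it.\<close>
  proof (rule that[of "R + 1"])
    fix y :: "real \<Rightarrow> 'a" and \<tau> t assume "\<tau> \<le> T" "\<forall>t\<in>{-1..\<tau>}. norm (y t - x t) \<le> 1" "t \<in> {-1..\<tau>}"
    then have "norm (y t - x t) \<le> 1" "norm (x t) \<le> R" using R by auto
    then show "norm (y t) \<le> R + 1" using norm_triangle_sub[of "y t" "x t"] by linarith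
  next
    show "norm (x t) \<le> R + 1" if "t \<in> {-1..T}" for t using R[OF that] by simp
  qed (use R0 in simp)
qed

text \<open>The uniform \<open>l\<close>-bounds allow both arguments of \<open>f\<^sub>n\<close> to
  be moved to \<open>x\<close> at once, so \<open>C\<close> is the \<open>l\<close>-bound constant
  of \<open>E\<close> alone; the Lipschitz bound of \<open>f\<close> enters only the error,
  multiplied by \<open>\<epsilon>\<close>.\<close>

lemma rhs_close_T_D:
  fixes E :: "(real \<Rightarrow> 'a::euclidean_space \<times> 'a \<Rightarrow> 'a) set"
  assumes E: "E \<subseteq> LC" "bounded_l_bounds E" and D: "closure D = UNIV"
    and fn: "\<And>n. fn n \<in> E" and f: "f \<in> LC" and lim: "limitin (T_D D) fn f sequentially"
    and xn: "\<And>n. dde_solution (fn n) (\<phi>n n) (bn n) (xn n)" and x: "dde_solution f \<phi> b x"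
    and T: "0 \<le> T" "ereal T < b"
  shows "\<exists>C\<ge>0. \<forall>e>0. \<forall>\<^sub>F n in sequentially. \<forall>\<tau>. 0 \<le> \<tau> \<longrightarrow> \<tau> \<le> T \<longrightarrow>
        ereal \<tau> < bn n \<longrightarrow> (\<forall>t\<in>{-1..\<tau>}. norm (xn n t - x t) \<le> 1) \<longrightarrow> rhs_close_upto \<tau> C e (fn n) (xn n) f x"
proof -
  from dde_solution_radius[OF x T] obtain R where R: "1 \<le> R" "\<And>t. t \<in> {-1..T} \<Longrightarrow> norm (x t) \<le> R"
    "\<And>y \<tau> t. \<tau> \<le> T \<Longrightarrow> \<forall>t\<in>{-1..\<tau>}. norm (y t - x t) \<le> 1 \<Longrightarrow> t \<in> {-1..\<tau>} \<Longrightarrow> norm (y t) \<le> R"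
    by metis
  \<comment> \<open>State pairs have norm at most \<open>2 * R\<close>, and the net points
    approximating them at most \<open>2 * R + 1\<close>.\<close>
  obtain j :: nat where j: "2 * R + 1 \<le> real j" using real_arch_simple by blast
  let ?B = "cball (0::'a \<times> 'a) (real j)"
  from E(2) have "\<forall>r>0. (SUP g\<in>E. \<integral>\<^sup>+t\<in>{-r..r}. l_bound j g t \<partial>lebesgue) < \<infinity>"
    unfolding bounded_l_bounds_def by blast
  from uniform_integral_bound[OF this] obtain C1 where C1: "0 \<le> C1"
    "\<And>g \<tau>. g \<in> E \<Longrightarrow> \<tau> \<le> T \<Longrightarrow> (\<integral>\<^sup>+t\<in>{0..\<tau>}. l_bound j g t \<partial>lebesgue) \<le> ennreal C1"
    by blast
  from LC_boundsE[OF f compact_cball[of 0 "real j"]] obtain m l where "\<forall>t. 0 \<le> m t" and l0: "\<forall>t. 0 \<le> l t"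
    and "\<forall>a b. m absolutely_integrable_on {a..b}" and li: "\<forall>a b. l absolutely_integrable_on {a..b}"
    and ael: "AE t in lebesgue. (\<forall>z\<in>?B. norm (f t z) \<le> m t) \<and>
       (\<forall>z1\<in>?B. \<forall>z2\<in>?B. norm (f t z1 - f t z2) \<le> l t * norm (z1 - z2))"
    .
  have lii: "l integrable_on {a..b}" for a b
    by (rule set_lebesgue_integral_eq_integral(1)[OF li[rule_format]])
  define C2 where "C2 = integral {0..T} l"
  have lC: "integral {0..\<tau>} l \<le> C2" if "\<tau> \<le> T" for \<tau>
    unfolding C2_def
    by (rule integral_subset_le) (use that l0 lii in auto)
  have C2: "0 \<le> C2"
    unfolding C2_def by (rule Henstock_Kurzweil_Integration.integral_nonneg)
      (use l0 lii in auto)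
  obtain q where q: "q \<in> \<rat>" "T < q" using Rats_dense_in_real[of T "T + 1"] by auto
  have qI: "{0..q} \<in> rat_intervals" by (rule rat_intervals_0) (use q T in auto)
  show ?thesis
  proof (intro exI[of _ C1] conjI C1(1) allI impI)
    fix e :: real assume e: "0 < e"
    \<comment> \<open>The cost of passing to net points has integral at most
      \<open>\<epsilon> * (C1 + C2)\<close>, so it uses half of \<open>e\<close>; the seminorms at
      the net points share the other half through \<open>?e1\<close>.\<close>
    define \<epsilon> where "\<epsilon> = min 1 (e / (2 * (C1 + C2 + 1)))"
    have \<epsilon>: "0 < \<epsilon>" "\<epsilon> \<le> 1" using e C1(1) C2 by (auto simp: \<epsilon>_def)
    have \<epsilon>C: "\<epsilon> * (C1 + C2) \<le> e / 2"
    proof -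
      have "\<epsilon> * (C1 + C2) \<le> e / (2 * (C1 + C2 + 1)) * (C1 + C2)"
        by (rule mult_right_mono) (use C1(1) C2 in \<open>auto simp: \<epsilon>_def\<close>)
      also have "\<dots> \<le> e / 2" using e C1(1) C2 by (simp add: field_simps)
      finally show ?thesis .
    qed
    obtain F where F: "finite F" "F \<subseteq> D" "F \<subseteq> cball 0 (2 * R + 1)"
      "\<And>p. p \<in> cball 0 (2 * R) \<Longrightarrow> \<exists>d\<in>F. norm (p - d) < \<epsilon>"
      using dense_finite_net[OF D \<epsilon>] by metis
    let ?e1 = "e / (2 * (real (card F) + 1))"
    have e1: "0 < ?e1" using e by (simp add: add_nonneg_pos)
    have "\<forall>\<^sub>F n in sequentially. \<forall>d\<in>F. (\<integral>\<^sup>+t\<in>{0..q}. ennreal (norm (fn n t d - f t d)) \<partial>lebesgue) < ennreal ?e1"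
    proof (rule eventually_ball_finite[OF F(1)], rule ballI)
      fix d assume d: "d \<in> F"
      show "\<forall>\<^sub>F n in sequentially. (\<integral>\<^sup>+t\<in>{0..q}. ennreal (norm (fn n t d - f t d)) \<partial>lebesgue) < ennreal ?e1"
      proof (rule limitin_LC_topology_seminorm[OF lim[unfolded T_D_def] f _ _ e1,
            where p = "\<lambda>g. \<integral>\<^sup>+t\<in>{0..q}. ennreal (norm (g t d)) \<partial>lebesgue"])
        show "(\<lambda>g :: real \<Rightarrow> 'a \<times> 'a \<Rightarrow> 'a. \<integral>\<^sup>+t\<in>{0..q}. ennreal (norm (g t d)) \<partial>lebesgue)
            \<in> {\<lambda>g. \<integral>\<^sup>+t\<in>I. ennreal (norm (g t z)) \<partial>lebesgue | I z. I \<in> rat_intervals \<and> z \<in> D}"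
          by (intro CollectI exI[of _ "{0..q}"] exI[of _ d]) (use qI d F(2) in auto)
      qed simp
    qed
    then show "\<forall>\<^sub>F n in sequentially. \<forall>\<tau>. 0 \<le> \<tau> \<longrightarrow> \<tau> \<le> T \<longrightarrow> ereal \<tau> < bn n \<longrightarrow>
        (\<forall>t\<in>{-1..\<tau>}. norm (xn n t - x t) \<le> 1) \<longrightarrow> rhs_close_upto \<tau> C1 e (fn n) (xn n) f x"
    proof (eventually_elim, intro allI impI)
      fix n \<tau> assume small: "\<forall>d\<in>F. (\<integral>\<^sup>+t\<in>{0..q}. ennreal (norm (fn n t d - f t d)) \<partial>lebesgue) < ennreal ?e1"
        and \<tau>: "0 \<le> \<tau>" "\<tau> \<le> T" "ereal \<tau> < bn n" and near: "\<forall>t\<in>{-1..\<tau>}. norm (xn n t - x t) \<le> 1"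
      have fnL: "fn n \<in> LC" using E(1) fn by blast
      from LC_l_bound_integrable[OF fnL C1(2)[OF fn \<tau>(2)] C1(1)]
      obtain k where k: "\<forall>t. 0 \<le> k t" "k absolutely_integrable_on {0..\<tau>}" "integral {0..\<tau>} k \<le> C1"
        and aek: "AE t in lebesgue. t \<in> {0..\<tau>} \<longrightarrow> (\<forall>z1\<in>?B. \<forall>z2\<in>?B. norm (fn n t z1 - fn n t z2) \<le> k t * norm (z1 - z2))"
        by blast
      define w where "w d t = norm (fn n t d - f t d)" for d t
      have wa: "w d absolutely_integrable_on {0..\<tau>}" for d
        unfolding w_def
        by (intro absolutely_integrable_norm[unfolded o_def] set_integral_diff
            LC_absolutely_integrable fnL f continuous_on_const)
      have wi: "integral {0..\<tau>} (w d) \<le> ?e1" if "d \<in> F" for d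
      proof (rule integral_le_of_nn_integral_superset[OF wa, where I = "{0..q}"])
        show "(\<integral>\<^sup>+t\<in>{0..q}. ennreal (w d t) \<partial>lebesgue) \<le> ennreal ?e1"
          using small that unfolding w_def by (simp add: less_imp_le)
      qed (use \<tau> q e1 in \<open>auto simp: w_def\<close>)
      define h where "h t = \<epsilon> * (k t + l t) + (\<Sum>d\<in>F. w d t)" for t
      have ha: "h absolutely_integrable_on {0..\<tau>}" and hi: "integral {0..\<tau>} h \<le> e"
        unfolding h_def
        by (rule net_error_integral[OF k(2,3) li[rule_format] lC[OF \<tau>(2)] F(1) wa wi _ \<epsilon>C]; use \<epsilon> e in simp)+
      have w0: "0 \<le> w d t" for d t by (simp add: w_def)
      have h0: "0 \<le> h t" for t
        unfolding h_def using k(1) l0 \<epsilon>(1) w0 by (intro add_nonneg_nonneg mult_nonneg_nonneg sum_nonneg) auto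
      have ae: "AE t in lebesgue. t \<in> {0..\<tau>} \<longrightarrow> norm (fn n t (xn n t, xn n (t - 1)) - f t (x t, x (t - 1)))
          \<le> k t * (norm (xn n t - x t) + norm (xn n (t - 1) - x (t - 1))) + h t"
        using aek ael
      proof eventually_elim
        case (elim t)
        show ?case
        proof
          assume t: "t \<in> {0..\<tau>}"
          define p where "p = (x t, x (t - 1))"
          define p' where "p' = (xn n t, xn n (t - 1))"
          have xR: "norm (x t) \<le> R" "norm (x (t - 1)) \<le> R" using R(2) t \<tau> by auto
          have yR: "norm (xn n t) \<le> R" "norm (xn n (t - 1)) \<le> R"
            by (rule R(3)[OF \<tau>(2) near], use t in auto)+
          have pR: "norm p \<le> 2 * R" using norm_Pair_le[of "x t" "x (t - 1)"] xR by (simp add: p_def)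
          have p'R: "norm p' \<le> 2 * R" using norm_Pair_le[of "xn n t" "xn n (t - 1)"] yR by (simp add: p'_def)
          obtain d where d: "d \<in> F" "norm (p - d) < \<epsilon>" using F(4)[of p] pR by auto
          have B: "p \<in> ?B" "p' \<in> ?B" "d \<in> ?B" using pR p'R d(1) F(3) j by auto
          have 1: "norm (fn n t p' - fn n t p) \<le> k t * (norm (xn n t - x t) + norm (xn n (t - 1) - x (t - 1)))"
          proof -
            have "norm (fn n t p' - fn n t p) \<le> k t * norm (p' - p)" using elim(1) t B by blast
            also have "\<dots> \<le> k t * (norm (xn n t - x t) + norm (xn n (t - 1) - x (t - 1)))"
              using norm_Pair_le[of "xn n t - x t" "xn n (t - 1) - x (t - 1)"] k(1)
              by (intro mult_left_mono) (auto simp: p_def p'_def)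
            finally show ?thesis .
          qed
          have 2: "norm (fn n t p - fn n t d) \<le> \<epsilon> * k t"
          proof -
            have "norm (fn n t p - fn n t d) \<le> k t * norm (p - d)" using elim(1) t B by blast
            also have "\<dots> \<le> k t * \<epsilon>" using d(2) k(1) by (intro mult_left_mono) auto
            finally show ?thesis by (simp add: mult.commute)
          qed
          have 3: "norm (f t d - f t p) \<le> \<epsilon> * l t"
          proof -
            have "norm (f t d - f t p) \<le> l t * norm (d - p)" using elim(2) B by blast
            also have "\<dots> \<le> l t * \<epsilon>" using d(2) l0 by (intro mult_left_mono) (auto simp: norm_minus_commute)
            finally show ?thesis by (simp add: mult.commute)
          qed
          have 4: "norm (fn n t d - f t d) \<le> (\<Sum>d\<in>F. w d t)"
            using member_le_sum[OF d(1), of "\<lambda>d. w d t"] w0 F(1) by (simp add: w_def)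
          \<comment> \<open>Only the first difference contains the unknown deviation and is charged
            to the kernel; the other three go into \<open>h\<close>.\<close>
          have "fn n t p' - f t p = (fn n t p' - fn n t p) + ((fn n t p - fn n t d) + ((fn n t d - f t d) + (f t d - f t p)))"
            by simp
          also have "norm \<dots> \<le> k t * (norm (xn n t - x t) + norm (xn n (t - 1) - x (t - 1)))
              + (\<epsilon> * k t + ((\<Sum>d\<in>F. w d t) + \<epsilon> * l t))"
            by (intro norm_triangle_mono 1 2 3 4)
          finally have "norm (fn n t p' - f t p) \<le>
              k t * (norm (xn n t - x t) + norm (xn n (t - 1) - x (t - 1))) + h t"
            by (simp add: h_def algebra_simps)
          then show "norm (fn n t (xn n t, xn n (t - 1)) - f t (x t, x (t - 1)))
              \<le> k t * (norm (xn n t - x t) + norm (xn n (t - 1) - x (t - 1))) + h t"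
            by (simp add: p_def p'_def)
        qed
      qed
      show "rhs_close_upto \<tau> C1 e (fn n) (xn n) f x"
        unfolding rhs_close_upto_def
        by (rule exI[of _ k], rule exI[of _ h]) (use k h0 ha hi ae in simp)
    qed
  qed
qed

text \<open>The current state is moved from \<open>x\<^sub>n\<close> to \<open>x\<close> inside
  \<open>f\<close>, not inside \<open>f\<^sub>n\<close>. The Lipschitz bound of \<open>f\<close>
  therefore joins the Gronwall kernel, and \<open>C\<close> becomes \<open>C1 + C2\<close>.\<close>

lemma rhs_close_T_Theta:
  fixes E :: "(real \<Rightarrow> 'a::euclidean_space \<times> 'a \<Rightarrow> 'a) set"
  assumes E: "E \<subseteq> LC" "equicontinuous_m_bounds E" "bounded_l2_bounds E" and D: "closure D' = UNIV"
    and fn: "\<And>n. fn n \<in> E" and f: "f \<in> LC" and lim: "limitin (T_Theta (moduli_of E) D') fn f sequentially"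
    and xn: "\<And>n. dde_solution (fn n) (\<phi>n n) (bn n) (xn n)" and x: "dde_solution f \<phi> b x"
    and T: "0 \<le> T" "ereal T < b"
  shows "\<exists>C\<ge>0. \<forall>e>0. \<forall>\<^sub>F n in sequentially. \<forall>\<tau>. 0 \<le> \<tau> \<longrightarrow> \<tau> \<le> T \<longrightarrow>
        ereal \<tau> < bn n \<longrightarrow> (\<forall>t\<in>{-1..\<tau>}. norm (xn n t - x t) \<le> 1) \<longrightarrow> rhs_close_upto \<tau> C e (fn n) (xn n) f x"
proof -
  from dde_solution_radius[OF x T] obtain R where R: "1 \<le> R" "\<And>t. t \<in> {-1..T} \<Longrightarrow> norm (x t) \<le> R"
    "\<And>y \<tau> t. \<tau> \<le> T \<Longrightarrow> \<forall>t\<in>{-1..\<tau>}. norm (y t - x t) \<le> 1 \<Longrightarrow> t \<in> {-1..\<tau>} \<Longrightarrow> norm (y t) \<le> R"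
    by metis
  obtain j :: nat where j: "2 * R + 1 \<le> real j" using real_arch_simple by blast
  let ?B = "cball (0::'a \<times> 'a) (real j)"
  from E(3) have "\<forall>r>0. (SUP g\<in>E. \<integral>\<^sup>+t\<in>{-r..r}. l2_bound j g t \<partial>lebesgue) < \<infinity>"
    unfolding bounded_l2_bounds_def by blast
  from uniform_integral_bound[OF this] obtain C1 where C1: "0 \<le> C1"
    "\<And>g \<tau>. g \<in> E \<Longrightarrow> \<tau> \<le> T \<Longrightarrow> (\<integral>\<^sup>+t\<in>{0..\<tau>}. l2_bound j g t \<partial>lebesgue) \<le> ennreal C1"
    by blast
  from LC_boundsE[OF f compact_cball[of 0 "real j"]] obtain m l where "\<forall>t. 0 \<le> m t" and l0: "\<forall>t. 0 \<le> l t"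
    and "\<forall>a b. m absolutely_integrable_on {a..b}" and li: "\<forall>a b. l absolutely_integrable_on {a..b}"
    and ael: "AE t in lebesgue. (\<forall>z\<in>?B. norm (f t z) \<le> m t) \<and>
       (\<forall>z1\<in>?B. \<forall>z2\<in>?B. norm (f t z1 - f t z2) \<le> l t * norm (z1 - z2))"
    .
  have lii: "l integrable_on {a..b}" for a b
    by (rule set_lebesgue_integral_eq_integral(1)[OF li[rule_format]])
  define C2 where "C2 = integral {0..T} l"
  have lC: "integral {0..\<tau>} l \<le> C2" if "\<tau> \<le> T" for \<tau>
    unfolding C2_def
    by (rule integral_subset_le) (use that l0 lii in auto)
  have C2: "0 \<le> C2"
    unfolding C2_def by (rule Henstock_Kurzweil_Integration.integral_nonneg)
      (use l0 lii in auto)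
  obtain q where q: "q \<in> \<rat>" "T < q" using Rats_dense_in_real[of T "T + 1"] by auto
  have qI: "{0..q} \<in> rat_intervals" by (rule rat_intervals_0) (use q T in auto)
  show ?thesis
  proof (intro exI[of _ "C1 + C2"] conjI add_nonneg_nonneg C1(1) C2 allI impI)
    fix e :: real assume e: "0 < e"
    define \<epsilon> where "\<epsilon> = min 1 (e / (2 * (C1 + C2 + 1)))"
    have \<epsilon>: "0 < \<epsilon>" "\<epsilon> \<le> 1" using e C1(1) C2 by (auto simp: \<epsilon>_def)
    have \<epsilon>C: "\<epsilon> * (C1 + C2) \<le> e / 2"
    proof -
      have "\<epsilon> * (C1 + C2) \<le> e / (2 * (C1 + C2 + 1)) * (C1 + C2)"
        by (rule mult_right_mono) (use C1(1) C2 in \<open>auto simp: \<epsilon>_def\<close>)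
      also have "\<dots> \<le> e / 2" using e C1(1) C2 by (simp add: field_simps)
      finally show ?thesis .
    qed
    \<comment> \<open>The net approximates only the delayed state \<open>x (t - 1)\<close>, so
      radius \<open>R\<close> replaces the \<open>2 * R\<close> of a net for pairs.\<close>
    obtain F where F: "finite F" "F \<subseteq> D'" "F \<subseteq> cball 0 (R + 1)"
      "\<And>p. p \<in> cball 0 R \<Longrightarrow> \<exists>d\<in>F. norm (p - d) < \<epsilon>"
      using dense_finite_net[OF D \<epsilon>] by metis
    let ?e1 = "e / (2 * (real (card F) + 1))"
    let ?K = "modulus_class (moduli_of E) j {0..q} :: (real \<Rightarrow> 'a) set"
    have e1: "0 < ?e1" using e by (simp add: add_nonneg_pos)
    have "\<forall>\<^sub>F n in sequentially. \<forall>d\<in>F.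
        (SUP z\<in>?K. \<integral>\<^sup>+t\<in>{0..q}. ennreal (norm (fn n t (z t, d) - f t (z t, d))) \<partial>lebesgue) < ennreal ?e1"
    proof (rule eventually_ball_finite[OF F(1)], rule ballI)
      fix d assume d: "d \<in> F"
      show "\<forall>\<^sub>F n in sequentially.
        (SUP z\<in>?K. \<integral>\<^sup>+t\<in>{0..q}. ennreal (norm (fn n t (z t, d) - f t (z t, d))) \<partial>lebesgue) < ennreal ?e1"
      proof (rule limitin_LC_topology_seminorm[OF lim[unfolded T_Theta_def] f _ _ e1,
            where p = "\<lambda>g. SUP z\<in>?K. \<integral>\<^sup>+t\<in>{0..q}. ennreal (norm (g t (z t, d))) \<partial>lebesgue"])
        show "(SUP z\<in>?K. \<integral>\<^sup>+t\<in>{0..q}. ennreal (norm (0::'a)) \<partial>lebesgue) = 0"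
          by (intro antisym SUP_least) auto
        show "(\<lambda>g :: real \<Rightarrow> 'a \<times> 'a \<Rightarrow> 'a. SUP z\<in>?K. \<integral>\<^sup>+t\<in>{0..q}. ennreal (norm (g t (z t, d))) \<partial>lebesgue)
            \<in> {\<lambda>g. SUP x\<in>modulus_class (moduli_of E) j I. \<integral>\<^sup>+t\<in>I. ennreal (norm (g t (x t, u))) \<partial>lebesgue
                | j I u. I \<in> rat_intervals \<and> u \<in> D'}"
          by (intro CollectI exI[of _ "{0..q}"] exI[of _ j] exI[of _ d]) (use qI d F(2) in auto)
      qed
    qed
    then show "\<forall>\<^sub>F n in sequentially. \<forall>\<tau>. 0 \<le> \<tau> \<longrightarrow> \<tau> \<le> T \<longrightarrow> ereal \<tau> < bn n \<longrightarrow>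
        (\<forall>t\<in>{-1..\<tau>}. norm (xn n t - x t) \<le> 1) \<longrightarrow> rhs_close_upto \<tau> (C1 + C2) e (fn n) (xn n) f x"
    proof (eventually_elim, intro allI impI)
      fix n \<tau> assume small: "\<forall>d\<in>F.
        (SUP z\<in>?K. \<integral>\<^sup>+t\<in>{0..q}. ennreal (norm (fn n t (z t, d) - f t (z t, d))) \<partial>lebesgue) < ennreal ?e1"
        and \<tau>: "0 \<le> \<tau>" "\<tau> \<le> T" "ereal \<tau> < bn n" and near: "\<forall>t\<in>{-1..\<tau>}. norm (xn n t - x t) \<le> 1"
      have fnL: "fn n \<in> LC" using E(1) fn by blast
      have yR: "norm (xn n t) \<le> R" if "t \<in> {-1..\<tau>}" for t by (rule R(3)[OF \<tau>(2) near that])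
      from LC_l2_bound_integrable[OF fnL C1(2)[OF fn \<tau>(2)] C1(1)]
      obtain k where k: "\<forall>t. 0 \<le> k t" "k absolutely_integrable_on {0..\<tau>}" "integral {0..\<tau>} k \<le> C1"
        and aek: "AE t in lebesgue. t \<in> {0..\<tau>} \<longrightarrow> (\<forall>x u1 u2. (x, u1) \<in> ?B \<longrightarrow> (x, u2) \<in> ?B \<longrightarrow>
          norm (fn n t (x, u1) - fn n t (x, u2)) \<le> k t * norm (u1 - u2))"
        by blast
      define z where "z t = xn n (max 0 (min t \<tau>))" for t
      have zK: "z \<in> ?K"
        unfolding z_def
        by (rule clamped_solution_in_modulus_class[OF E(1,2) fn xn \<tau>(1,3) _ q(1) yR]) (use \<tau> q j in auto)
      have zc: "continuous_on {0..\<tau>} z"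
        using zK continuous_on_subset[of "{0..q}" z "{0..\<tau>}"] \<tau> q by (auto simp: modulus_class_def)
      define w where "w d t = norm (fn n t (z t, d) - f t (z t, d))" for d t
      have wa: "w d absolutely_integrable_on {0..\<tau>}" for d
        unfolding w_def
        by (intro absolutely_integrable_norm[unfolded o_def] set_integral_diff
            LC_absolutely_integrable fnL f continuous_on_const continuous_on_Pair zc)
      have wi: "integral {0..\<tau>} (w d) \<le> ?e1" if "d \<in> F" for d
      proof (rule integral_le_of_nn_integral_superset[OF wa, where I = "{0..q}"])
        have "(\<integral>\<^sup>+t\<in>{0..q}. ennreal (w d t) \<partial>lebesgue) \<le>
            (SUP z\<in>?K. \<integral>\<^sup>+t\<in>{0..q}. ennreal (norm (fn n t (z t, d) - f t (z t, d))) \<partial>lebesgue)"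
          unfolding w_def by (rule SUP_upper[OF zK])
        also have "\<dots> \<le> ennreal ?e1" using small that by (simp add: less_imp_le)
        finally show "(\<integral>\<^sup>+t\<in>{0..q}. ennreal (w d t) \<partial>lebesgue) \<le> ennreal ?e1" .
      qed (use \<tau> q e1 in \<open>auto simp: w_def\<close>)
      define h where "h t = \<epsilon> * (k t + l t) + (\<Sum>d\<in>F. w d t)" for t
      have ha: "h absolutely_integrable_on {0..\<tau>}" and hi: "integral {0..\<tau>} h \<le> e"
        unfolding h_def
        by (rule net_error_integral[OF k(2,3) li[rule_format] lC[OF \<tau>(2)] F(1) wa wi _ \<epsilon>C]; use \<epsilon> e in simp)+
      have w0: "0 \<le> w d t" for d t by (simp add: w_def)
      have h0: "0 \<le> h t" for t
        unfolding h_def using k(1) l0 \<epsilon>(1) w0 by (intro add_nonneg_nonneg mult_nonneg_nonneg sum_nonneg) auto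
      have kl: "(\<lambda>t. k t + l t) absolutely_integrable_on {0..\<tau>}" "integral {0..\<tau>} (\<lambda>t. k t + l t) \<le> C1 + C2"
        using k li lC[OF \<tau>(2)] lii set_lebesgue_integral_eq_integral(1)[OF k(2)]
        by (auto intro!: set_integral_add add_mono simp: integral_add)
      have ae: "AE t in lebesgue. t \<in> {0..\<tau>} \<longrightarrow> norm (fn n t (xn n t, xn n (t - 1)) - f t (x t, x (t - 1)))
          \<le> (k t + l t) * (norm (xn n t - x t) + norm (xn n (t - 1) - x (t - 1))) + h t"
        using aek ael
      proof eventually_elim
        case (elim t)
        show ?case
        proof
          assume t: "t \<in> {0..\<tau>}"
          define a where "a = xn n t"
          define u where "u = xn n (t - 1)"
          define u0 where "u0 = x (t - 1)"
          have nR: "norm a \<le> R" "norm u \<le> R" "norm (x t) \<le> R" "norm u0 \<le> R"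
            unfolding a_def u_def u0_def using yR[of t] yR[of "t - 1"] R(2)[of t] R(2)[of "t - 1"] t \<tau> by auto
          obtain d where d: "d \<in> F" "norm (u0 - d) < \<epsilon>" using F(4)[of u0] nR by auto
          have dR: "norm d \<le> R + 1" using d(1) F(3) by auto
          have inB: "(v1, v2) \<in> ?B" if "norm v1 \<le> R" "norm v2 \<le> R + 1" for v1 v2 :: 'a
            using norm_Pair_le[of v1 v2] that j by simp
          have B: "(a, u) \<in> ?B" "(a, u0) \<in> ?B" "(a, d) \<in> ?B" "(x t, u0) \<in> ?B"
            by (rule inB; use nR dR in linarith)+
          have 1: "norm (fn n t (a, u) - fn n t (a, u0)) \<le> k t * norm (u - u0)"
            using elim(1) t B by blast
          have 2: "norm (fn n t (a, u0) - fn n t (a, d)) \<le> \<epsilon> * k t"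
          proof -
            have "norm (fn n t (a, u0) - fn n t (a, d)) \<le> k t * norm (u0 - d)" using elim(1) t B by blast
            also have "\<dots> \<le> k t * \<epsilon>" using d(2) k(1) by (intro mult_left_mono) auto
            finally show ?thesis by (simp add: mult.commute)
          qed
          have 3: "norm (f t (a, d) - f t (a, u0)) \<le> \<epsilon> * l t"
          proof -
            have "norm (f t (a, d) - f t (a, u0)) \<le> l t * norm ((a, d) - (a, u0))" using elim(2) B by blast
            also have "\<dots> \<le> l t * \<epsilon>"
              using d(2) l0 by (intro mult_left_mono) (auto simp: norm_minus_commute norm_Pair)
            finally show ?thesis by (simp add: mult.commute)
          qed
          have 4: "norm (f t (a, u0) - f t (x t, u0)) \<le> l t * norm (a - x t)"
          proof -
            have "norm (f t (a, u0) - f t (x t, u0)) \<le> l t * norm ((a, u0) - (x t, u0))" using elim(2) B by blast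
            then show ?thesis by (simp add: norm_Pair)
          qed
          have "z t = a" using t by (simp add: z_def a_def)
          then have 5: "norm (fn n t (a, d) - f t (a, d)) \<le> (\<Sum>d\<in>F. w d t)"
            using member_le_sum[OF d(1), of "\<lambda>d. w d t"] w0 F(1) by (simp add: w_def)
          \<comment> \<open>The first and the last difference carry the delayed and the current
            deviation and feed the kernel; the three in between form \<open>h\<close>.\<close>
          have "fn n t (a, u) - f t (x t, u0) = (fn n t (a, u) - fn n t (a, u0)) + ((fn n t (a, u0) - fn n t (a, d))
              + ((fn n t (a, d) - f t (a, d)) + ((f t (a, d) - f t (a, u0)) + (f t (a, u0) - f t (x t, u0)))))"
            by simp
          also have "norm \<dots> \<le> k t * norm (u - u0) + (\<epsilon> * k t + ((\<Sum>d\<in>F. w d t) + (\<epsilon> * l t + l t * norm (a - x t))))"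
            by (intro norm_triangle_mono 1 2 3 4 5)
          finally have "norm (fn n t (a, u) - f t (x t, u0)) \<le> \<dots>" .
          \<comment> \<open>The common form has one kernel for both deviations; adding these cross
            terms turns \<open>k\<close> and \<open>l\<close> into the joint factor
            \<open>k + l\<close>.\<close>
          moreover have "0 \<le> k t * norm (a - x t)" "0 \<le> l t * norm (u - u0)"
            using k(1) l0 by auto
          ultimately have "norm (fn n t (a, u) - f t (x t, u0)) \<le>
              (k t + l t) * (norm (a - x t) + norm (u - u0)) + h t"
            unfolding h_def distrib_left distrib_right by linarith
          then show "norm (fn n t (xn n t, xn n (t - 1)) - f t (x t, x (t - 1)))
              \<le> (k t + l t) * (norm (xn n t - x t) + norm (xn n (t - 1) - x (t - 1))) + h t"
            by (simp add: a_def u_def u0_def)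
        qed
      qed
      show "rhs_close_upto \<tau> (C1 + C2) e (fn n) (xn n) f x"
        unfolding rhs_close_upto_def
        by (rule exI[of _ "\<lambda>t. k t + l t"], rule exI[of _ h]) (use k(1) l0 kl h0 ha hi ae in simp)
    qed
  qed
qed

theorem proposition4p7:
  fixes E :: "(real \<Rightarrow> (real^'n) \<times> (real^'n) \<Rightarrow> real^'n) set"
    and D' :: "(real^'n) set"
    and D :: "((real^'n) \<times> (real^'n)) set"
  assumes "E \<subseteq> LC"
    and "countable D'" and "closure D' = UNIV"
    and "countable D" and "closure D = UNIV"
  shows
    "(equicontinuous_m_bounds E \<and> bounded_l2_bounds E \<longrightarrow>
        (\<forall>fn f \<phi>n \<phi>. (\<forall>n. fn n \<in> E) \<longrightarrow> f \<in> LC \<longrightarrow>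
           limitin (T_Theta (moduli_of E) D') fn f sequentially \<longrightarrow>
           (\<forall>n. continuous_on {-1..0} (\<phi>n n)) \<longrightarrow> continuous_on {-1..0} \<phi> \<longrightarrow>
           uniform_limit {-1..0} \<phi>n \<phi> sequentially \<longrightarrow>
           solutions_converge fn \<phi>n f \<phi>)) \<and>
     (bounded_l_bounds E \<longrightarrow>
        (\<forall>fn f \<phi>n \<phi>. (\<forall>n. fn n \<in> E) \<longrightarrow> f \<in> LC \<longrightarrow>
           limitin (T_D D) fn f sequentially \<longrightarrow>
           (\<forall>n. continuous_on {-1..0} (\<phi>n n)) \<longrightarrow> continuous_on {-1..0} \<phi> \<longrightarrow>
           uniform_limit {-1..0} \<phi>n \<phi> sequentially \<longrightarrow>
           solutions_converge fn \<phi>n f \<phi>))"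
proof (intro conjI impI allI, goal_cases)
  case (1 fn f \<phi>n \<phi>)
  show ?case
  proof (rule solutions_convergeI)
    show "fn n \<in> LC" for n using 1 assms(1) by blast
    show "uniform_limit {-1..0} \<phi>n \<phi> sequentially" by (rule 1)
  qed (rule rhs_close_T_Theta[of E D'], use 1 assms in auto)
next
  case (2 fn f \<phi>n \<phi>)
  show ?case
  proof (rule solutions_convergeI)
    show "fn n \<in> LC" for n using 2 assms(1) by blast
    show "uniform_limit {-1..0} \<phi>n \<phi> sequentially" by (rule 2)
  qed (rule rhs_close_T_D[of E D], use 2 assms in auto)
qed

end
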